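(* Assume that $\mu_{X_n}$ converges almost surely weakly to a non-random compactly supported probability measure $\mu_X$, that the largest singular value of $X_n$ converges almost surely to $b$, the supremum of the support of $\mu_X$, and that $\nu$ has mean zero, variance one and satisfies a log-Sobolev inequality. Let $r=1$, i.e. let the perturbation $P_n$ have rank one, built according to either the i.i.d. model or the orthonormalized model, and let the sole (non-zero) singular value of $P_n$ be denoted by $\theta$. Suppose that $$\theta\le\overline\theta\qquad\text{and}\qquad\varphi_{\mu_X}'(b^+)=-\infty.$$ For each $n$, let $\widetilde u$ and $\widetilde v$ denote, respectively, left and right unit singular vectors of $\widetilde X_n=X_n+P_n$ associated with its largest singular value. Then, as $n\to\infty$, $$\langle\widetilde u,\ker(\theta^2I_n-P_nP_n^* )\rangle\xrightarrow{\ \mathrm{a.s.}\ }0\qquad\text{and}\qquad\langle\widetilde v,\ker(\theta^2I_m-P_n^*P_n)\rangle\xrightarrow{\ \mathrm{a.s.}\ }0.$$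
   Context: Let $\mathbb K=\mathbb R$ or $\mathbb C$. For each $n$, let $m=m_n\ge n$ be an integer, with $n/m_n\to c\in[0,1]$ as $n\to\infty$. $X_n$ is an $n\times m$ real or complex random matrix with singular values $\sigma_1\ge\cdots\ge\sigma_n$, and $\mu_{X_n}=\frac1n\sum_{i=1}^n\delta_{\sigma_i}$ is its empirical singular value distribution. Perturbation (case $r=1$). Let $\theta_1>0$ be a deterministic real number chosen independently of $n$, and let $\nu$ be a fixed probability measure on $\mathbb K$. For every $n$ let $G_u^{(n)}$ (of size $n\times1$) and $G_v^{(n)}$ (of size $m\times1$) be independent, with i.i.d. entries of law $\nu$, and independent of $X_n$. In the i.i.d. model, $u_1=\frac1{\sqrt n}G_u^{(n)}$ and $v_1=\frac1{\sqrt m}G_v^{(n)}$. In the orthonormalized model, $u_1$ and $v_1$ are obtained from $G_u^{(n)}$ and $G_v^{(n)}$ by Gram-Schmidt, i.e. by normalizing them to have norm one (well defined with probability tending to one). Set $P_n=\theta_1u_1v_1^*$ and $\widetilde X_n=X_n+P_n$. The sole non-zero singular value $\theta$ of $P_n$ is $\theta_1\|u_1\|\,\|v_1\|$; in the orthonormalized model it equals $\theta_1$. Log-Sobolev inequality: there is a constant $C>0$ such that $\int f^2\log\frac{f^2}{\int f^2d\nu}\,d\nu\le 2C\int|\nabla f|^2d\nu$ for all continuously differentiable $f\in L^2(\nu)$ (with $\mathbb C$ identified with $\mathbb R^2$). $\varphi_{\mu_X}(z)=\int\frac{z}{z^2-t^2}d\mu_X(t)$ and $\varphi_{\mu_X}'(b^+)=\lim_{z\downarrow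 b}\varphi_{\mu_X}'(z)$. For $z>b$, $$D_{\mu_X}(z)=\Big[\int\frac{z}{z^2-t^2}d\mu_X(t)\Big]\times\Big[c\int\frac{z}{z^2-t^2}d\mu_X(t)+\frac{1-c}{z}\Big],$$ $D_{\mu_X}(b^+)=\lim_{z\downarrow b}D_{\mu_X}(z)$, and $\overline\theta=(D_{\mu_X}(b^+))^{-1/2}$ with the convention $(+\infty)^{-1/2}=0$. For a unit vector $x$ and a subspace $F$, $\langle x,F\rangle$ denotes the norm of the orthogonal projection of $x$ onto $F$. The convergence $\xrightarrow{\ \mathrm{a.s.}\ }$ is almost sure convergence. *)

theory Defs
  imports
    "HOL-Probability.Probability"
    "Jordan_Normal_Form.Schur_Decomposition"
    "Jordan_Normal_Form.Matrix_Kernel"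
begin

unbundle no vec_syntax
hide_type (open) Finite_Cartesian_Product.vec
hide_const (open) Finite_Cartesian_Product.vec

text \<open>
  The scalar fields: a finite-dimensional normed field over the reals whose conjugation satisfies
  the identity below is isometrically isomorphic to the reals or to the complex numbers, with the
  usual conjugation. Both are instances.
\<close>

class real_or_complex = real_normed_field + euclidean_space + conjugatable_field +
  assumes mult_conjugate: "x * conjugate x = (norm x)\<^sup>2 *\<^sub>R 1"

instance real :: real_or_complex
  by standard (simp add: power2_eq_square)

instance complex :: real_or_complex
  by standard (simp add: complex_norm_square[symmetric] scaleR_conv_of_real)

definition vnorm :: "'a::real_or_complex vec \<Rightarrow> real" where
  "vnorm x = sqrt (\<Sum>i<dim_vec x. (norm (x $ i))\<^sup>2)"

text \<open>
  The singular values in decreasing order: the square roots of the eigenvalues of \<open>A A\<^sup>*\<close>, repeated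
  according to multiplicity. This list has length \<open>dim_row A\<close>, which is the usual convention for
  \<open>n \<times> m\<close> matrices with \<open>n \<le> m\<close>.
\<close>

definition singular_values :: "'a::real_or_complex mat \<Rightarrow> real list" where
  "singular_values A = (THE s. sorted_wrt (\<ge>) s \<and> (\<forall>x\<in>set s. 0 \<le> x) \<and>
     char_poly (A * mat_adjoint A) = (\<Prod>x\<leftarrow>s. [:- of_real (x\<^sup>2), 1:]))"

definition singular_vectors :: "'a::real_or_complex mat \<Rightarrow> real \<Rightarrow> 'a vec \<Rightarrow> 'a vec \<Rightarrow> bool" where
  "singular_vectors A s x y \<longleftrightarrow>
     x \<in> carrier_vec (dim_row A) \<and> y \<in> carrier_vec (dim_col A) \<and> vnorm x = 1 \<and> vnorm y = 1 \<and>
     A *\<^sub>v y = of_real s \<cdot>\<^sub>v x \<and> mat_adjoint A *\<^sub>v x = of_real s \<cdot>\<^sub>v y"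

definition orth_proj :: "'a::real_or_complex vec set \<Rightarrow> 'a vec \<Rightarrow> 'a vec" where
  "orth_proj F x = (THE p. p \<in> F \<and> (\<forall>w\<in>F. (x - p) \<bullet>c w = 0))"

definition proj_norm :: "'a::real_or_complex vec \<Rightarrow> 'a vec set \<Rightarrow> real" where
  "proj_norm x F = vnorm (orth_proj F x)"

definition rank_one_mat :: "real \<Rightarrow> 'a::real_or_complex vec \<Rightarrow> 'a vec \<Rightarrow> 'a mat" where
  "rank_one_mat t u v =
     mat (dim_vec u) (dim_vec v) (\<lambda>(i, j). of_real t * u $ i * conjugate (v $ j))"

definition empirical_sv :: "'a::real_or_complex mat \<Rightarrow> real measure" where
  "empirical_sv A = distr (uniform_count_measure {..<length (singular_values A)}) borel
     (\<lambda>i. singular_values A ! i)"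

definition msupport :: "real measure \<Rightarrow> real set" where
  "msupport \<mu> = {x. \<forall>e>0. emeasure \<mu> (ball x e) > 0}"

definition phi :: "real measure \<Rightarrow> real \<Rightarrow> real" where
  "phi \<mu> z = (\<integral>t. z / (z\<^sup>2 - t\<^sup>2) \<partial>\<mu>)"

definition D_transform :: "real \<Rightarrow> real measure \<Rightarrow> real \<Rightarrow> real" where
  "D_transform c \<mu> z = (\<integral>t. z / (z\<^sup>2 - t\<^sup>2) \<partial>\<mu>) * (c * (\<integral>t. z / (z\<^sup>2 - t\<^sup>2) \<partial>\<mu>) + (1 - c) / z)"

definition D_limit :: "real \<Rightarrow> real measure \<Rightarrow> real \<Rightarrow> ereal" where
  "D_limit c \<mu> b = Lim (at_right b) (\<lambda>z. ereal (D_transform c \<mu> z))"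

definition theta_bar :: "real \<Rightarrow> real measure \<Rightarrow> real \<Rightarrow> real" where
  "theta_bar c \<mu> b =
     (if D_limit c \<mu> b = \<infinity> then 0 else real_of_ereal (D_limit c \<mu> b) powr (- 1 / 2))"

text \<open>
  The inequality only constrains test functions with a finite right-hand side. For those, it
  contains the finiteness of the left-hand side, which has to be stated separately because a
  Bochner integral that does not exist is zero. The negative part of the left integrand is always
  integrable, and \<open>0 ln 0 = 0\<close> in HOL.
\<close>

definition log_sobolev :: "'a::euclidean_space measure \<Rightarrow> bool" where
  "log_sobolev \<nu> \<longleftrightarrow> (\<exists>C>0. \<forall>(f :: 'a \<Rightarrow> real) g.
     (\<forall>x. GDERIV f x :> g x) \<longrightarrow> continuous_on UNIV g \<longrightarrow>
     integrable \<nu> (\<lambda>x. (f x)\<^sup>2) \<longrightarrow> integrable \<nu> (\<lambda>x. (norm (g x))\<^sup>2) \<longrightarrow>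
     integrable \<nu> (\<lambda>x. (f x)\<^sup>2 * ln ((f x)\<^sup>2 / (\<integral>y. (f y)\<^sup>2 \<partial>\<nu>))) \<and>
     (\<integral>x. (f x)\<^sup>2 * ln ((f x)\<^sup>2 / (\<integral>y. (f y)\<^sup>2 \<partial>\<nu>)) \<partial>\<nu>) \<le> 2 * C * (\<integral>x. (norm (g x))\<^sup>2 \<partial>\<nu>))"

datatype perturbation_model = IID | Orthonormalized

text \<open>
  For a single vector, Gram-Schmidt is normalization. It is undefined at the zero vector, which is
  mapped to itself here.
\<close>

fun model_vec :: "perturbation_model \<Rightarrow> 'a::real_or_complex vec \<Rightarrow> 'a vec" where
  "model_vec IID g = of_real (1 / sqrt (real (dim_vec g))) \<cdot>\<^sub>v g"
| "model_vec Orthonormalized g = of_real (1 / vnorm g) \<cdot>\<^sub>v g"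

definition entries :: "'a vec \<Rightarrow> 'a vec \<Rightarrow> nat + nat \<Rightarrow> 'a" where
  "entries x y k = (case k of Inl i \<Rightarrow> x $ i | Inr j \<Rightarrow> y $ j)"

end

theory Submission
  imports Defs
begin

text \<open>
  Let \<open>H\<close> be the Hermitian dilation of \<open>X\<^sub>n\<close>, put \<open>a = (u, 0)\<close>, \<open>d = (0, v)\<close>, and let \<open>w\<close> collect the two
  singular vectors of the perturbed matrix, with singular value \<open>\<sigma>\<close>. Then
  \<open>(\<sigma> - H) w = \<alpha> a + \<beta> d\<close> with \<open>\<alpha> = \<theta> (d, w)\<close> and \<open>\<beta> = \<theta> (a, w)\<close>. All resolvents \<open>R = (z - H)\<^sup>-\<^sup>1\<close> are
  taken at fixed points \<open>z > b\<close>, where \<open>(a, R a)\<close>, \<open>(d, R d)\<close> and \<open>(a, R d)\<close> converge to \<open>\<phi>(z)\<close>, \<open>c \<phi>(z) + (1 - c)/z\<close>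
  and \<open>0\<close>, and never at the random point \<open>\<sigma>\<close>, which may fall inside the spectrum of \<open>H\<close>. The identity
  \<open>R (\<alpha> a + \<beta> d) = w + (\<sigma> - z) R w\<close> bounds the left side uniformly in \<open>z\<close> once \<open>\<sigma>\<close> is known to converge to the
  edge, and the resolvent identity turns this bound into \<open>|\<alpha>|\<^sup>2\<close> times a difference quotient of \<open>\<phi>\<close>; as
  \<open>\<phi>'\<close> diverges at the edge, \<open>\<alpha>\<close> tends to zero. Pairing the identity with \<open>a\<close> gives the same for \<open>\<beta>\<close>, since
  \<open>\<phi>\<close> stays bounded at the edge.

  The log-Sobolev inequality enters only through finite moments: they bound the fourth moment of a
  centred quadratic form by the fourth power of its Hilbert-Schmidt norm, which is summable after scaling.
\<close>

section \<open>Resolvents of Hermitian kernels\<close>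

text \<open>The convergence of \<sigma> to the edge takes two separate arguments. From above: if
  \<sigma> \<ge> z, the Cauchy-Schwarz inequality of the form \<open>z - H\<close> forces \<theta>^2
  D(z) \<ge> 1 in the limit, whereas D is strictly decreasing, so \<theta>^2 D(z) < 1 at every z > b
  even when \<theta> equals the threshold. From below: \<open>R a\<close> is a trial vector for the
  largest eigenvalue of the perturbed dilation, and a \<sigma> staying below the edge would bound
  the slope of \<phi>. The divergence of \<phi>' is thus used twice. A positive \<theta> below the
  threshold makes D finite at the edge, and this is what keeps \<phi> bounded there.

  The limits of the random forms hold almost surely for countably many z at a time. Hence the points
  b + 1/(k+1), difference quotients in place of derivatives, and the order of choice: k from the
  tolerance, then n.

  Both scalar fields are treated at once by an embedding into the complex numbers that preserves
  norm, conjugation and characteristic polynomials; the law of the noise stays on the original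
  field.\<close>

definition ip :: "'i set \<Rightarrow> ('i \<Rightarrow> complex) \<Rightarrow> ('i \<Rightarrow> complex) \<Rightarrow> complex" where
  "ip I x y = (\<Sum>i\<in>I. cnj (x i) * y i)"

definition nrm :: "'i set \<Rightarrow> ('i \<Rightarrow> complex) \<Rightarrow> real" where
  "nrm I x = sqrt (\<Sum>i\<in>I. (cmod (x i))\<^sup>2)"

definition mv :: "'i set \<Rightarrow> ('i \<Rightarrow> 'i \<Rightarrow> complex) \<Rightarrow> ('i \<Rightarrow> complex) \<Rightarrow> 'i \<Rightarrow> complex" where
  "mv I A x i = (\<Sum>j\<in>I. A i j * x j)"

lemma nrm_nonneg [simp]: "0 \<le> nrm I x"
  by (simp add: nrm_def sum_nonneg)

lemma nrm_sq: "(nrm I x)\<^sup>2 = (\<Sum>i\<in>I. (cmod (x i))\<^sup>2)"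
  by (simp add: nrm_def sum_nonneg)

lemma ip_self: "ip I x x = of_real ((nrm I x)\<^sup>2)"
  unfolding ip_def nrm_sq of_real_sum
  by (intro sum.cong refl) (metis complex_norm_square mult.commute)

lemma ip_sym: "ip I y x = cnj (ip I x y)"
  by (simp add: ip_def mult.commute)

lemma ip_cong: "(\<And>i. i \<in> I \<Longrightarrow> x i = x' i) \<Longrightarrow> (\<And>i. i \<in> I \<Longrightarrow> y i = y' i) \<Longrightarrow> ip I x y = ip I x' y'"
  by (simp add: ip_def)

lemma ip_add_right: "ip I x (\<lambda>i. y i + z i) = ip I x y + ip I x z"
  by (simp add: ip_def algebra_simps sum.distrib)

lemma ip_diff_right: "ip I x (\<lambda>i. y i - z i) = ip I x y - ip I x z"
  by (simp add: ip_def algebra_simps sum_subtractf)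

lemma ip_scale_right: "ip I x (\<lambda>i. k * y i) = k * ip I x y"
  by (simp add: ip_def algebra_simps sum_distrib_left)

lemma ip_add_left: "ip I (\<lambda>i. y i + z i) x = ip I y x + ip I z x"
  by (simp add: ip_def algebra_simps sum.distrib)

lemma ip_diff_left: "ip I (\<lambda>i. y i - z i) x = ip I y x - ip I z x"
  by (simp add: ip_def algebra_simps sum_subtractf)

lemma ip_scale_left: "ip I (\<lambda>i. k * y i) x = cnj k * ip I y x"
  by (simp add: ip_def algebra_simps sum_distrib_left)

lemmas ip_linear = ip_add_right ip_diff_right ip_scale_right ip_add_left ip_diff_left ip_scale_left

lemma ip_Cauchy_Schwarz: "cmod (ip I x y) \<le> nrm I x * nrm I y"
proof -
  have "cmod (ip I x y) \<le> (\<Sum>i\<in>I. cmod (x i) * cmod (y i))"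
    unfolding ip_def by (rule order_trans[OF norm_sum]) (simp add: norm_mult)
  also have "\<dots> \<le> sqrt ((\<Sum>i\<in>I. (cmod (x i))\<^sup>2) * (\<Sum>i\<in>I. (cmod (y i))\<^sup>2))"
    by (rule real_le_rsqrt) (rule Cauchy_Schwarz_ineq_sum)
  finally show ?thesis by (simp add: nrm_def real_sqrt_mult)
qed

lemma nrm_scale: "nrm I (\<lambda>i. k * x i) = cmod k * nrm I x"
  by (simp add: nrm_def norm_mult power_mult_distrib sum_distrib_left[symmetric] real_sqrt_mult)

lemma nrm_triangle: "nrm I (\<lambda>i. x i + y i) \<le> nrm I x + nrm I y"
proof (rule power2_le_imp_le)
  have "(nrm I (\<lambda>i. x i + y i))\<^sup>2 = Re (ip I (\<lambda>i. x i + y i) (\<lambda>i. x i + y i))"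
    by (simp add: ip_self)
  also have "\<dots> = (nrm I x)\<^sup>2 + (nrm I y)\<^sup>2 + 2 * Re (ip I x y)"
    using ip_sym[of I y x] by (simp add: ip_add_right ip_add_left) (simp add: ip_self)
  also have "Re (ip I x y) \<le> nrm I x * nrm I y"
    using ip_Cauchy_Schwarz[of I x y] complex_Re_le_cmod order_trans by blast
  finally show "(nrm I (\<lambda>i. x i + y i))\<^sup>2 \<le> (nrm I x + nrm I y)\<^sup>2"
    by (simp add: power2_sum algebra_simps)
qed simp

lemma nrm_eq_0: "finite I \<Longrightarrow> nrm I x = 0 \<longleftrightarrow> (\<forall>i\<in>I. x i = 0)"
  by (simp add: nrm_def sum_nonneg_eq_0_iff)

lemma mv_linear:
  "mv I A (\<lambda>i. x i + y i) i = mv I A x i + mv I A y i"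
  "mv I A (\<lambda>i. x i - y i) i = mv I A x i - mv I A y i"
  "mv I A (\<lambda>i. k * x i) i = k * mv I A x i"
  by (simp_all add: mv_def algebra_simps sum.distrib sum_subtractf sum_distrib_left)

lemma mv_cong: "(\<And>i. i \<in> I \<Longrightarrow> x i = x' i) \<Longrightarrow> mv I A x = mv I A x'"
  by (rule ext) (simp add: mv_def)

text \<open>Only an upper bound \<open>s\<close> of the spectrum is recorded, because every
  resolvent point lies above it. Vectors are total functions whose values outside \<open>I\<close>
  are ignored.\<close>

locale hermitian_op =
  fixes I :: "'i set" and H :: "'i \<Rightarrow> 'i \<Rightarrow> complex" and s :: real
  assumes fin: "finite I"
    and herm: "i \<in> I \<Longrightarrow> j \<in> I \<Longrightarrow> H j i = cnj (H i j)"
    and bound: "Re (ip I x (mv I H x)) \<le> s * (nrm I x)\<^sup>2"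
begin

lemma ip_herm: "ip I x (mv I H y) = ip I (mv I H x) y"
proof -
  have "ip I x (mv I H y) = (\<Sum>i\<in>I. \<Sum>j\<in>I. cnj (x i) * H i j * y j)"
    by (simp add: ip_def mv_def sum_distrib_left mult.assoc)
  also have "\<dots> = (\<Sum>j\<in>I. \<Sum>i\<in>I. cnj (x i) * H i j * y j)" by (rule sum.swap)
  also have "\<dots> = (\<Sum>j\<in>I. \<Sum>i\<in>I. cnj (H j i * x i) * y j)"
  proof (intro sum.cong refl)
    fix j i assume "j \<in> I" "i \<in> I"
    hence "cnj (H j i) = H i j" using herm[of j i] by simp
    thus "cnj (x i) * H i j * y j = cnj (H j i * x i) * y j" by simp
  qed
  also have "\<dots> = ip I (mv I H x) y"
    by (simp add: ip_def mv_def sum_distrib_right)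
  finally show ?thesis .
qed

end

text \<open>\<open>R\<close> is only asked to be a right inverse of \<open>z - H\<close>;
  self-adjointness makes it two-sided in \<open>res_left_inverse\<close>.\<close>

locale resolvent = hermitian_op +
  fixes z :: real and R :: "'a \<Rightarrow> 'a \<Rightarrow> complex"
  assumes z_gt: "s < z"
    and inverse: "i \<in> I \<Longrightarrow> of_real z * mv I R x i - mv I H (mv I R x) i = x i"
begin

abbreviation "K \<equiv> mv I R"

lemma ip_inverse:
  "ip I y (\<lambda>i. of_real z * K x i - mv I H (K x) i) = ip I y x"
  "ip I (\<lambda>i. of_real z * K x i - mv I H (K x) i) y = ip I x y"
  by (auto intro!: ip_cong simp: inverse)

lemma ip_res: "ip I (K x) y = ip I x (K y)"
proof -
  have "ip I (K x) y = ip I (K x) (\<lambda>i. of_real z * K y i - mv I H (K y) i)"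
    by (simp add: ip_inverse)
  also have "\<dots> = ip I (\<lambda>i. of_real z * K x i - mv I H (K x) i) (K y)"
    by (simp add: ip_linear ip_herm)
  finally show ?thesis by (simp add: ip_inverse)
qed

text \<open>With \<open>y = K x\<close> the right side is the form of \<open>z - H\<close> at
  \<open>y\<close>, and \<open>z - H\<close> is at least \<open>z - s\<close>.\<close>

lemma res_coercive: "(z - s) * (nrm I (K x))\<^sup>2 \<le> Re (ip I x (K x))"
proof -
  have "ip I x (K x) = ip I (\<lambda>i. of_real z * K x i - mv I H (K x) i) (K x)"
    by (simp add: ip_inverse)
  also have "\<dots> = of_real (z * (nrm I (K x))\<^sup>2) - ip I (K x) (mv I H (K x))"
    by (simp add: ip_linear ip_herm ip_self)
  finally have "Re (ip I x (K x)) = z * (nrm I (K x))\<^sup>2 - Re (ip I (K x) (mv I H (K x)))"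
    by simp
  with bound[of "K x"] show ?thesis by (simp add: algebra_simps)
qed

lemma res_real: "ip I x (K x) = of_real (Re (ip I x (K x)))"
proof -
  have "ip I x (K x) = cnj (ip I x (K x))"
    using ip_sym[of I x "K x"] ip_res[of x x] by simp
  thus ?thesis by (simp add: complex_eq_iff)
qed

lemma res_pos: "0 \<le> Re (ip I x (K x))"
  using res_coercive[of x] z_gt
  by (meson diff_ge_0_iff_ge less_imp_le mult_nonneg_nonneg order_trans zero_le_power2)

lemma nrm_res: "nrm I (K x) \<le> nrm I x / (z - s)"
proof (cases "nrm I (K x) = 0")
  case False
  hence pos: "nrm I (K x) > 0" using nrm_nonneg[of I "K x"] by linarith
  have "(z - s) * (nrm I (K x))\<^sup>2 \<le> nrm I x * nrm I (K x)"
    using res_coercive[of x] ip_Cauchy_Schwarz[of I x "K x"] complex_Re_le_cmod[of "ip I x (K x)"]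
    by linarith
  hence "(z - s) * nrm I (K x) \<le> nrm I x"
    using pos by (simp add: power2_eq_square)
  thus ?thesis using z_gt by (simp add: field_simps)
qed (use z_gt in simp)

lemma nrm_res_sq: "(nrm I (K x))\<^sup>2 \<le> (nrm I x)\<^sup>2 / (z - s)\<^sup>2"
  using power_mono[OF nrm_res nrm_nonneg, of x 2] by (simp add: power_divide)

text \<open>The defect is orthogonal to every vector: moving \<open>K\<close> and \<open>H\<close>
  to the other side of the inner product turns the claim into the right inverse property.\<close>

lemma res_left_inverse:
  assumes "i \<in> I" shows "of_real z * K x i - K (mv I H x) i = x i"
proof -
  define d where "d i = of_real z * K x i - K (mv I H x) i - x i" for i
  have "ip I y d = 0" for y
  proof -
    have "ip I y d = of_real z * ip I (K y) x - ip I (mv I H (K y)) x - ip I y x"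
      unfolding d_def by (simp add: ip_linear ip_res[symmetric] ip_herm)
    also have "\<dots> = ip I (\<lambda>i. of_real z * K y i - mv I H (K y) i) x - ip I y x"
      by (simp add: ip_linear)
    also have "\<dots> = 0" by (simp add: ip_inverse)
    finally show ?thesis .
  qed
  from this[of d] have "nrm I d = 0" by (simp add: ip_self)
  thus ?thesis using assms fin by (simp add: nrm_eq_0 d_def)
qed

text \<open>This is Cauchy-Schwarz for the positive form of \<open>z - H\<close>, applied to
  \<open>K f\<close> and \<open>w\<close>, because \<open>(f, w)\<close> is the value of that form
  at the pair.\<close>

lemma res_Cauchy_Schwarz:
  assumes "0 < Re (ip I f (K f))"
  shows "(cmod (ip I f w))\<^sup>2 \<le> Re (ip I f (K f)) * (z * (nrm I w)\<^sup>2 - Re (ip I w (mv I H w)))"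
proof -
  define p where "p = Re (ip I f (K f))"
  \<comment> \<open>This \<open>t\<close> minimizes the form of \<open>z - H\<close> along the
    vectors \<open>w - t K f\<close>; nonnegativity at the minimum is the claim.\<close>
  define t where "t = ip I f w / of_real p"
  define y where "y i = w i - t * K f i" for i
  have p: "p > 0" using assms by (simp add: p_def)
  have Kff: "ip I f (K f) = of_real p" "ip I (K f) f = of_real p"
    using res_real[of f] ip_res[of f f] by (simp_all add: p_def)
  have Hy: "ip I x (\<lambda>i. of_real z * y i - mv I H y i) =
      of_real z * ip I x w - ip I x (mv I H w) - t * ip I x f" for x
  proof -
    have "ip I x (\<lambda>i. of_real z * y i - mv I H y i) =
       ip I x (\<lambda>i. (of_real z * w i - mv I H w i) - t * (of_real z * K f i - mv I H (K f) i))"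
      unfolding y_def by (intro ip_cong refl) (simp add: mv_linear algebra_simps)
    also have "\<dots> = of_real z * ip I x w - ip I x (mv I H w) - t * ip I x (\<lambda>i. of_real z * K f i - mv I H (K f) i)"
      by (simp only: ip_diff_right ip_scale_right)
    finally show ?thesis by (simp add: ip_inverse)
  qed
  have Kfw: "ip I (K f) (mv I H w) = of_real z * ip I (K f) w - ip I f w"
  proof -
    have "ip I (\<lambda>i. of_real z * K f i - mv I H (K f) i) w = ip I f w" by (simp add: ip_inverse)
    thus ?thesis by (simp add: ip_linear ip_herm algebra_simps)
  qed
  have "0 \<le> Re (ip I y (\<lambda>i. of_real z * y i - mv I H y i))"
    using bound[of y] mult_right_mono[of s z "(nrm I y)\<^sup>2"] z_gt
    by (simp add: ip_diff_right ip_scale_right) (simp add: ip_self)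
  also have "ip I y (\<lambda>i. of_real z * y i - mv I H y i) =
     of_real z * ip I y w - ip I y (mv I H w) - t * ip I y f" by (rule Hy)
  also have "\<dots> = (of_real z * ip I w w - ip I w (mv I H w) - t * ip I w f)
     - cnj t * (of_real z * ip I (K f) w - ip I (K f) (mv I H w) - t * of_real p)"
    unfolding y_def by (simp add: ip_diff_left ip_scale_left Kff algebra_simps)
  also have "\<dots> = of_real z * ip I w w - ip I w (mv I H w) - t * ip I w f - cnj t * (ip I f w - t * of_real p)"
    by (simp add: Kfw)
  also have "ip I f w - t * of_real p = 0" using p by (simp add: t_def)
  also have "t * ip I w f = of_real ((cmod (ip I f w))\<^sup>2 / p)"
    using ip_sym[of I w f] by (simp add: t_def flip: complex_norm_square)
  finally have "0 \<le> z * (nrm I w)\<^sup>2 - Re (ip I w (mv I H w)) - (cmod (ip I f w))\<^sup>2 / p"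
    by (simp add: ip_self)
  thus ?thesis using p by (simp add: field_simps p_def)
qed

end

lemma resolvent_identity:
  assumes "resolvent I H s z R" "resolvent I H s z' R'"
  shows "ip I x (mv I R y) - ip I x (mv I R' y) = of_real (z' - z) * ip I (mv I R' x) (mv I R y)"
proof -
  interpret A: resolvent I H s z R by fact
  interpret B: resolvent I H s z' R' by fact
  have 1: "ip I x (mv I R' y) = of_real z * ip I (B.K x) (A.K y) - ip I (B.K x) (mv I H (A.K y))"
    using A.ip_inverse(1)[of "B.K x" y] by (simp add: ip_linear B.ip_res)
  have 2: "ip I x (mv I R y) = of_real z' * ip I (B.K x) (A.K y) - ip I (B.K x) (mv I H (A.K y))"
    using B.ip_inverse(2)[of x "A.K y"] by (simp add: ip_linear A.ip_herm)
  show ?thesis unfolding 1 2 by (simp add: algebra_simps)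
qed

locale spiked_resolvent = resolvent I H s z R
  for I :: "'i set" and H s z R +
  fixes a b w :: "'i \<Rightarrow> complex" and t \<sigma> :: real
  assumes t_pos: "0 < t"
    and eigen: "i \<in> I \<Longrightarrow>
      of_real \<sigma> * w i = mv I H w i + of_real t * (a i * ip I b w + b i * ip I a w)"
    and top: "Re (ip I y (mv I H y)) + 2 * t * Re (ip I y a * ip I b y) \<le> \<sigma> * (nrm I y)\<^sup>2"
begin

abbreviation "p \<equiv> Re (ip I a (K a))"
abbreviation "q \<equiv> Re (ip I b (K b))"
abbreviation "e \<equiv> cmod (ip I a (K b))"
abbreviation "\<alpha> \<equiv> of_real t * ip I b w"
abbreviation "\<beta> \<equiv> of_real t * ip I a w"

lemma res_spike:
  assumes "i \<in> I"
  shows "K (\<lambda>i. \<alpha> * a i + \<beta> * b i) i = w i + of_real (\<sigma> - z) * K w i"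
proof -
  have "K (\<lambda>i. \<alpha> * a i + \<beta> * b i) i = K (\<lambda>i. of_real \<sigma> * w i - mv I H w i) i"
    by (rule fun_cong[OF mv_cong]) (simp add: eigen algebra_simps)
  also have "\<dots> = of_real \<sigma> * K w i - K (mv I H w) i"
    by (simp add: mv_linear)
  also have "K (mv I H w) i = of_real z * K w i - w i"
    using res_left_inverse[OF assms, of w] by (simp add: algebra_simps)
  finally show ?thesis by (simp add: algebra_simps)
qed

text \<open>The bound does not blow up near the edge as long as |\<sigma> - z| is comparable with
  \<open>z - s\<close>.\<close>

lemma nrm_res_spike:
  "nrm I (K (\<lambda>i. \<alpha> * a i + \<beta> * b i)) \<le> nrm I w * (1 + \<bar>\<sigma> - z\<bar> / (z - s))"
proof -
  have "nrm I (K (\<lambda>i. \<alpha> * a i + \<beta> * b i)) = nrm I (\<lambda>i. w i + of_real (\<sigma> - z) * K w i)"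
    by (simp add: nrm_def res_spike)
  also have "\<dots> \<le> nrm I w + \<bar>\<sigma> - z\<bar> * nrm I (K w)"
    using nrm_triangle[of I w "\<lambda>i. of_real (\<sigma> - z) * K w i"]
    by (simp only: nrm_scale norm_of_real)
  also have "\<dots> \<le> nrm I w + \<bar>\<sigma> - z\<bar> * (nrm I w / (z - s))"
    by (intro add_left_mono mult_left_mono nrm_res) simp
  finally show ?thesis by (simp add: algebra_simps)
qed

text \<open>The mixed terms are a number and its conjugate, of modulus at most the product of the
  coefficients and \<open>e\<close>; in the application \<open>e\<close> tends to zero, so the form
  becomes diagonal.\<close>

lemma res_spike_form:
  "\<bar>Re (ip I (\<lambda>i. \<gamma> * a i + \<delta> * b i) (K (\<lambda>i. \<gamma> * a i + \<delta> * b i)))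
    - ((cmod \<gamma>)\<^sup>2 * p + (cmod \<delta>)\<^sup>2 * q)\<bar> \<le> 2 * cmod \<gamma> * cmod \<delta> * e"
proof -
  have K: "K (\<lambda>i. \<gamma> * a i + \<delta> * b i) = (\<lambda>i. \<gamma> * K a i + \<delta> * K b i)"
    by (rule ext) (simp add: mv_linear)
  have 1: "ip I b (K a) = cnj (ip I a (K b))"
    using ip_sym[of I b "K a"] by (simp add: ip_res)
  define W where "W = cnj \<gamma> * \<delta> * ip I a (K b)"
  have "ip I (\<lambda>i. \<gamma> * a i + \<delta> * b i) (K (\<lambda>i. \<gamma> * a i + \<delta> * b i)) =
      (\<gamma> * cnj \<gamma>) * ip I a (K a) + (\<delta> * cnj \<delta>) * ip I b (K b)
      + (W + cnj W)"
    unfolding K W_def by (simp add: ip_linear 1 algebra_simps)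
  also have "\<gamma> * cnj \<gamma> = of_real ((cmod \<gamma>)\<^sup>2)" by (rule complex_norm_square[symmetric])
  also have "\<delta> * cnj \<delta> = of_real ((cmod \<delta>)\<^sup>2)" by (rule complex_norm_square[symmetric])
  finally have "Re (ip I (\<lambda>i. \<gamma> * a i + \<delta> * b i) (K (\<lambda>i. \<gamma> * a i + \<delta> * b i))) =
     (cmod \<gamma>)\<^sup>2 * p + (cmod \<delta>)\<^sup>2 * q + 2 * Re W"
    by (simp del: of_real_power)
  moreover have "\<bar>Re W\<bar> \<le> cmod \<gamma> * cmod \<delta> * e"
    using abs_Re_le_cmod[of W] by (simp add: norm_mult W_def)
  ultimately show ?thesis by linarith
qed

text \<open>Let x = (a, w), y = (b, w) and let W be the form of \<open>z - H\<close> at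
  \<open>w\<close>. For \<sigma> \<ge> z the eigenvalue equation paired with \<open>w\<close> gives
  W \<le> 2 t |x| |y|. Cauchy-Schwarz in that form bounds |(f, w)|^2 by (f, K f) W for a suitable
  \<open>f\<close>, and |x| |y| cancels.\<close>

lemma outlier_bound:
  assumes "z \<le> \<sigma>" "0 < p" "0 < q" "0 < nrm I w"
  shows "1 \<le> t * (sqrt (p * q) + e)"
proof -
  define x y where "x = ip I a w" and "y = ip I b w"
  define W where "W = z * (nrm I w)\<^sup>2 - Re (ip I w (mv I H w))"
  have "0 < (z - s) * (nrm I w)\<^sup>2" using z_gt assms by simp
  also have "\<dots> \<le> W" using bound[of w] by (simp add: W_def algebra_simps)
  finally have W: "0 < W" .
  have "of_real \<sigma> * ip I w w = ip I w (mv I H w) + of_real t * (ip I w a * y + ip I w b * x)"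
  proof -
    have "of_real \<sigma> * ip I w w = ip I w (\<lambda>i. of_real \<sigma> * w i)" by (simp add: ip_linear)
    also have "\<dots> = ip I w (\<lambda>i. mv I H w i + of_real t * (y * a i + x * b i))"
      by (rule ip_cong) (simp_all add: eigen x_def y_def mult.commute)
    finally show ?thesis by (simp only: ip_linear) (simp add: algebra_simps)
  qed
  moreover have "ip I w a = cnj x" "ip I w b = cnj y"
    unfolding x_def y_def using ip_sym[of I w a] ip_sym[of I w b] by simp_all
  ultimately have "\<sigma> * (nrm I w)\<^sup>2 = Re (ip I w (mv I H w)) + 2 * t * Re (cnj x * y)"
    by (simp add: complex_eq_iff ip_self algebra_simps)
  moreover have "Re (cnj x * y) \<le> cmod x * cmod y"
    using complex_Re_le_cmod[of "cnj x * y"] by (simp add: norm_mult)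
  ultimately have "W \<le> (z - \<sigma>) * (nrm I w)\<^sup>2 + 2 * t * (cmod x * cmod y)"
    using t_pos mult_left_mono[of "Re (cnj x * y)" "cmod x * cmod y" "2 * t"]
    by (simp add: W_def left_diff_distrib)
  also have "\<dots> \<le> 2 * t * (cmod x * cmod y)"
    using assms(1) by (simp add: mult_nonpos_nonneg)
  finally have Wxy: "W \<le> 2 * t * (cmod x * cmod y)" .
  with W t_pos have xy: "0 < cmod x * cmod y"
    by (smt (verit) mult_nonneg_nonpos norm_ge_zero zero_less_mult_iff)
  \<comment> \<open>The phases make both contributions to (f, w) nonnegative, so that they cannot
    cancel. The weights make both diagonal terms of (f, K f) equal to p q, and the
    arithmetic-geometric mean inequality then yields the factor 4 sqrt(p q) in
    \<open>lower\<close>.\<close>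
  define f where "f i = (of_real (sqrt q) * sgn x) * a i + (of_real (sqrt p) * sgn y) * b i" for i
  have sg: "cmod (sgn x) = 1" "cmod (sgn y) = 1" using xy by (auto simp: norm_sgn)
  have "cnj (sgn x) * x = of_real (cmod x)" for x :: complex
  proof -
    have "x * cnj x = of_real (cmod x) * of_real (cmod x)"
      by (metis complex_norm_square of_real_power power2_eq_square)
    thus ?thesis by (cases "x = 0") (simp_all add: sgn_eq field_simps)
  qed
  hence "ip I f w = of_real (sqrt q * cmod x + sqrt p * cmod y)"
    unfolding f_def by (simp add: ip_linear x_def[symmetric] y_def[symmetric] mult.assoc)
  hence fw: "cmod (ip I f w) = sqrt q * cmod x + sqrt p * cmod y"
    using assms by (simp only: norm_of_real) simp
  have pf: "Re (ip I f (K f)) \<le> 2 * p * q + 2 * sqrt (p * q) * e"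
    using res_spike_form[of "of_real (sqrt q) * sgn x" "of_real (sqrt p) * sgn y"] assms
    unfolding f_def[symmetric] norm_mult sg by (simp add: real_sqrt_mult algebra_simps)
  have lower: "4 * sqrt (p * q) * (cmod x * cmod y) \<le> (cmod (ip I f w))\<^sup>2"
  proof -
    have "0 \<le> (sqrt q * cmod x - sqrt p * cmod y)\<^sup>2" by simp
    thus ?thesis unfolding fw by (simp add: power2_eq_square algebra_simps real_sqrt_mult)
  qed
  have pos: "0 < (cmod (ip I f w))\<^sup>2"
    unfolding fw using assms xy
    by (intro zero_less_power add_nonneg_pos mult_nonneg_nonneg mult_pos_pos)
      (auto simp: zero_less_mult_iff)
  \<comment> \<open>If the form vanished, \<open>K f\<close> and therefore \<open>f\<close> itself
    would vanish on \<open>I\<close>, contradicting (f, w) \<noteq> 0.\<close>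
  have pf0: "0 < Re (ip I f (K f))"
  proof (rule ccontr)
    assume "\<not> 0 < Re (ip I f (K f))"
    hence "Re (ip I f (K f)) = 0" using res_pos[of f] by linarith
    with res_coercive[of f] z_gt have "nrm I (K f) = 0"
      by (smt (verit) mult_pos_pos nrm_nonneg zero_less_power2)
    hence "\<forall>i\<in>I. K f i = 0" using fin by (simp add: nrm_eq_0)
    hence "f i = 0" if "i \<in> I" for i
      using inverse[OF that, of f] mv_cong[of I "K f" "\<lambda>_. 0" H] that by (simp add: mv_def)
    hence "ip I f w = 0" by (simp add: ip_def)
    thus False using pos by simp
  qed
  from res_Cauchy_Schwarz[OF pf0, of w]
  have "(cmod (ip I f w))\<^sup>2 \<le> Re (ip I f (K f)) * W" by (simp add: W_def)
  also have "\<dots> \<le> (2 * p * q + 2 * sqrt (p * q) * e) * (2 * t * (cmod x * cmod y))"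
    using pf pf0 W Wxy by (intro mult_mono) auto
  also have "\<dots> = (4 * sqrt (p * q)) * ((t * (sqrt (p * q) + e)) * (cmod x * cmod y))"
  proof -
    have "p * q = sqrt (p * q) * sqrt (p * q)" using assms by simp
    thus ?thesis by (simp add: algebra_simps)
  qed
  finally have "(4 * sqrt (p * q)) * (cmod x * cmod y)
      \<le> (4 * sqrt (p * q)) * ((t * (sqrt (p * q) + e)) * (cmod x * cmod y))"
    using lower by linarith
  hence "cmod x * cmod y \<le> (t * (sqrt (p * q) + e)) * (cmod x * cmod y)"
    using assms by (subst (asm) mult_le_cancel_left_pos) auto
  hence "1 * (cmod x * cmod y) \<le> (t * (sqrt (p * q) + e)) * (cmod x * cmod y)" by (simp only: mult_1)
  thus ?thesis using xy by (rule mult_right_le_imp_le)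
qed

text \<open>The norm of \<open>K a\<close> is bounded through coercivity by sqrt(p / (z - s)), not
  by |a| / (z - s). Once \<sigma> and \<open>s\<close> are near the edge, the first term is
  therefore of order sqrt(z - s) and disappears as z approaches the edge.\<close>

lemma inner_bound:
  "cmod (ip I a w) \<le> \<bar>z - \<sigma>\<bar> * sqrt (p / (z - s)) * nrm I w + cmod \<alpha> * p + cmod \<beta> * e"
proof -
  have "ip I a (\<lambda>i. \<alpha> * K a i + \<beta> * K b i) = ip I a (\<lambda>i. w i + of_real (\<sigma> - z) * K w i)"
  proof (rule ip_cong)
    fix i assume "i \<in> I"
    show "\<alpha> * K a i + \<beta> * K b i = w i + of_real (\<sigma> - z) * K w i"
      by (simp only: res_spike[OF \<open>i \<in> I\<close>, symmetric] mv_linear)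
  qed simp
  hence "ip I a w = of_real (z - \<sigma>) * ip I (K a) w + \<alpha> * of_real p + \<beta> * ip I a (K b)"
    using res_real[of a] by (simp only: ip_linear ip_res[of a w]) (simp add: algebra_simps)
  hence "cmod (ip I a w) \<le> cmod (of_real (z - \<sigma>) * ip I (K a) w) + cmod (\<alpha> * of_real p) + cmod (\<beta> * ip I a (K b))"
    by (metis (no_types, lifting) norm_triangle_mono norm_triangle_ineq order_refl)
  also have "\<dots> = \<bar>z - \<sigma>\<bar> * cmod (ip I (K a) w) + cmod \<alpha> * p + cmod \<beta> * e"
    using res_pos[of a] by (simp only: norm_mult norm_of_real)
  also have "cmod (ip I (K a) w) \<le> sqrt (p / (z - s)) * nrm I w"
  proof -
    have "nrm I (K a) \<le> sqrt (p / (z - s))"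
      using res_coercive[of a] z_gt by (intro real_le_rsqrt) (simp add: field_simps)
    thus ?thesis using ip_Cauchy_Schwarz[of I "K a" w]
      by (meson mult_right_mono nrm_nonneg order_trans)
  qed
  finally show ?thesis by (simp add: mult_left_mono mult.assoc)
qed

end

locale spiked_resolvent_pair = A: spiked_resolvent I H s z R a b w t \<sigma> + B: spiked_resolvent I H s z' R' a b w t \<sigma>
  for I :: "'i set" and H s z R z' R' a b w t \<sigma> +
  assumes less: "z < z'"
begin

text \<open>The resolvent identity at y = \<alpha> a + \<beta> b writes the decrease of the form (y,
  R y) from z to z' as z' - z times an inner product of two resolvent vectors, and both of these are
  controlled by \<open>nrm_res_spike\<close>.\<close>

lemma spike_bound:
  "(cmod A.\<alpha>)\<^sup>2 * (A.p - B.p) + (cmod A.\<beta>)\<^sup>2 * (A.q - B.q) - 2 * cmod A.\<alpha> * cmod A.\<beta> * (A.e + B.e)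
   \<le> (z' - z) * ((nrm I w)\<^sup>2 * ((1 + \<bar>\<sigma> - z\<bar> / (z - s)) * (1 + \<bar>\<sigma> - z'\<bar> / (z' - s))))"
proof -
  define y where "y i = A.\<alpha> * a i + A.\<beta> * b i" for i
  have "Re (ip I y (A.K y)) - Re (ip I y (B.K y)) = (z' - z) * Re (ip I (B.K y) (A.K y))"
    using resolvent_identity[OF A.resolvent_axioms B.resolvent_axioms, of y y]
    by (simp add: complex_eq_iff)
  also have "\<dots> \<le> (z' - z) * (nrm I (A.K y) * nrm I (B.K y))"
    using less ip_Cauchy_Schwarz[of I "B.K y" "A.K y"] complex_Re_le_cmod[of "ip I (B.K y) (A.K y)"]
    by (intro mult_left_mono) (auto simp: mult.commute)
  also have "\<dots> \<le> (z' - z) * ((nrm I w * (1 + \<bar>\<sigma> - z\<bar> / (z - s))) * (nrm I w * (1 + \<bar>\<sigma> - z'\<bar> / (z' - s))))"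
    using less A.z_gt unfolding y_def
    by (intro mult_left_mono mult_mono A.nrm_res_spike B.nrm_res_spike) auto
  finally show ?thesis
    using A.res_spike_form[of A.\<alpha> A.\<beta>] B.res_spike_form[of A.\<alpha> A.\<beta>]
    unfolding y_def by (simp add: power2_eq_square algebra_simps abs_le_iff)
qed

text \<open>The trial vector g = R a in \<open>top\<close> gives (z - \<sigma>) |g|^2 \<le> p (1 + 2
  t e), while |g|^2 is at least the difference quotient of p. A steep p thus leaves no room for
  \<sigma> far below z.\<close>

lemma top_bound:
  assumes "\<sigma> \<le> z"
  shows "(z - \<sigma>) * (A.p - B.p) \<le> (z' - z) * (A.p * (1 + 2 * t * A.e))"
proof -
  define g where "g = A.K a"
  have g: "nrm I g ^ 2 * z - A.p = Re (ip I g (mv I H g))"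
    using A.ip_inverse(1)[of g a] A.ip_res[of a a]
    by (simp add: ip_linear g_def ip_self complex_eq_iff algebra_simps)
  have ga: "ip I g a = of_real A.p" unfolding g_def using A.ip_res[of a a] A.res_real[of a] by simp
  have bg: "ip I b g = cnj (ip I a (A.K b))"
    unfolding g_def using ip_sym[of I b "A.K a"] A.ip_res[of a b] by simp
  have "- (A.p * A.e) \<le> Re (ip I g a * ip I b g)"
    using abs_Re_le_cmod[of "ip I g a * ip I b g"] A.res_pos[of a]
    by (simp add: ga bg norm_mult)
  hence "2 * t * (- (A.p * A.e)) \<le> 2 * t * Re (ip I g a * ip I b g)"
    using A.t_pos by (intro mult_left_mono) auto
  with A.top[of g] g have 1: "(z - \<sigma>) * (nrm I g)\<^sup>2 \<le> A.p * (1 + 2 * t * A.e)"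
    by (simp add: algebra_simps)
  have "A.p - B.p = (z' - z) * Re (ip I (B.K a) g)"
    using resolvent_identity[OF A.resolvent_axioms B.resolvent_axioms, of a a]
    by (simp add: complex_eq_iff g_def)
  \<comment> \<open>The vector \<open>g - B.K a\<close> equals (z' - z) \<open>B.K g\<close>, and
    its pairing with \<open>g\<close> is nonnegative because \<open>B.K\<close> is positive.\<close>
  also have "Re (ip I (B.K a) g) \<le> (nrm I g)\<^sup>2"
  proof -
    have "ip I g (A.K a) - ip I g (B.K a) = of_real (z' - z) * ip I g (B.K g)"
      using resolvent_identity[OF A.resolvent_axioms B.resolvent_axioms, of g a]
      by (simp add: g_def B.ip_res)
    hence "(nrm I g)\<^sup>2 - Re (ip I g (B.K a)) = (z' - z) * Re (ip I g (B.K g))"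
      by (simp add: g_def[symmetric] ip_self complex_eq_iff)
    moreover have "\<dots> \<ge> 0" using less B.res_pos[of g] by simp
    moreover have "Re (ip I (B.K a) g) = Re (ip I g (B.K a))"
      using ip_sym[of I "B.K a" g] by simp
    ultimately show ?thesis by linarith
  qed
  finally have "A.p - B.p \<le> (z' - z) * (nrm I g)\<^sup>2" using less by simp
  hence "(z - \<sigma>) * (A.p - B.p) \<le> (z - \<sigma>) * ((z' - z) * (nrm I g)\<^sup>2)"
    using assms by (intro mult_left_mono) auto
  also have "\<dots> = (z' - z) * ((z - \<sigma>) * (nrm I g)\<^sup>2)" by simp
  also have "\<dots> \<le> (z' - z) * (A.p * (1 + 2 * t * A.e))"
    using 1 less by (intro mult_left_mono) auto
  finally show ?thesis .
qed

end

section \<open>Delocalization at the edge\<close>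

lemma eventually_upper:
  fixes f :: "nat \<Rightarrow> real"
  assumes "f \<longlonglongrightarrow> l" "l < c" shows "\<forall>\<^sub>F n in sequentially. f n \<le> c"
  using order_tendstoD(2)[OF assms] by (rule eventually_mono) simp

lemma eventually_lower:
  fixes f :: "nat \<Rightarrow> real"
  assumes "f \<longlonglongrightarrow> l" "c < l" shows "\<forall>\<^sub>F n in sequentially. c \<le> f n"
  using order_tendstoD(1)[OF assms] by (rule eventually_mono) simp

lemma tendsto_zeroI_eventually:
  fixes f :: "nat \<Rightarrow> complex"
  assumes "\<And>\<epsilon>. 0 < \<epsilon> \<Longrightarrow> \<forall>\<^sub>F n in sequentially. cmod (f n) \<le> \<epsilon>"
  shows "f \<longlonglongrightarrow> 0"
  unfolding tendsto_iff dist_norm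
proof (intro allI impI)
  fix e :: real assume "0 < e"
  thus "\<forall>\<^sub>F n in sequentially. norm (f n - 0) < e"
    using assms[of "e / 2"] by (auto elim!: eventually_mono)
qed

text \<open>A deterministic statement. Here \<open>c\<close> is the edge, \<open>z\<close> a
  sequence decreasing to it, and \<open>f\<close>, \<open>g\<close> are the limits in n of the two
  diagonal resolvent forms. Each hypothesis on resolvents concerns a fixed k and large n, so k may
  be chosen from \<epsilon> before n.\<close>

theorem spiked_eigenvector_delocalization:
  fixes I :: "nat \<Rightarrow> 'i set" and H :: "nat \<Rightarrow> 'i \<Rightarrow> 'i \<Rightarrow> complex" and s \<sigma> :: "nat \<Rightarrow> real"
    and a b w :: "nat \<Rightarrow> 'i \<Rightarrow> complex" and R :: "nat \<Rightarrow> nat \<Rightarrow> 'i \<Rightarrow> 'i \<Rightarrow> complex"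
    and z f g :: "nat \<Rightarrow> real" and t c F :: real
  assumes spiked: "\<And>k. \<forall>\<^sub>F n in sequentially.
      spiked_resolvent (I n) (H n) (s n) (z k) (R k n) (a n) (b n) (w n) t (\<sigma> n)"
    and s: "s \<longlonglongrightarrow> c"
    and z_gt: "\<And>k. c < z k" and z_less: "\<And>k. z (Suc k) < z k" and z_lim: "z \<longlonglongrightarrow> c"
    and w: "\<forall>\<^sub>F n in sequentially. (nrm (I n) (w n))\<^sup>2 = 2"
    and a_le: "\<forall>\<^sub>F n in sequentially. nrm (I n) (a n) \<le> 2"
    and b_le: "\<forall>\<^sub>F n in sequentially. nrm (I n) (b n) \<le> 2"
    and p: "\<And>k. (\<lambda>n. Re (ip (I n) (a n) (mv (I n) (R k n) (a n)))) \<longlonglongrightarrow> f k"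
    and q: "\<And>k. (\<lambda>n. Re (ip (I n) (b n) (mv (I n) (R k n) (b n)))) \<longlonglongrightarrow> g k"
    and e: "\<And>k. (\<lambda>n. ip (I n) (a n) (mv (I n) (R k n) (b n))) \<longlonglongrightarrow> 0"
    and f_pos: "\<And>k. 0 < f k" and f_le: "\<And>k. f k \<le> F" 
    and g_pos: "\<And>k. 0 < g k" and g_mono: "\<And>k. g k \<le> g (Suc k)"
    and subcrit: "\<And>k. t\<^sup>2 * (f k * g k) < 1"
    and slope: "filterlim (\<lambda>k. (f (Suc k) - f k) / (z k - z (Suc k))) at_top sequentially"
  shows "(\<lambda>n. ip (I n) (a n) (w n)) \<longlonglongrightarrow> 0" "(\<lambda>n. ip (I n) (b n) (w n)) \<longlonglongrightarrow> 0"
proof -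
  define P where "P k n = Re (ip (I n) (a n) (mv (I n) (R k n) (a n)))" for k n
  define Q where "Q k n = Re (ip (I n) (b n) (mv (I n) (R k n) (b n)))" for k n
  define E where "E k n = cmod (ip (I n) (a n) (mv (I n) (R k n) (b n)))" for k n
  define D where "D k = (f (Suc k) - f k) / (z k - z (Suc k))" for k
  have P: "P k \<longlonglongrightarrow> f k" and Q: "Q k \<longlonglongrightarrow> g k" and E: "E k \<longlonglongrightarrow> 0" for k
    using p[of k] q[of k] tendsto_norm_zero[OF e[of k]] by (simp_all add: P_def[abs_def] Q_def[abs_def] E_def[abs_def])
  have ev_s: "\<forall>\<^sub>F n in sequentially. s n < z k" for k
    using order_tendstoD(2)[OF s z_gt] .
  have t: "0 < t"
  proof -
    from spiked[of 0] obtain n where "spiked_resolvent (I n) (H n) (s n) (z 0) (R 0 n) (a n) (b n) (w n) t (\<sigma> n)"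
      using eventually_happens[of _ sequentially] by auto
    thus ?thesis by (rule spiked_resolvent.t_pos)
  qed
  have F: "0 < F" using f_pos[of 0] f_le[of 0] by linarith
  have pair: "\<forall>\<^sub>F n in sequentially. spiked_resolvent_pair (I n) (H n) (s n)
      (z (Suc k)) (R (Suc k) n) (z k) (R k n) (a n) (b n) (w n) t (\<sigma> n)" for k
    using spiked[of k] spiked[of "Suc k"]
    by eventually_elim
      (simp add: spiked_resolvent_pair_def spiked_resolvent_pair_axioms_def z_less)
  have D_eq: "f (Suc k) - f k = D k * (z k - z (Suc k))" for k
    using z_less[of k] by (simp add: D_def)
  have D_large: "\<exists>k. x < D k \<and> z k < c + y" if "0 < y" for x y
  proof -
    have "\<forall>\<^sub>F k in sequentially. x < D k"
      using slope unfolding filterlim_at_top_dense D_def by blast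
    moreover have "\<forall>\<^sub>F k in sequentially. z k < c + y"
      using order_tendstoD(2)[OF z_lim, of "c + y"] that by simp
    ultimately show ?thesis
      using eventually_happens[OF eventually_conj] sequentially_bot by blast
  qed
  \<comment> \<open>For large n at least half of the limiting slope is present.\<close>
  have gap: "\<forall>\<^sub>F n in sequentially. D k / 2 * (z k - z (Suc k)) \<le> P (Suc k) n - P k n" if "0 < D k" for k
  proof (rule eventually_lower)
    show "(\<lambda>n. P (Suc k) n - P k n) \<longlonglongrightarrow> D k * (z k - z (Suc k))"
      using tendsto_diff[OF P[of "Suc k"] P[of k]] by (simp only: D_eq)
    show "D k / 2 * (z k - z (Suc k)) < D k * (z k - z (Suc k))"
      using that z_less[of k] by simp
  qed

  \<comment> \<open>Otherwise \<open>outlier_bound\<close> would give 1 \<le> t (sqrt(p q) + e),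
    whose right side has the limit t sqrt(f g) < 1 by \<open>subcrit\<close>.\<close>
  have sigma_upper: "\<forall>\<^sub>F n in sequentially. \<sigma> n < z k" for k
  proof -
    have "(\<lambda>n. t * (sqrt (P k n * Q k n) + E k n)) \<longlonglongrightarrow> t * (sqrt (f k * g k) + 0)"
      by (intro tendsto_intros P Q E)
    moreover have "t * (sqrt (f k * g k) + 0) < 1"
    proof -
      have "(t * sqrt (f k * g k))\<^sup>2 < 1\<^sup>2"
        using subcrit[of k] f_pos[of k] g_pos[of k] by (simp add: power_mult_distrib)
      thus ?thesis by (simp add: power2_less_imp_less)
    qed
    ultimately have "\<forall>\<^sub>F n in sequentially. t * (sqrt (P k n * Q k n) + E k n) < 1"
      by (rule order_tendstoD(2))
    moreover have "\<forall>\<^sub>F n in sequentially. 0 < P k n" "\<forall>\<^sub>F n in sequentially. 0 < Q k n"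
      using order_tendstoD(1)[OF P f_pos] order_tendstoD(1)[OF Q g_pos] by auto
    ultimately show ?thesis
      using spiked[of k] w
    proof eventually_elim
      case (elim n)
      interpret spiked_resolvent "I n" "H n" "s n" "z k" "R k n" "a n" "b n" "w n" t "\<sigma> n"
        by (rule elim)
      have "0 < nrm (I n) (w n)"
        using elim(5) by (auto simp: less_le)
      with outlier_bound elim show ?case
        unfolding P_def Q_def E_def by fastforce
    qed
  qed

  have sigma_lower: "\<forall>\<^sub>F n in sequentially. c - \<epsilon> < \<sigma> n" if "0 < \<epsilon>" for \<epsilon>
  proof -
    \<comment> \<open>The constant 8 is the product of three factors 2: p is at most 2 F, the factor
      1 + 2 t e is at most 2, and only half of the slope is available.\<close>
    obtain k where k: "8 * F / \<epsilon> < D k" using D_large[of 1] by auto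
    have Dk: "0 < D k" using k F that
      by (smt (verit) divide_pos_pos)
    have "\<forall>\<^sub>F n in sequentially. P (Suc k) n \<le> 2 * F"
      by (rule eventually_upper[OF P]) (use f_le[of "Suc k"] F in linarith)
    moreover have "\<forall>\<^sub>F n in sequentially. 0 \<le> P (Suc k) n"
      by (rule eventually_lower[OF P f_pos])
    moreover have "\<forall>\<^sub>F n in sequentially. E (Suc k) n \<le> 1 / (2 * t)"
      by (rule eventually_upper[OF E]) (use t in simp)
    ultimately show ?thesis using pair[of k] gap[OF Dk]
    proof eventually_elim
      case (elim n)
      interpret spiked_resolvent_pair "I n" "H n" "s n" "z (Suc k)" "R (Suc k) n" "z k" "R k n"
        "a n" "b n" "w n" t "\<sigma> n" by (rule elim)
      show ?case
      proof (cases "\<sigma> n \<le> z (Suc k)")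
        case True
        let ?d = "z k - z (Suc k)"
        have d: "0 < ?d" using z_less[of k] by simp
        have "(z (Suc k) - \<sigma> n) * (D k / 2 * ?d) \<le> (z (Suc k) - \<sigma> n) * (P (Suc k) n - P k n)"
          using True elim by (intro mult_left_mono) auto
        also have "\<dots> \<le> ?d * (P (Suc k) n * (1 + 2 * t * E (Suc k) n))"
          using top_bound[OF True] unfolding P_def E_def .
        also have "\<dots> \<le> ?d * (2 * F * 2)"
          using elim(1-3) d t F
          by (intro mult_left_mono mult_mono) (auto simp: field_simps E_def)
        finally have "?d * ((z (Suc k) - \<sigma> n) * D k) \<le> ?d * (8 * F)"
          by (simp add: field_simps)
        hence "(z (Suc k) - \<sigma> n) * D k \<le> 8 * F" using d by simp
        also have "\<dots> < \<epsilon> * D k" using k that by (simp add: field_simps)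
        finally have "z (Suc k) - \<sigma> n < \<epsilon>" using Dk by simp
        thus ?thesis using z_gt[of "Suc k"] by linarith
      next
        case False
        thus ?thesis using z_gt[of "Suc k"] that by linarith
      qed
    qed
  qed

  have sigma: "\<sigma> \<longlonglongrightarrow> c"
  proof (rule order_tendstoI)
    fix x assume "x < c"
    with sigma_lower[of "c - x"] show "\<forall>\<^sub>F n in sequentially. x < \<sigma> n" by simp
  next
    fix x assume "c < x"
    with D_large[of "x - c"] obtain k where "z k < x" by auto
    with sigma_upper[of k] show "\<forall>\<^sub>F n in sequentially. \<sigma> n < x"
      by (auto elim!: eventually_mono)
  qed
  \<comment> \<open>Numerator and denominator have the same limit z - c. Each factor in
    \<open>spike_bound\<close> therefore tends to 2, whatever k is; 3 is a safe bound uniform in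
    k.\<close>
  have ratio: "(\<lambda>n. \<bar>\<sigma> n - z k\<bar> / (z k - s n)) \<longlonglongrightarrow> 1" for k
  proof -
    have "(\<lambda>n. \<bar>\<sigma> n - z k\<bar> / (z k - s n)) \<longlonglongrightarrow> \<bar>c - z k\<bar> / (z k - c)"
      using z_gt[of k] by (intro tendsto_intros sigma s) auto
    thus ?thesis using z_gt[of k] by simp
  qed
  have ev_ratio: "\<forall>\<^sub>F n in sequentially. 1 + \<bar>\<sigma> n - z k\<bar> / (z k - s n) \<le> 3" for k
    using eventually_upper[OF ratio[of k], of 2] by simp

  define A where "A n = cmod (of_real t * ip (I n) (b n) (w n))" for n
  define B where "B n = cmod (of_real t * ip (I n) (a n) (w n))" for n
  have AB: "\<forall>\<^sub>F n in sequentially. A n \<le> 4 * t \<and> B n \<le> 4 * t"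
    using w a_le b_le
  proof eventually_elim
    case (elim n)
    have "nrm (I n) (w n) \<le> 2" by (rule power2_le_imp_le) (simp_all add: elim)
    hence "nrm (I n) x * nrm (I n) (w n) \<le> 4" if "nrm (I n) x \<le> 2" for x
      using mult_mono[OF that, of "nrm (I n) (w n)" 2] by simp
    hence "cmod (ip (I n) x (w n)) \<le> 4" if "nrm (I n) x \<le> 2" for x
      using ip_Cauchy_Schwarz that by (meson order_trans)
    thus ?case using t elim unfolding A_def B_def norm_mult by (simp add: mult.commute)
  qed

  have A_small: "\<forall>\<^sub>F n in sequentially. A n \<le> \<epsilon>" if "0 < \<epsilon>" for \<epsilon>
  proof -
    \<comment> \<open>The constant is 2 (2 * 3 * 3 + 2): |w|^2 = 2, each resolvent factor is at most
      3, the \<beta> term and the mixed term cost at most one \<open>?d\<close> each, and only half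
      of the slope is available.\<close>
    obtain k where k: "40 / \<epsilon>\<^sup>2 < D k" using D_large[of 1] by auto
    have Dk: "0 < D k" using k that
      by (smt (verit) divide_pos_pos zero_less_power)
    \<comment> \<open>The tolerances below are scaled by \<open>?d\<close> and by (4 t)^2, which
      bounds B^2 and A B. The q-difference has a nonnegative limit by \<open>g_mono\<close>, so the
      \<beta> term can lose only an arbitrarily small amount.\<close>
    let ?d = "z k - z (Suc k)"
    have d: "0 < ?d" using z_less[of k] by simp
    have "\<forall>\<^sub>F n in sequentially. - (?d / (4 * t)\<^sup>2) \<le> Q (Suc k) n - Q k n"
      by (rule eventually_lower[OF tendsto_diff[OF Q Q]])
        (use g_mono[of k] d t in \<open>smt (verit) divide_pos_pos zero_less_power\<close>)
    moreover have "\<forall>\<^sub>F n in sequentially. E (Suc k) n + E k n \<le> ?d / (2 * (4 * t)\<^sup>2)"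
      by (rule eventually_upper[OF tendsto_add[OF E E]]) (use d t in simp)
    ultimately show ?thesis
      using pair[of k] gap[OF Dk] AB w ev_ratio[of k] ev_ratio[of "Suc k"] ev_s[of k] ev_s[of "Suc k"]
    proof eventually_elim
      case (elim n)
      interpret spiked_resolvent_pair "I n" "H n" "s n" "z (Suc k)" "R (Suc k) n" "z k" "R k n"
        "a n" "b n" "w n" t "\<sigma> n" by (rule elim)
      have nn: "0 \<le> A n" "0 \<le> B n" "0 \<le> E k n" "0 \<le> E (Suc k) n"
        by (simp_all add: A_def B_def E_def)
      have "(B n)\<^sup>2 * - (?d / (4 * t)\<^sup>2) \<ge> (4 * t)\<^sup>2 * - (?d / (4 * t)\<^sup>2)"
        using elim(5) nn d t by (intro mult_right_mono_neg power_mono) auto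
      moreover have "(B n)\<^sup>2 * - (?d / (4 * t)\<^sup>2) \<le> (B n)\<^sup>2 * (Q (Suc k) n - Q k n)"
        using elim(1) by (intro mult_left_mono) auto
      ultimately have Bq: "- ?d \<le> (B n)\<^sup>2 * (Q (Suc k) n - Q k n)"
        using t by simp
      have "A n * B n * (E (Suc k) n + E k n) \<le> (4 * t) * (4 * t) * (?d / (2 * (4 * t)\<^sup>2))"
        using elim(2,5) nn t by (intro mult_mono) auto
      also have "\<dots> = ?d / 2" using t by (simp add: power2_eq_square)
      finally have ABE: "2 * A n * B n * (E (Suc k) n + E k n) \<le> ?d" by simp
      have "(A n)\<^sup>2 * (D k / 2 * ?d) \<le> (A n)\<^sup>2 * (P (Suc k) n - P k n)"
        using elim(4) by (intro mult_left_mono) auto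
      also have "\<dots> \<le> ?d * (2 * ((1 + \<bar>\<sigma> n - z (Suc k)\<bar> / (z (Suc k) - s n)) *
          (1 + \<bar>\<sigma> n - z k\<bar> / (z k - s n)))) + 2 * ?d"
        using spike_bound Bq ABE elim(6)
        unfolding A_def[symmetric] B_def[symmetric] P_def[symmetric] Q_def[symmetric] E_def[symmetric]
        by simp
      also have "\<dots> \<le> ?d * (2 * (3 * 3)) + 2 * ?d"
        using elim(7-10) d by (intro add_right_mono mult_left_mono mult_mono) auto
      finally have "?d * ((A n)\<^sup>2 * D k) \<le> ?d * 40" by (simp add: field_simps)
      hence "(A n)\<^sup>2 * D k \<le> 40" using d by (rule mult_left_le_imp_le)
      also have "\<dots> \<le> \<epsilon>\<^sup>2 * D k" using k that by (simp add: field_simps)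
      finally have "(A n)\<^sup>2 \<le> \<epsilon>\<^sup>2" using Dk by (rule mult_right_le_imp_le)
      thus ?case by (rule power2_le_imp_le) (use that in simp)
    qed
  qed

  show "(\<lambda>n. ip (I n) (b n) (w n)) \<longlonglongrightarrow> 0"
  proof (rule tendsto_zeroI_eventually)
    fix \<epsilon> :: real assume "0 < \<epsilon>"
    with A_small[of "t * \<epsilon>"] t
    show "\<forall>\<^sub>F n in sequentially. cmod (ip (I n) (b n) (w n)) \<le> \<epsilon>"
      by (simp add: A_def norm_mult)
  qed

  have A: "A \<longlonglongrightarrow> 0"
  proof (rule order_tendstoI)
    fix x :: real assume "x < 0"
    thus "\<forall>\<^sub>F n in sequentially. x < A n"
      by (intro always_eventually) (auto simp: A_def intro: less_le_trans)
  next
    fix x :: real assume "0 < x"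
    thus "\<forall>\<^sub>F n in sequentially. A n < x"
      using A_small[of "x / 2"] by (auto elim!: eventually_mono)
  qed

  show "(\<lambda>n. ip (I n) (a n) (w n)) \<longlonglongrightarrow> 0"
  proof (rule tendsto_zeroI_eventually)
    fix \<epsilon> :: real assume \<epsilon>: "0 < \<epsilon>"
    \<comment> \<open>With this k the square of the limiting bound is 2 f (z - c) < \<epsilon>^2 /
      4.\<close>
    obtain k where k: "z k < c + \<epsilon>\<^sup>2 / (8 * F)" using D_large[of "\<epsilon>\<^sup>2 / (8 * F)"] F \<epsilon> by auto
    have d: "0 < z k - c" using z_gt[of k] by simp
    have "(\<lambda>n. \<bar>z k - \<sigma> n\<bar> * sqrt (P k n / (z k - s n)) * sqrt 2 + A n * P k n + 4 * t * E k n)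
      \<longlonglongrightarrow> \<bar>z k - c\<bar> * sqrt (f k / (z k - c)) * sqrt 2 + 0 * f k + 4 * t * 0"
      using d by (intro tendsto_intros sigma P s A E) auto
    moreover have "\<bar>z k - c\<bar> * sqrt (f k / (z k - c)) * sqrt 2 + 0 * f k + 4 * t * 0 < \<epsilon>"
    proof -
      have "(\<bar>z k - c\<bar> * sqrt (f k / (z k - c)) * sqrt 2)\<^sup>2 = 2 * f k * (z k - c)"
        using d f_pos[of k] by (simp add: power_mult_distrib) (simp add: power2_eq_square field_simps)
      also have "\<dots> \<le> 2 * F * (z k - c)"
        using d f_le[of k] by simp
      also have "\<dots> < \<epsilon>\<^sup>2"
      proof -
        have "8 * (F * (z k - c)) < \<epsilon>\<^sup>2" using k F by (simp add: field_simps)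
        moreover have "0 < F * (z k - c)" using F d by simp
        ultimately show ?thesis by linarith
      qed
      finally show ?thesis using \<epsilon> by (simp add: power2_less_imp_less)
    qed
    ultimately have "\<forall>\<^sub>F n in sequentially.
       \<bar>z k - \<sigma> n\<bar> * sqrt (P k n / (z k - s n)) * sqrt 2 + A n * P k n + 4 * t * E k n < \<epsilon>"
      by (rule order_tendstoD(2))
    thus "\<forall>\<^sub>F n in sequentially. cmod (ip (I n) (a n) (w n)) \<le> \<epsilon>"
      using spiked[of k] w AB
    proof eventually_elim
      case (elim n)
      interpret spiked_resolvent "I n" "H n" "s n" "z k" "R k n" "a n" "b n" "w n" t "\<sigma> n"
        by (rule elim)
      have nw: "nrm (I n) (w n) = sqrt 2" using elim(3) by (simp add: real_sqrt_unique)
      have "B n * E k n \<le> 4 * t * E k n"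
        using elim(4) by (intro mult_right_mono) (auto simp: E_def)
      moreover have "cmod (ip (I n) (a n) (w n))
          \<le> \<bar>z k - \<sigma> n\<bar> * sqrt (P k n / (z k - s n)) * sqrt 2 + A n * P k n + B n * E k n"
        using inner_bound unfolding nw P_def A_def B_def E_def .
      ultimately show ?case
        using elim(1) by linarith
    qed
  qed
qed

section \<open>Moments from the log-Sobolev inequality\<close>

text \<open>A Poincare-type consequence. With A the integral of f^2, the inequality ln r \<le> r - 1
  gives f^2 ln(f^2 / A) \<ge> 2 f^2 - 2 sqrt(A) f pointwise; integrate and apply 2 sqrt(A) B \<le> A
  + B^2, where B is the mean of f.\<close>

lemma log_sobolev_second_moment:
  fixes M' :: "'b::euclidean_space measure" and f :: "'b \<Rightarrow> real"
  assumes "prob_space M'"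
    and sobolev: "integrable M' (\<lambda>x. (f x)\<^sup>2 * ln ((f x)\<^sup>2 / (\<integral>y. (f y)\<^sup>2 \<partial>M')))"
      "(\<integral>x. (f x)\<^sup>2 * ln ((f x)\<^sup>2 / (\<integral>y. (f y)\<^sup>2 \<partial>M')) \<partial>M') \<le> K"
    and f: "integrable M' f" "integrable M' (\<lambda>x. (f x)\<^sup>2)" "\<And>x. 0 < f x"
  shows "(\<integral>x. (f x)\<^sup>2 \<partial>M') \<le> K + (\<integral>x. f x \<partial>M')\<^sup>2"
proof -
  interpret M': prob_space M' by fact
  define A where "A = (\<integral>x. (f x)\<^sup>2 \<partial>M')"
  define B where "B = (\<integral>x. f x \<partial>M')"
  have "A \<noteq> 0"
  proof
    assume "A = 0"
    hence "AE x in M'. (f x)\<^sup>2 = 0"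
      using integral_nonneg_eq_0_iff_AE[OF f(2)] by (simp add: A_def)
    hence "AE x in M'. False" by (rule eventually_mono) (use f(3) in \<open>auto simp: less_le\<close>)
    thus False by simp
  qed
  moreover have "0 \<le> A" by (simp add: A_def)
  ultimately have A: "0 < A" by simp
  have "2 * (f x)\<^sup>2 - 2 * sqrt A * f x \<le> (f x)\<^sup>2 * ln ((f x)\<^sup>2 / A)" for x
  proof -
    have "ln (sqrt A / f x) \<le> sqrt A / f x - 1"
      using A f(3)[of x] by (intro ln_le_minus_one) simp
    hence "1 - sqrt A / f x \<le> ln (f x / sqrt A)"
      using A f(3)[of x] by (simp add: ln_div)
    moreover have "ln ((f x)\<^sup>2 / A) = 2 * ln (f x / sqrt A)"
      using A f(3)[of x] by (simp add: ln_div ln_realpow ln_sqrt)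
    ultimately have "(f x)\<^sup>2 * (2 * (1 - sqrt A / f x)) \<le> (f x)\<^sup>2 * ln ((f x)\<^sup>2 / A)"
      by (intro mult_left_mono) auto
    thus ?thesis using f(3)[of x] by (simp add: power2_eq_square algebra_simps)
  qed
  hence "(\<integral>x. 2 * (f x)\<^sup>2 - 2 * sqrt A * f x \<partial>M') \<le> K"
    using f sobolev unfolding A_def[symmetric]
    by (intro order_trans[OF integral_mono sobolev(2)[folded A_def]]) auto
  moreover have "(\<integral>x. 2 * (f x)\<^sup>2 - 2 * sqrt A * f x \<partial>M') = 2 * A - 2 * sqrt A * B"
    using f by (subst Bochner_Integration.integral_diff) (auto simp: A_def B_def)
  moreover have "2 * sqrt A * B \<le> A + B\<^sup>2"
    using sum_squares_bound[of "sqrt A" B] A by simp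
  ultimately show ?thesis by (simp add: A_def B_def)
qed

lemma GDERIV_sqrt_one_plus_norm:
  fixes x :: "'a::euclidean_space"
  assumes "(F has_real_derivative D) (at (sqrt (1 + inner x x)))"
  shows "GDERIV (\<lambda>x. F (sqrt (1 + inner x x))) x :> (D / sqrt (1 + inner x x)) *\<^sub>R x"
proof -
  have pos: "0 < 1 + inner x x" using inner_ge_zero[of x] by linarith
  have 1: "GDERIV (\<lambda>x. inner x x) x :> 2 *\<^sub>R x"
    unfolding gderiv_def by (auto intro!: derivative_eq_intros simp: inner_commute)
  have "((\<lambda>r. F (sqrt (1 + r))) has_real_derivative D * (inverse (sqrt (1 + inner x x)) / 2)) (at (inner x x))"
    using pos assms by (intro DERIV_chain2[where f=F and g="\<lambda>r. sqrt (1 + r)"]) (auto intro!: derivative_eq_intros)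
  from GDERIV_DERIV_compose[OF 1 this] show ?thesis
    by (simp add: field_simps)
qed

text \<open>Let s be the smooth substitute sqrt(1 + |x|^2) for the norm. The gradient of s^(k+1) is
  at most (k+1) s^k, so the moment of order 2 k controls the one of order 2 k + 2 by the previous
  inequality, once the test function is truncated. For k \<ge> 1 its mean is controlled as well,
  since s^(k+1) \<le> s^(2 k).\<close>

lemma log_sobolev_integrable_power_Suc:
  fixes \<nu> :: "'a::euclidean_space measure"
  assumes \<nu>: "prob_space \<nu>" "sets \<nu> = sets borel" and ls: "log_sobolev \<nu>"
    and k: "1 \<le> k" and int: "integrable \<nu> (\<lambda>x. sqrt (1 + inner x x) ^ (2 * k))"
  shows "integrable \<nu> (\<lambda>x. sqrt (1 + inner x x) ^ (2 * Suc k))"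
proof -
  interpret prob_space \<nu> by fact
  note [measurable_cong] = \<nu>(2)
  define s where "s x = sqrt (1 + inner x x)" for x :: 'a
  have s1: "1 \<le> s x" for x by (simp add: s_def)
  have s0: "0 < s x" for x using s1[of x] by linarith
  have norm_le: "norm x \<le> s x" for x
    by (simp add: s_def norm_eq_sqrt_inner)
  have [measurable]: "s \<in> borel_measurable borel"
    unfolding s_def[abs_def] by (intro borel_measurable_continuous_onI continuous_intros)
  obtain C where "0 < C \<and> (\<forall>(f :: 'a \<Rightarrow> real) g.
     (\<forall>x. GDERIV f x :> g x) \<longrightarrow> continuous_on UNIV g \<longrightarrow>
     integrable \<nu> (\<lambda>x. (f x)\<^sup>2) \<longrightarrow> integrable \<nu> (\<lambda>x. (norm (g x))\<^sup>2) \<longrightarrow>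
     integrable \<nu> (\<lambda>x. (f x)\<^sup>2 * ln ((f x)\<^sup>2 / (\<integral>y. (f y)\<^sup>2 \<partial>\<nu>))) \<and>
     (\<integral>x. (f x)\<^sup>2 * ln ((f x)\<^sup>2 / (\<integral>y. (f y)\<^sup>2 \<partial>\<nu>)) \<partial>\<nu>) \<le> 2 * C * (\<integral>x. (norm (g x))\<^sup>2 \<partial>\<nu>))"
    using ls unfolding log_sobolev_def by (elim exE)
  note C = conjunct1[OF this] conjunct2[OF this, rule_format]
  have int2k: "integrable \<nu> (\<lambda>x. s x ^ (2 * k))" using int by (simp add: s_def)
  have intk: "integrable \<nu> (\<lambda>x. s x ^ Suc k)"
  proof (rule Bochner_Integration.integrable_bound[OF int2k])
    show "AE x in \<nu>. norm (s x ^ Suc k) \<le> norm (s x ^ (2 * k))"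
      using power_increasing[OF _ s1, of "Suc k" "2 * k"] k s0 by (auto simp: less_imp_le)
  qed measurable
  define B where "B = 2 * C * ((real (Suc k))\<^sup>2 * (\<integral>x. s x ^ (2 * k) \<partial>\<nu>)) + (\<integral>x. s x ^ Suc k \<partial>\<nu>)\<^sup>2"
  have bound: "(\<integral>\<^sup>+x. ennreal ((s x ^ Suc k / (1 + s x ^ Suc k / r))\<^sup>2) \<partial>\<nu>) \<le> ennreal B"
    if r: "0 < r" for r :: real
  proof -
    \<comment> \<open>A differentiable truncation: bounded by r and by y^(k+1), with a derivative no
      larger than that of y^(k+1). The resulting bound \<open>B\<close> does not involve r.\<close>
    define F where "F y = y ^ Suc k / (1 + y ^ Suc k / r)" for y
    define D where "D y = real (Suc k) * y ^ k / (1 + y ^ Suc k / r)\<^sup>2" for y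
    have pos: "0 < 1 + y ^ Suc k / r" if "0 < y" for y
      using that r by (intro add_pos_pos) auto
    have F_deriv: "(F has_real_derivative D y) (at y)" if "0 < y" for y
    proof -
      have 1: "((\<lambda>y. y ^ Suc k) has_real_derivative real (Suc k) * y ^ k) (at y)"
        using DERIV_pow[of "Suc k" y UNIV] by (simp only: diff_Suc_Suc diff_zero)
      have 2: "((\<lambda>y. 1 + y ^ Suc k / r) has_real_derivative real (Suc k) * y ^ k / r) (at y)"
        using DERIV_add[OF DERIV_const DERIV_cdivide[OF 1], of 1 r] by (simp only: add_0_left)
      have "(F has_real_derivative
          ((real (Suc k) * y ^ k) * (1 + y ^ Suc k / r) - y ^ Suc k * (real (Suc k) * y ^ k / r)) /
            ((1 + y ^ Suc k / r) * (1 + y ^ Suc k / r))) (at y)"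
        unfolding F_def[abs_def] by (rule DERIV_divide[OF 1 2]) (use pos[OF that] in linarith)
      also have "((real (Suc k) * y ^ k) * (1 + y ^ Suc k / r) - y ^ Suc k * (real (Suc k) * y ^ k / r))
         = real (Suc k) * y ^ k" by (simp add: algebra_simps add_divide_distrib)
      finally show ?thesis by (simp add: D_def power2_eq_square)
    qed
    define g where "g x = (D (s x) / s x) *\<^sub>R x" for x :: 'a
    have "GDERIV (\<lambda>x. F (s x)) x :> g x" for x
      using GDERIV_sqrt_one_plus_norm[OF F_deriv[OF s0[of x, unfolded s_def]]]
      by (simp add: s_def[abs_def] g_def)
    moreover have "continuous_on UNIV g"
    proof -
      have cs: "continuous_on UNIV s"
        unfolding s_def[abs_def] by (intro continuous_intros)
      have "s x \<noteq> 0" "1 + s x ^ Suc k / r \<noteq> 0" for x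
        using s0[of x] pos[OF s0[of x]] by linarith+
      thus ?thesis
        unfolding g_def[abs_def] D_def
        by (intro continuous_intros cs) (use r in \<open>simp_all del: power_Suc\<close>)
    qed
    moreover have F_bd: "0 < F (s x)" "F (s x) \<le> s x ^ Suc k" "F (s x) \<le> r" for x
    proof -
      define h where "h = s x ^ Suc k"
      have h: "0 < h" using s0 by (simp add: h_def)
      have F: "F (s x) = h / (1 + h / r)" by (simp add: F_def h_def)
      have hr: "0 < h / r" using h r by simp
      show "0 < F (s x)" unfolding F using h hr by (intro divide_pos_pos) linarith+
      show "F (s x) \<le> s x ^ Suc k"
        unfolding F h_def[symmetric] using h hr mult_pos_pos[OF h hr] by (intro mult_imp_div_pos_le) (auto simp: algebra_simps)
      show "F (s x) \<le> r"
        unfolding F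
      proof (rule mult_imp_div_pos_le)
        show "0 < 1 + h / r" using hr by linarith
        show "h \<le> r * (1 + h / r)" using r by (simp add: distrib_left)
      qed
    qed
    have [measurable]: "(\<lambda>x. F (s x)) \<in> borel_measurable borel"
      unfolding F_def by measurable
    have [measurable]: "g \<in> borel_measurable borel"
      using \<open>continuous_on UNIV g\<close> by (rule borel_measurable_continuous_onI)
    have intF: "integrable \<nu> (\<lambda>x. F (s x))"
      using F_bd by (intro integrable_const_bound[where B=r]) (auto simp: less_imp_le)
    have intF2: "integrable \<nu> (\<lambda>x. (F (s x))\<^sup>2)"
      using F_bd by (intro integrable_const_bound[where B="r\<^sup>2"])
        (auto simp: less_imp_le intro!: power_mono)
    have g_le: "(norm (g x))\<^sup>2 \<le> (real (Suc k))\<^sup>2 * s x ^ (2 * k)" for x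
    proof -
      have "0 < s x ^ Suc k / r" using s0[of x] r by simp
      hence q: "1 \<le> (1 + s x ^ Suc k / r)\<^sup>2" by (intro one_le_power) linarith
      have "D (s x) \<le> real (Suc k) * s x ^ k"
        unfolding D_def
      proof (rule mult_imp_div_pos_le)
        show "0 < (1 + s x ^ Suc k / r)\<^sup>2" using q by linarith
        have "0 \<le> real (Suc k) * s x ^ k" using s0[of x] by simp
        from mult_left_mono[OF q this]
        show "real (Suc k) * s x ^ k \<le> real (Suc k) * s x ^ k * (1 + s x ^ Suc k / r)\<^sup>2"
          by (simp only: mult_1_right)
      qed
      moreover have "0 \<le> D (s x)" unfolding D_def using s0[of x] by simp
      moreover have "norm (g x) = D (s x) * (norm x / s x)"
        unfolding g_def using s0[of x] calculation(2) by simp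
      moreover have "norm x / s x \<le> 1" using norm_le[of x] s0[of x] by simp
      ultimately have "norm (g x) \<le> real (Suc k) * s x ^ k"
        by (smt (verit) mult_left_le)
      from power_mono[OF this norm_ge_zero, of 2] show ?thesis
        by (simp only: power_mult_distrib power_mult[symmetric] mult.commute[of k 2])
    qed
    have intg: "integrable \<nu> (\<lambda>x. (norm (g x))\<^sup>2)"
    proof (rule Bochner_Integration.integrable_bound[OF integrable_mult_right[OF int2k]])
      show "AE x in \<nu>. norm ((norm (g x))\<^sup>2) \<le> norm ((real (Suc k))\<^sup>2 * s x ^ (2 * k))"
        using order_trans[OF g_le abs_ge_self] by (intro AE_I2) (simp only: real_norm_def abs_power2)
    qed measurable
    ultimately have "(\<integral>x. (F (s x))\<^sup>2 \<partial>\<nu>) \<le> 2 * C * (\<integral>x. (norm (g x))\<^sup>2 \<partial>\<nu>) + (\<integral>x. F (s x) \<partial>\<nu>)\<^sup>2"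
      using C(2)[of "\<lambda>x. F (s x)" g] intF intF2 F_bd(1)
      by (intro log_sobolev_second_moment \<nu>(1)) auto
    also have "\<dots> \<le> B"
      unfolding B_def
    proof (intro add_mono mult_left_mono power_mono)
      show "(\<integral>x. (norm (g x))\<^sup>2 \<partial>\<nu>) \<le> (real (Suc k))\<^sup>2 * (\<integral>x. s x ^ (2 * k) \<partial>\<nu>)"
        using integral_mono[OF intg integrable_mult_right[OF int2k] g_le] by simp
      show "(\<integral>x. F (s x) \<partial>\<nu>) \<le> (\<integral>x. s x ^ Suc k \<partial>\<nu>)"
        using F_bd(2) by (intro integral_mono intF intk)
      show "0 \<le> (\<integral>x. F (s x) \<partial>\<nu>)" using F_bd(1) by (simp add: less_imp_le)
    qed (use C in auto)
    finally have "(\<integral>x. (F (s x))\<^sup>2 \<partial>\<nu>) \<le> B" .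
    hence "ennreal (\<integral>x. (F (s x))\<^sup>2 \<partial>\<nu>) \<le> ennreal B" by (rule ennreal_leI)
    thus ?thesis using nn_integral_eq_integral[OF intF2] by (simp add: F_def)
  qed
  \<comment> \<open>The truncation is released along r = n + 1; Fatou's lemma transfers the uniform
    bound to the limit.\<close>
  have lim: "(\<lambda>n. ennreal ((s x ^ Suc k / (1 + s x ^ Suc k / real (Suc n)))\<^sup>2)) \<longlonglongrightarrow> ennreal ((s x ^ Suc k)\<^sup>2)" for x
  proof -
    have "(\<lambda>n. s x ^ Suc k / real (Suc n)) \<longlonglongrightarrow> 0"
      using LIMSEQ_Suc[OF lim_const_over_n[of "s x ^ Suc k"]] .
    hence "(\<lambda>n. (s x ^ Suc k / (1 + s x ^ Suc k / real (Suc n)))\<^sup>2) \<longlonglongrightarrow> (s x ^ Suc k / (1 + 0))\<^sup>2"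
      by (intro tendsto_intros) auto
    thus ?thesis by (intro tendsto_ennrealI) simp
  qed
  have "(\<integral>\<^sup>+x. ennreal ((s x ^ Suc k)\<^sup>2) \<partial>\<nu>)
      = (\<integral>\<^sup>+x. liminf (\<lambda>n. ennreal ((s x ^ Suc k / (1 + s x ^ Suc k / real (Suc n)))\<^sup>2)) \<partial>\<nu>)"
    using lim_imp_Liminf[OF _ lim] by (intro nn_integral_cong) simp
  also have "\<dots> \<le> liminf (\<lambda>n. \<integral>\<^sup>+x. ennreal ((s x ^ Suc k / (1 + s x ^ Suc k / real (Suc n)))\<^sup>2) \<partial>\<nu>)"
    by (rule nn_integral_liminf) measurable
  also have "\<dots> \<le> ennreal B"
    by (rule order_trans[OF Liminf_le_Limsup Limsup_bounded])
      (use bound in \<open>auto intro!: always_eventually\<close>)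
  finally have "(\<integral>\<^sup>+x. ennreal ((s x ^ Suc k)\<^sup>2) \<partial>\<nu>) < \<infinity>"
    using ennreal_less_top le_less_trans by (metis infinity_ennreal_def)
  hence "integrable \<nu> (\<lambda>x. (s x ^ Suc k)\<^sup>2)"
    by (intro integrableI_nonneg) auto
  moreover have "(s x ^ Suc k)\<^sup>2 = s x ^ (2 * Suc k)" for x
    by (simp only: power_mult[symmetric] mult.commute)
  ultimately show ?thesis by (simp only: s_def)
qed

lemma log_sobolev_integrable_norm_power:
  fixes \<nu> :: "'a::euclidean_space measure"
  assumes \<nu>: "prob_space \<nu>" "sets \<nu> = sets borel" and ls: "log_sobolev \<nu>"
    and int: "integrable \<nu> (\<lambda>x. (norm x)\<^sup>2)"
  shows "integrable \<nu> (\<lambda>x. norm x ^ (2 * k))"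
proof -
  interpret prob_space \<nu> by fact
  note [measurable_cong] = \<nu>(2)
  have "integrable \<nu> (\<lambda>x. sqrt (1 + inner x x) ^ (2 * Suc k))" for k
  proof (induction k)
    case 0
    have "integrable \<nu> (\<lambda>x. 1 + (norm x)\<^sup>2)" using int by auto
    thus ?case by (simp add: power2_norm_eq_inner)
  next
    case (Suc k)
    show ?case by (rule log_sobolev_integrable_power_Suc[OF \<nu> ls _ Suc]) simp
  qed
  from this[of k] show ?thesis
  proof (rule Bochner_Integration.integrable_bound)
    have "norm x ^ (2 * k) \<le> sqrt (1 + inner x x) ^ (2 * Suc k)" for x :: 'a
    proof -
      have "norm x ^ (2 * k) \<le> sqrt (1 + inner x x) ^ (2 * k)"
        by (intro power_mono) (simp_all add: norm_eq_sqrt_inner)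
      also have "\<dots> \<le> sqrt (1 + inner x x) ^ (2 * Suc k)"
        by (intro power_increasing) simp_all
      finally show ?thesis .
    qed
    thus "AE x in \<nu>. norm (norm x ^ (2 * k)) \<le> norm (sqrt (1 + inner x x) ^ (2 * Suc k))"
      by (intro AE_I2) simp
  qed measurable
qed

section \<open>Quadratic forms in independent variables\<close>

lemma borel_measurable_cnj [measurable]:
  assumes "f \<in> borel_measurable M" shows "(\<lambda>x. cnj (f x)) \<in> borel_measurable M"
  by (rule measurable_compose[OF assms]) (intro borel_measurable_continuous_onI continuous_intros)

lemma power4_sum3: "(a + b + c) ^ 4 \<le> 27 * (a ^ 4 + b ^ 4 + c ^ 4)" if "0 \<le> a" "0 \<le> b" "0 \<le> c" for a b c :: real
proof -
  have sq: "(a + b + c)\<^sup>2 \<le> 3 * (a\<^sup>2 + b\<^sup>2 + c\<^sup>2)" for a b c :: real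
  proof -
    have "0 \<le> (a - b)\<^sup>2 + (b - c)\<^sup>2 + (a - c)\<^sup>2" by simp
    thus ?thesis by (simp add: power2_eq_square algebra_simps)
  qed
  have "(a + b + c) ^ 4 = ((a + b + c)\<^sup>2)\<^sup>2" by (simp flip: power_mult)
  also have "\<dots> \<le> (3 * (a\<^sup>2 + b\<^sup>2 + c\<^sup>2))\<^sup>2" by (intro power_mono sq) simp
  also have "\<dots> = 9 * (a\<^sup>2 + b\<^sup>2 + c\<^sup>2)\<^sup>2" by (simp only: power_mult_distrib) simp
  also have "\<dots> \<le> 9 * (3 * ((a\<^sup>2)\<^sup>2 + (b\<^sup>2)\<^sup>2 + (c\<^sup>2)\<^sup>2))" using sq[of "a\<^sup>2" "b\<^sup>2" "c\<^sup>2"] by simp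
  finally show ?thesis by (simp flip: power_mult)
qed

text \<open>The term linear in d is kept exactly, because it will have mean zero. All others are
  estimated by |Re (cnj q * d)| \<le> |q| |d| and 2 |q| |d| \<le> |q|^2 + |d|^2, which gives 8 = 2 +
  4 + 2 and 3 = 1 + 2.\<close>

lemma norm_add_power4_le:
  fixes q d :: complex
  shows "cmod (q + d) ^ 4 \<le> cmod q ^ 4 + 4 * (cmod q)\<^sup>2 * Re (cnj q * d) + 8 * (cmod q)\<^sup>2 * (cmod d)\<^sup>2 + 3 * cmod d ^ 4"
proof -
  define x y r where "x = cmod q" and "y = cmod d" and "r = Re (cnj q * d)"
  have r: "\<bar>r\<bar> \<le> x * y"
    using abs_Re_le_cmod[of "cnj q * d"] by (simp add: r_def x_def y_def norm_mult)
  have "(cmod (q + d))\<^sup>2 = x\<^sup>2 + 2 * r + y\<^sup>2"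
    unfolding x_def y_def r_def cmod_power2 by (simp add: power2_eq_square algebra_simps)
  hence "cmod (q + d) ^ 4 = (x\<^sup>2 + 2 * r + y\<^sup>2)\<^sup>2"
    by (metis (no_types) mult_2 numeral_Bit0 power_add power2_eq_square)
  also have "\<dots> = x ^ 4 + 4 * r\<^sup>2 + y ^ 4 + 4 * x\<^sup>2 * r + 2 * x\<^sup>2 * y\<^sup>2 + 4 * r * y\<^sup>2"
    by (simp add: power2_eq_square power4_eq_xxxx algebra_simps)
  also have "r\<^sup>2 \<le> (x * y)\<^sup>2" using r by (simp add: abs_le_square_iff[symmetric] x_def y_def)
  also have "4 * r * y\<^sup>2 \<le> 4 * (x * y) * y\<^sup>2"
    using r by (intro mult_right_mono mult_left_mono) auto
  also have "4 * (x * y) * y\<^sup>2 \<le> 2 * x\<^sup>2 * y\<^sup>2 + 2 * y ^ 4"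
  proof -
    have "0 \<le> 2 * y\<^sup>2 * (x - y)\<^sup>2" by simp
    thus ?thesis by (simp add: power2_eq_square power4_eq_xxxx algebra_simps)
  qed
  finally show ?thesis by (simp add: x_def y_def r_def power_mult_distrib algebra_simps)
qed

lemma ennreal_power2_le_imp_le:
  assumes "x\<^sup>2 \<le> (ennreal c)\<^sup>2" "0 \<le> c"
  shows "x \<le> ennreal c"
proof (cases x)
  case (real r)
  hence "r\<^sup>2 \<le> c\<^sup>2" using assms by (simp add: ennreal_power)
  from power2_le_imp_le[OF this assms(2)] show ?thesis
    unfolding real(2) by (rule ennreal_leI)
next
  case top
  thus ?thesis using assms by (simp add: ennreal_power top_unique)
qed

text \<open>The linear term integrates to zero, and the second moment of D is at most
  \<open>e\<close> because the variance of |D|^2 is nonnegative.\<close>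

lemma (in prob_space) expectation_add_power4_le:
  fixes D :: "'a \<Rightarrow> complex"
  assumes [measurable]: "D \<in> borel_measurable M"
    and int: "integrable M (\<lambda>x. cmod (D x) ^ 4)"
    and mean: "expectation D = 0" and e: "expectation (\<lambda>x. cmod (D x) ^ 4) \<le> e\<^sup>2" "0 \<le> e"
  shows "(\<integral>\<^sup>+x. ennreal (cmod (q + D x) ^ 4) \<partial>M) \<le> ennreal (cmod q ^ 4 + 8 * (cmod q)\<^sup>2 * e + 3 * e\<^sup>2)"
proof -
  have int2: "integrable M (\<lambda>x. (cmod (D x))\<^sup>2)"
    by (rule square_integrable_imp_integrable) (use int in \<open>simp_all flip: power_mult\<close>)
  have int1: "integrable M D"
    using square_integrable_imp_integrable[of "\<lambda>x. cmod (D x)"] int2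
    by (simp add: integrable_norm_iff)
  have "(expectation (\<lambda>x. (cmod (D x))\<^sup>2))\<^sup>2 \<le> expectation (\<lambda>x. ((cmod (D x))\<^sup>2)\<^sup>2)"
    using variance_eq[of "\<lambda>x. (cmod (D x))\<^sup>2"] variance_positive[of "\<lambda>x. (cmod (D x))\<^sup>2"] int2 int
    by (simp flip: power_mult)
  also have "\<dots> \<le> e\<^sup>2" using e by (simp flip: power_mult)
  finally have D2: "expectation (\<lambda>x. (cmod (D x))\<^sup>2) \<le> e"
    using e(2) by (rule power2_le_imp_le)
  define r where "r x = Re (cnj q * D x)" for x
  define d2 where "d2 x = (cmod (D x))\<^sup>2" for x
  define d4 where "d4 x = cmod (D x) ^ 4" for x
  define U where "U x = cmod q ^ 4 + 4 * (cmod q)\<^sup>2 * r x + 8 * (cmod q)\<^sup>2 * d2 x + 3 * d4 x" for x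
  have ints: "integrable M r" "integrable M d2" "integrable M d4"
    using int int1 int2 by (auto simp: r_def[abs_def] d2_def[abs_def] d4_def[abs_def])
  have intU: "integrable M U" unfolding U_def using ints by auto
  have "expectation r = 0"
    unfolding r_def[abs_def] using int1 mean by (subst integral_Re) auto
  hence "expectation U = cmod q ^ 4 + 8 * (cmod q)\<^sup>2 * expectation d2 + 3 * expectation d4"
    unfolding U_def using ints by (simp add: prob_space)
  also have "\<dots> = cmod q ^ 4 + 8 * (cmod q)\<^sup>2 * expectation (\<lambda>x. (cmod (D x))\<^sup>2) + 3 * expectation (\<lambda>x. cmod (D x) ^ 4)"
    by (simp only: d2_def[abs_def] d4_def[abs_def])
  also have "\<dots> \<le> cmod q ^ 4 + 8 * (cmod q)\<^sup>2 * e + 3 * e\<^sup>2"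
    using D2 e by (intro add_mono mult_left_mono) auto
  finally have EU: "expectation U \<le> cmod q ^ 4 + 8 * (cmod q)\<^sup>2 * e + 3 * e\<^sup>2" .
  have le: "cmod (q + D x) ^ 4 \<le> U x" for x
    unfolding U_def r_def d2_def d4_def by (rule norm_add_power4_le)
  hence "(\<integral>\<^sup>+x. ennreal (cmod (q + D x) ^ 4) \<partial>M) \<le> (\<integral>\<^sup>+x. ennreal (U x) \<partial>M)"
    by (intro nn_integral_mono ennreal_leI)
  also have "\<dots> = ennreal (expectation U)"
    using le by (intro nn_integral_eq_integral intU AE_I2) (meson order_trans zero_le_power norm_ge_zero)
  finally show ?thesis using EU by (meson ennreal_leI order_trans)
qed

text \<open>The recursion \<open>y \<mapsto> y + 8 \<surd>(y C) s + 3 C s\<^sup>2\<close> preserves bounds \<open>y \<le> K S\<^sup>2\<close> under \<open>S \<mapsto> S + s\<close>.\<close>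

lemma power4_moment_step:
  fixes N :: "'b measure" and \<nu> :: "'c measure" and q :: "'b \<Rightarrow> complex" and e :: "'b \<Rightarrow> real"
  assumes [measurable]: "q \<in> borel_measurable N" "e \<in> borel_measurable N"
    and e: "\<And>g. 0 \<le> e g"
    and q4: "(\<integral>\<^sup>+g. ennreal (cmod (q g) ^ 4) \<partial>N) \<le> ennreal (K * S\<^sup>2)"
    and e2: "(\<integral>\<^sup>+g. ennreal ((e g)\<^sup>2) \<partial>N) \<le> ennreal (C * s\<^sup>2)"
    and nn: "0 \<le> C" "0 \<le> S" "0 \<le> s" and K: "K = 16 * C"
    and f: "\<And>g. g \<in> space N \<Longrightarrow> f g \<le> ennreal (cmod (q g) ^ 4 + 8 * (cmod (q g))\<^sup>2 * e g + 3 * (e g)\<^sup>2)"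
  shows "(\<integral>\<^sup>+g. f g \<partial>N) \<le> ennreal (K * (S + s)\<^sup>2)"
proof -
  have "(\<integral>\<^sup>+g. ennreal ((cmod (q g))\<^sup>2) * ennreal (e g) \<partial>N)\<^sup>2
      \<le> (\<integral>\<^sup>+g. (ennreal ((cmod (q g))\<^sup>2))\<^sup>2 \<partial>N) * (\<integral>\<^sup>+g. (ennreal (e g))\<^sup>2 \<partial>N)"
    by (rule Cauchy_Schwarz_nn_integral) measurable
  also have "\<dots> \<le> ennreal (K * S\<^sup>2) * ennreal (C * s\<^sup>2)"
    using q4 e2 e by (intro mult_mono) (simp_all add: ennreal_power flip: power_mult)
  also have "\<dots> = (ennreal (4 * C * S * s))\<^sup>2"
    using nn K by (simp add: ennreal_power flip: ennreal_mult) (simp add: power2_eq_square mult_ac)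
  finally have cross: "(\<integral>\<^sup>+g. ennreal ((cmod (q g))\<^sup>2) * ennreal (e g) \<partial>N) \<le> ennreal (4 * C * S * s)"
    by (rule ennreal_power2_le_imp_le) (use nn in simp)
  have "(\<integral>\<^sup>+g. f g \<partial>N) \<le> (\<integral>\<^sup>+g. ennreal (cmod (q g) ^ 4) + 8 * (ennreal ((cmod (q g))\<^sup>2) * ennreal (e g)) + 3 * ennreal ((e g)\<^sup>2) \<partial>N)"
  proof (intro nn_integral_mono)
    fix g assume "g \<in> space N"
    have "ennreal (cmod (q g) ^ 4 + 8 * (cmod (q g))\<^sup>2 * e g + 3 * (e g)\<^sup>2)
      = ennreal (cmod (q g) ^ 4) + 8 * (ennreal ((cmod (q g))\<^sup>2) * ennreal (e g)) + 3 * ennreal ((e g)\<^sup>2)"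
      using e[of g] by (simp add: ennreal_mult ennreal_plus mult.assoc)
    with f[OF \<open>g \<in> space N\<close>]
    show "f g \<le> ennreal (cmod (q g) ^ 4) + 8 * (ennreal ((cmod (q g))\<^sup>2) * ennreal (e g)) + 3 * ennreal ((e g)\<^sup>2)"
      by simp
  qed
  also have "\<dots> = (\<integral>\<^sup>+g. ennreal (cmod (q g) ^ 4) \<partial>N) + 8 * (\<integral>\<^sup>+g. ennreal ((cmod (q g))\<^sup>2) * ennreal (e g) \<partial>N)
      + 3 * (\<integral>\<^sup>+g. ennreal ((e g)\<^sup>2) \<partial>N)"
    by (simp add: nn_integral_add nn_integral_cmult)
  also have "\<dots> \<le> ennreal (K * S\<^sup>2) + 8 * ennreal (4 * C * S * s) + 3 * ennreal (C * s\<^sup>2)"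
    by (intro add_mono mult_left_mono q4 e2 cross) auto
  also have "\<dots> = ennreal (K * S\<^sup>2 + 8 * (4 * C * S * s) + 3 * (C * s\<^sup>2))"
  proof -
    have "8 * ennreal (4 * C * S * s) = ennreal (8 * (4 * C * S * s))"
      "3 * ennreal (C * s\<^sup>2) = ennreal (3 * (C * s\<^sup>2))"
      using nn by (subst ennreal_mult; simp)+
    moreover have "0 \<le> K * S\<^sup>2" "0 \<le> 8 * (4 * C * S * s)" "0 \<le> 3 * (C * s\<^sup>2)"
      using nn K by simp_all
    ultimately show ?thesis by (simp only: ennreal_plus add_nonneg_nonneg)
  qed
  also have "\<dots> \<le> ennreal (K * (S + s)\<^sup>2)"
  \<comment> \<open>The choice K = 16 C is made for this: Cauchy-Schwarz produces sqrt(K C) = 4 C,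
    and 8 * 4 C S s is exactly the mixed term 2 K S s of K (S + s)^2.\<close>
  proof (rule ennreal_leI)
    have "0 \<le> C * s\<^sup>2" using nn by simp
    thus "K * S\<^sup>2 + 8 * (4 * C * S * s) + 3 * (C * s\<^sup>2) \<le> K * (S + s)\<^sup>2"
      unfolding K power2_sum by (simp add: algebra_simps)
  qed
  finally show ?thesis .
qed

text \<open>\<open>N\<close> lives on the original scalars and \<open>h\<close> carries its samples
  into the complex numbers. The eighth moment is required because the diagonal terms of a quadratic
  form contain |h|^2 - 1, whose fourth moment must be finite.\<close>

locale unit_noise = prob_space N for N :: "'c measure" +
  fixes h :: "'c \<Rightarrow> complex"
  assumes h [measurable]: "h \<in> borel_measurable N"
    and int8: "integrable N (\<lambda>x. cmod (h x) ^ 8)"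
    and mean0: "expectation h = 0"
    and var1: "expectation (\<lambda>x. (cmod (h x))\<^sup>2) = 1"
begin

section \<open>Fourth moments of linear and quadratic forms\<close>

definition \<kappa> :: real where
  "\<kappa> = expectation (\<lambda>x. cmod (h x) ^ 4) + expectation (\<lambda>x. ((cmod (h x))\<^sup>2 - 1) ^ 4)"

lemma int4: "integrable N (\<lambda>x. cmod (h x) ^ 4)"
  by (rule square_integrable_imp_integrable) (use int8 in \<open>simp_all flip: power_mult\<close>)

lemma int2: "integrable N (\<lambda>x. (cmod (h x))\<^sup>2)"
  by (rule square_integrable_imp_integrable) (use int4 in \<open>simp_all flip: power_mult\<close>)

lemma int1: "integrable N h"
  using square_integrable_imp_integrable[of "\<lambda>x. cmod (h x)"] int2 by (simp add: integrable_norm_iff)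

lemma int4c: "integrable N (\<lambda>x. ((cmod (h x))\<^sup>2 - 1) ^ 4)"
proof (rule Bochner_Integration.integrable_bound[where f="\<lambda>x. 1 + cmod (h x) ^ 8"])
  show "integrable N (\<lambda>x. 1 + cmod (h x) ^ 8)" using int8 by simp
  have "\<bar>y - 1\<bar> ^ 4 \<le> 1 + y ^ 4" if "0 \<le> y" for y :: real
  proof (cases "y \<le> 1")
    case True
    hence "\<bar>y - 1\<bar> ^ 4 \<le> 1" using that by (intro power_le_one) auto
    thus ?thesis using that by (simp add: add_increasing2)
  next
    case False
    hence "\<bar>y - 1\<bar> ^ 4 \<le> y ^ 4" by (intro power_mono) auto
    thus ?thesis by simp
  qed
  from this[of "(cmod (h x))\<^sup>2" for x]
  have "((cmod (h x))\<^sup>2 - 1) ^ 4 \<le> 1 + cmod (h x) ^ 8" for x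
    by (simp flip: power_mult)
  thus "AE x in N. norm (((cmod (h x))\<^sup>2 - 1) ^ 4) \<le> norm (1 + cmod (h x) ^ 8)"
    by (intro AE_I2) simp
qed measurable

lemma \<kappa>_nonneg: "0 \<le> \<kappa>"
  unfolding \<kappa>_def by (intro add_nonneg_nonneg integral_nonneg_AE AE_I2) simp_all

lemma moment4_le: "expectation (\<lambda>x. cmod (h x) ^ 4) \<le> \<kappa>"
  unfolding \<kappa>_def by (simp add: integral_nonneg_AE)

lemma moment4c_le: "expectation (\<lambda>x. ((cmod (h x))\<^sup>2 - 1) ^ 4) \<le> \<kappa>"
  unfolding \<kappa>_def by (simp add: integral_nonneg_AE)

sublocale prod: product_sigma_finite "\<lambda>_. N"
  by standard

lemma prob_space_PiM_N: "prob_space (Pi\<^sub>M I (\<lambda>_. N))"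
  by (intro prob_space_PiM) unfold_locales

lemma measurable_h_component [measurable]: "i \<in> I \<Longrightarrow> (\<lambda>g. h (g i)) \<in> borel_measurable (Pi\<^sub>M I (\<lambda>_. N))"
  by measurable

text \<open>The coordinates are added one at a time. Given the earlier ones the new summand has mean
  zero, and the sum of the |c i|^2 plays the role of S in \<open>power4_moment_step\<close>.\<close>

lemma linear_form_moment4:
  assumes "finite I"
  shows "(\<integral>\<^sup>+g. ennreal (cmod (\<Sum>i\<in>I. c i * h (g i)) ^ 4) \<partial>Pi\<^sub>M I (\<lambda>_. N))
    \<le> ennreal (16 * \<kappa> * (\<Sum>i\<in>I. (cmod (c i))\<^sup>2)\<^sup>2)"
  using assms
proof (induction I)
  case empty
  thus ?case by simp
next
  case (insert k I)
  have "(\<integral>\<^sup>+g. ennreal (cmod (\<Sum>i\<in>insert k I. c i * h (g i)) ^ 4) \<partial>Pi\<^sub>M (insert k I) (\<lambda>_. N))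
    = (\<integral>\<^sup>+g. (\<integral>\<^sup>+x. ennreal (cmod (\<Sum>i\<in>insert k I. c i * h ((g(k := x)) i)) ^ 4) \<partial>N) \<partial>Pi\<^sub>M I (\<lambda>_. N))"
    using insert by (intro prod.product_nn_integral_insert) auto
  also have "\<dots> = (\<integral>\<^sup>+g. (\<integral>\<^sup>+x. ennreal (cmod ((\<Sum>i\<in>I. c i * h (g i)) + c k * h x) ^ 4) \<partial>N) \<partial>Pi\<^sub>M I (\<lambda>_. N))"
  proof (intro nn_integral_cong)
    fix g x
    have "(\<Sum>i\<in>I. c i * h ((g(k := x)) i)) = (\<Sum>i\<in>I. c i * h (g i))"
      using insert by (intro sum.cong) auto
    thus "ennreal (cmod (\<Sum>i\<in>insert k I. c i * h ((g(k := x)) i)) ^ 4)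
      = ennreal (cmod ((\<Sum>i\<in>I. c i * h (g i)) + c k * h x) ^ 4)"
      using insert by (simp add: add.commute)
  qed
  also have "\<dots> \<le> ennreal (16 * \<kappa> * ((\<Sum>i\<in>I. (cmod (c i))\<^sup>2) + (cmod (c k))\<^sup>2)\<^sup>2)"
  proof (rule power4_moment_step[where C=\<kappa> and e="\<lambda>_. sqrt \<kappa> * (cmod (c k))\<^sup>2"])
    interpret P: prob_space "Pi\<^sub>M I (\<lambda>_. N)" by (rule prob_space_PiM_N)
    show "(\<integral>\<^sup>+g. ennreal ((sqrt \<kappa> * (cmod (c k))\<^sup>2)\<^sup>2) \<partial>Pi\<^sub>M I (\<lambda>_. N)) \<le> ennreal (\<kappa> * ((cmod (c k))\<^sup>2)\<^sup>2)"
      using \<kappa>_nonneg by (simp add: P.emeasure_space_1 power_mult_distrib)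
    show "(\<integral>\<^sup>+x. ennreal (cmod ((\<Sum>i\<in>I. c i * h (g i)) + c k * h x) ^ 4) \<partial>N)
      \<le> ennreal (cmod (\<Sum>i\<in>I. c i * h (g i)) ^ 4 +
           8 * (cmod (\<Sum>i\<in>I. c i * h (g i)))\<^sup>2 * (sqrt \<kappa> * (cmod (c k))\<^sup>2) + 3 * (sqrt \<kappa> * (cmod (c k))\<^sup>2)\<^sup>2)" for g
    proof (rule expectation_add_power4_le)
      show "expectation (\<lambda>x. cmod (c k * h x) ^ 4) \<le> (sqrt \<kappa> * (cmod (c k))\<^sup>2)\<^sup>2"
        using mult_right_mono[OF moment4_le, of "cmod (c k) ^ 4"] \<kappa>_nonneg
        by (simp add: norm_mult power_mult_distrib mult.commute flip: power_mult)
    qed (use int4 int1 mean0 \<kappa>_nonneg in \<open>auto simp: norm_mult power_mult_distrib\<close>)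
  qed (use insert \<kappa>_nonneg in \<open>auto intro!: sum_nonneg borel_measurable_sum borel_measurable_times\<close>)
  finally show ?case using insert by (simp add: add.commute)
qed

text \<open>Centred: independence, mean zero and variance one make the trace the expectation of the
  double sum.\<close>

definition qform :: "'i set \<Rightarrow> ('i \<Rightarrow> 'i \<Rightarrow> complex) \<Rightarrow> ('i \<Rightarrow> 'c) \<Rightarrow> complex" where
  "qform I F g = (\<Sum>i\<in>I. \<Sum>j\<in>I. cnj (h (g i)) * F i j * h (g j)) - (\<Sum>i\<in>I. F i i)"

definition hs2 :: "'i set \<Rightarrow> ('i \<Rightarrow> 'i \<Rightarrow> complex) \<Rightarrow> real" where
  "hs2 I F = (\<Sum>i\<in>I. \<Sum>j\<in>I. (cmod (F i j))\<^sup>2)"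

lemma measurable_qform [measurable]: "qform I F \<in> borel_measurable (Pi\<^sub>M I (\<lambda>_. N))"
  unfolding qform_def[abs_def]
  by (intro borel_measurable_diff borel_measurable_sum borel_measurable_times borel_measurable_const
      borel_measurable_cnj measurable_h_component)

text \<open>For fixed old coordinates each of the three new summands has mean zero in the new
  variable, so adding coordinates is a martingale step.\<close>

lemma qform_insert:
  assumes "finite I" "k \<notin> I"
  shows "qform (insert k I) F (g(k := x)) = qform I F g
    + (cnj (h x) * (\<Sum>j\<in>I. F k j * h (g j)) + (\<Sum>i\<in>I. cnj (h (g i)) * F i k) * h x
       + F k k * of_real ((cmod (h x))\<^sup>2 - 1))"
proof -
  define y where "y = g(k := x)"
  have yk: "y k = x" by (simp add: y_def)
  have yi: "y i = g i" if "i \<in> I" for i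
    using that assms by (auto simp: y_def)
  have "(\<Sum>i\<in>insert k I. \<Sum>j\<in>insert k I. cnj (h (y i)) * F i j * h (y j)) =
     (cnj (h x) * F k k * h x + (\<Sum>j\<in>I. cnj (h x) * F k j * h (g j))) +
     (\<Sum>i\<in>I. cnj (h (g i)) * F i k * h x + (\<Sum>j\<in>I. cnj (h (g i)) * F i j * h (g j)))"
    using assms by (simp add: yk yi cong: sum.cong)
  moreover have "cnj (h x) * F k k * h x = F k k * of_real ((cmod (h x))\<^sup>2)"
    by (simp only: complex_norm_square) simp
  ultimately show ?thesis
    using assms unfolding qform_def y_def[symmetric]
    by (simp add: sum.distrib sum_distrib_left sum_distrib_right algebra_simps)
qed

text \<open>\<open>l\<close> and \<open>l'\<close> are the row and column forms, constant once the
  old coordinates are fixed. The factor 27 comes from the fourth power of a sum of three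
  terms.\<close>

lemma increment_moment4:
  fixes l l' f :: complex
  defines "D \<equiv> \<lambda>x. cnj (h x) * l + l' * h x + f * of_real ((cmod (h x))\<^sup>2 - 1)"
  shows "integrable N (\<lambda>x. cmod (D x) ^ 4)" "expectation D = 0"
    "expectation (\<lambda>x. cmod (D x) ^ 4) \<le> (sqrt (27 * \<kappa>) * ((cmod l)\<^sup>2 + (cmod l')\<^sup>2 + (cmod f)\<^sup>2))\<^sup>2"
proof -
  define U where "U x = 27 * (cmod (h x) ^ 4 * cmod l ^ 4 + cmod (h x) ^ 4 * cmod l' ^ 4 + cmod f ^ 4 * ((cmod (h x))\<^sup>2 - 1) ^ 4)" for x
  have le: "cmod (D x) ^ 4 \<le> U x" for x
  proof -
    have "cmod (D x) \<le> cmod (h x) * cmod l + cmod l' * cmod (h x) + cmod f * \<bar>(cmod (h x))\<^sup>2 - 1\<bar>"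
      unfolding D_def by (intro order_trans[OF norm_triangle_ineq] add_mono) (simp_all add: norm_mult del: of_real_diff)
    hence "cmod (D x) ^ 4 \<le> (cmod (h x) * cmod l + cmod l' * cmod (h x) + cmod f * \<bar>(cmod (h x))\<^sup>2 - 1\<bar>) ^ 4"
      by (intro power_mono) auto
    also have "\<dots> \<le> 27 * ((cmod (h x) * cmod l) ^ 4 + (cmod l' * cmod (h x)) ^ 4 + (cmod f * \<bar>(cmod (h x))\<^sup>2 - 1\<bar>) ^ 4)"
      by (rule power4_sum3) auto
    finally show ?thesis by (simp add: U_def power_mult_distrib mult.commute)
  qed
  have intU: "integrable N U" unfolding U_def using int4 int4c by auto
  have [measurable]: "D \<in> borel_measurable N"
    unfolding D_def by measurable
  show "integrable N (\<lambda>x. cmod (D x) ^ 4)"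
    by (rule Bochner_Integration.integrable_bound[OF intU])
      (use le order_trans[OF le abs_ge_self] in \<open>auto\<close>)
  note int = this
  have "expectation (\<lambda>x. cnj (h x)) = 0" using mean0 by simp
  moreover have "expectation (\<lambda>x. complex_of_real ((cmod (h x))\<^sup>2 - 1)) = 0"
  proof -
    have "expectation (\<lambda>x. (cmod (h x))\<^sup>2 - 1) = 0"
      using int2 var1 by (subst Bochner_Integration.integral_diff) (simp_all add: prob_space)
    thus ?thesis by (subst integral_complex_of_real) simp
  qed
  moreover have "integrable N (\<lambda>x. complex_of_real ((cmod (h x))\<^sup>2 - 1))"
    using int2 by (intro integrable_of_real) auto
  ultimately show "expectation D = 0"
    unfolding D_def using int1 mean0 by (simp del: of_real_diff of_real_power)
  have "expectation (\<lambda>x. cmod (D x) ^ 4) \<le> expectation U"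
    by (intro integral_mono int intU le)
  also have "\<dots> = 27 * (expectation (\<lambda>x. cmod (h x) ^ 4) * cmod l ^ 4 + expectation (\<lambda>x. cmod (h x) ^ 4) * cmod l' ^ 4
     + cmod f ^ 4 * expectation (\<lambda>x. ((cmod (h x))\<^sup>2 - 1) ^ 4))"
    unfolding U_def using int4 int4c by simp
  also have "\<dots> \<le> 27 * (\<kappa> * cmod l ^ 4 + \<kappa> * cmod l' ^ 4 + cmod f ^ 4 * \<kappa>)"
    by (intro mult_left_mono add_mono mult_right_mono moment4_le moment4c_le) auto
  also have "\<dots> = 27 * \<kappa> * (((cmod l)\<^sup>2)\<^sup>2 + ((cmod l')\<^sup>2)\<^sup>2 + ((cmod f)\<^sup>2)\<^sup>2)"
    by (simp add: algebra_simps flip: power_mult)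
  also have "\<dots> \<le> 27 * \<kappa> * ((cmod l)\<^sup>2 + (cmod l')\<^sup>2 + (cmod f)\<^sup>2)\<^sup>2"
  proof -
    have "a\<^sup>2 + b\<^sup>2 + c\<^sup>2 \<le> (a + b + c)\<^sup>2" if "0 \<le> a" "0 \<le> b" "0 \<le> c" for a b c :: real
      using that by (simp add: power2_eq_square algebra_simps add_nonneg_nonneg)
    from this[of "(cmod l)\<^sup>2" "(cmod l')\<^sup>2" "(cmod f)\<^sup>2"] show ?thesis
      using \<kappa>_nonneg by (intro mult_left_mono) auto
  qed
  finally show "expectation (\<lambda>x. cmod (D x) ^ 4) \<le> (sqrt (27 * \<kappa>) * ((cmod l)\<^sup>2 + (cmod l')\<^sup>2 + (cmod f)\<^sup>2))\<^sup>2"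
    using \<kappa>_nonneg by (simp add: power_mult_distrib)
qed

lemma hs2_insert:
  assumes "finite I" "k \<notin> I"
  shows "hs2 (insert k I) F = hs2 I F +
    ((\<Sum>j\<in>I. (cmod (F k j))\<^sup>2) + (\<Sum>j\<in>I. (cmod (F j k))\<^sup>2) + (cmod (F k k))\<^sup>2)"
  using assms by (simp add: hs2_def sum.distrib algebra_simps)

text \<open>Martingale induction over the coordinates: S is the squared Hilbert-Schmidt norm so far,
  and the increment is the sum of the new row, column and diagonal squares.\<close>

lemma qform_moment4:
  assumes "finite I"
  shows "(\<integral>\<^sup>+g. ennreal (cmod (qform I F g) ^ 4) \<partial>Pi\<^sub>M I (\<lambda>_. N))
    \<le> ennreal (16 * (81 * \<kappa> * (16 * \<kappa> + 1)) * (hs2 I F)\<^sup>2)"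
  using assms
proof (induction I)
  case empty
  thus ?case by (simp add: qform_def)
next
  case (insert k I)
  define l where "l g = (\<Sum>j\<in>I. F k j * h (g j))" for g
  define l' where "l' g = (\<Sum>i\<in>I. cnj (h (g i)) * F i k)" for g
  define a where "a = (\<Sum>j\<in>I. (cmod (F k j))\<^sup>2)"
  define b where "b = (\<Sum>j\<in>I. (cmod (F j k))\<^sup>2)"
  define d where "d = (cmod (F k k))\<^sup>2"
  define e where "e g = sqrt (27 * \<kappa>) * ((cmod (l g))\<^sup>2 + (cmod (l' g))\<^sup>2 + (cmod (F k k))\<^sup>2)" for g
  let ?P = "Pi\<^sub>M I (\<lambda>_. N)"
  interpret P: prob_space ?P by (rule prob_space_PiM_N)
  have abd: "0 \<le> a" "0 \<le> b" "0 \<le> d" by (simp_all add: a_def b_def d_def sum_nonneg)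
  have [measurable]: "l \<in> borel_measurable ?P" "l' \<in> borel_measurable ?P"
    unfolding l_def[abs_def] l'_def[abs_def]
    by (intro borel_measurable_sum borel_measurable_times borel_measurable_const
      borel_measurable_cnj measurable_h_component; assumption)+
  have "(\<integral>\<^sup>+g. ennreal (cmod (qform (insert k I) F g) ^ 4) \<partial>Pi\<^sub>M (insert k I) (\<lambda>_. N))
    = (\<integral>\<^sup>+g. (\<integral>\<^sup>+x. ennreal (cmod (qform (insert k I) F (g(k := x))) ^ 4) \<partial>N) \<partial>?P)"
    using insert by (intro prod.product_nn_integral_insert) auto
  also have "\<dots> = (\<integral>\<^sup>+g. (\<integral>\<^sup>+x. ennreal (cmod (qform I F g +
      (cnj (h x) * l g + l' g * h x + F k k * of_real ((cmod (h x))\<^sup>2 - 1))) ^ 4) \<partial>N) \<partial>?P)"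
    unfolding qform_insert[OF insert(1,2)] l_def l'_def ..
  also have "\<dots> \<le> ennreal (16 * (81 * \<kappa> * (16 * \<kappa> + 1)) * (hs2 I F + (a + b + d))\<^sup>2)"
  \<comment> \<open>The constant: 27 \<kappa> from the increment, 3 from squaring a sum of three
    terms, 16 \<kappa> from the fourth moments of the row and column forms, and 1 from the
    deterministic diagonal entry.\<close>
  proof (rule power4_moment_step[where C="81 * \<kappa> * (16 * \<kappa> + 1)" and e=e])
    show "e \<in> borel_measurable ?P" unfolding e_def[abs_def] by measurable
    show "0 \<le> e g" for g unfolding e_def using \<kappa>_nonneg by simp
    show "(\<integral>\<^sup>+x. ennreal (cmod (qform I F g +
        (cnj (h x) * l g + l' g * h x + F k k * of_real ((cmod (h x))\<^sup>2 - 1))) ^ 4) \<partial>N)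
      \<le> ennreal (cmod (qform I F g) ^ 4 + 8 * (cmod (qform I F g))\<^sup>2 * e g + 3 * (e g)\<^sup>2)" for g
      unfolding e_def
    proof (rule expectation_add_power4_le)
      show "(\<lambda>x. cnj (h x) * l g + l' g * h x + F k k * of_real ((cmod (h x))\<^sup>2 - 1)) \<in> borel_measurable N"
        by measurable
    qed (use increment_moment4 \<kappa>_nonneg in auto)
    have l4: "(\<integral>\<^sup>+g. ennreal (cmod (l g) ^ 4) \<partial>?P) \<le> ennreal (16 * \<kappa> * a\<^sup>2)"
      unfolding l_def a_def by (rule linear_form_moment4[OF insert(1)])
    have "cmod (l' g) = cmod (\<Sum>i\<in>I. cnj (F i k) * h (g i))" for g
    proof -
      have "l' g = cnj (\<Sum>i\<in>I. cnj (F i k) * h (g i))" by (simp add: l'_def mult.commute)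
      thus ?thesis by (metis complex_mod_cnj)
    qed
    hence l'4: "(\<integral>\<^sup>+g. ennreal (cmod (l' g) ^ 4) \<partial>?P) \<le> ennreal (16 * \<kappa> * b\<^sup>2)"
      using linear_form_moment4[OF insert(1), of "\<lambda>i. cnj (F i k)"] by (simp add: b_def)
    have e_le: "(e g)\<^sup>2 \<le> 81 * \<kappa> * (cmod (l g) ^ 4 + cmod (l' g) ^ 4 + d\<^sup>2)" for g
    proof -
      have "(x + y + z)\<^sup>2 \<le> 3 * (x\<^sup>2 + y\<^sup>2 + z\<^sup>2)" for x y z :: real
      proof -
        have "0 \<le> (x - y)\<^sup>2 + (y - z)\<^sup>2 + (x - z)\<^sup>2" by simp
        thus ?thesis by (simp add: power2_eq_square algebra_simps)
      qed
      from mult_left_mono[OF this, of "27 * \<kappa>" "(cmod (l g))\<^sup>2" "(cmod (l' g))\<^sup>2" d]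
      show ?thesis unfolding e_def d_def using \<kappa>_nonneg
        by (simp only: power_mult_distrib[of "sqrt (27 * \<kappa>)"]) (simp add: algebra_simps flip: power_mult)
    qed
    have "(\<integral>\<^sup>+g. ennreal ((e g)\<^sup>2) \<partial>?P)
      \<le> (\<integral>\<^sup>+g. ennreal (81 * \<kappa>) * (ennreal (cmod (l g) ^ 4) + ennreal (cmod (l' g) ^ 4) + ennreal (d\<^sup>2)) \<partial>?P)"
      using \<kappa>_nonneg by (intro nn_integral_mono order_trans[OF ennreal_leI[OF e_le]])
        (simp add: ennreal_mult ennreal_plus)
    also have "\<dots> = ennreal (81 * \<kappa>) * ((\<integral>\<^sup>+g. ennreal (cmod (l g) ^ 4) \<partial>?P)
        + (\<integral>\<^sup>+g. ennreal (cmod (l' g) ^ 4) \<partial>?P) + ennreal (d\<^sup>2))"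
      by (simp add: nn_integral_cmult nn_integral_add P.emeasure_space_1)
    also have "\<dots> \<le> ennreal (81 * \<kappa>) * (ennreal (16 * \<kappa> * a\<^sup>2) + ennreal (16 * \<kappa> * b\<^sup>2) + ennreal (d\<^sup>2))"
      by (intro mult_left_mono add_mono l4 l'4) auto
    also have "\<dots> = ennreal (81 * \<kappa> * (16 * \<kappa> * a\<^sup>2 + 16 * \<kappa> * b\<^sup>2 + d\<^sup>2))"
      using \<kappa>_nonneg by (simp only: ennreal_plus ennreal_mult add_nonneg_nonneg mult_nonneg_nonneg zero_le_power2 zero_le_numeral)
    also have "\<dots> \<le> ennreal (81 * \<kappa> * (16 * \<kappa> + 1) * (a + b + d)\<^sup>2)"
    proof (rule ennreal_leI)
      have "a\<^sup>2 + b\<^sup>2 + d\<^sup>2 \<le> (a + b + d)\<^sup>2"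
        using abd by (simp add: power2_eq_square algebra_simps add_nonneg_nonneg)
      hence "(16 * \<kappa> + 1) * (a\<^sup>2 + b\<^sup>2 + d\<^sup>2) \<le> (16 * \<kappa> + 1) * (a + b + d)\<^sup>2"
        using \<kappa>_nonneg by (intro mult_left_mono) auto
      moreover have "16 * \<kappa> * a\<^sup>2 + 16 * \<kappa> * b\<^sup>2 + d\<^sup>2 \<le> (16 * \<kappa> + 1) * (a\<^sup>2 + b\<^sup>2 + d\<^sup>2)"
        using \<kappa>_nonneg by (simp add: algebra_simps)
      ultimately have "16 * \<kappa> * a\<^sup>2 + 16 * \<kappa> * b\<^sup>2 + d\<^sup>2 \<le> (16 * \<kappa> + 1) * (a + b + d)\<^sup>2"
        by (rule order_trans[rotated])
      hence "81 * \<kappa> * (16 * \<kappa> * a\<^sup>2 + 16 * \<kappa> * b\<^sup>2 + d\<^sup>2) \<le> 81 * \<kappa> * ((16 * \<kappa> + 1) * (a + b + d)\<^sup>2)"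
        using \<kappa>_nonneg by (intro mult_left_mono) auto
      thus "81 * \<kappa> * (16 * \<kappa> * a\<^sup>2 + 16 * \<kappa> * b\<^sup>2 + d\<^sup>2) \<le> 81 * \<kappa> * (16 * \<kappa> + 1) * (a + b + d)\<^sup>2"
        by (simp only: mult.assoc)
    qed
    finally show "(\<integral>\<^sup>+g. ennreal ((e g)\<^sup>2) \<partial>?P) \<le> ennreal (81 * \<kappa> * (16 * \<kappa> + 1) * (a + b + d)\<^sup>2)" .
  qed (use insert \<kappa>_nonneg abd in \<open>auto simp: hs2_def intro!: sum_nonneg\<close>)
  finally show ?case unfolding hs2_insert[OF insert(1,2)] a_def b_def d_def .
qed

end

text \<open>Independence is given through generated sigma-algebras. Restating it as a product law
  allows the matrix to be frozen by Fubini while the noise is integrated.\<close>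

lemma (in prob_space) independent_product_law:
  fixes E :: "'k \<Rightarrow> 'a \<Rightarrow> 'b::second_countable_topology" and \<nu> :: "'b measure"
  assumes I: "I \<noteq> {}"
    and indep: "indep_vars (\<lambda>_. borel) E I"
    and law: "\<And>k. k \<in> I \<Longrightarrow> distr M borel (E k) = \<nu>"
    and \<nu>: "sets \<nu> = sets borel"
    and Y: "Y \<in> space M \<rightarrow> space S"
    and indep_Y: "indep_set (sets (vimage_algebra (space M) Y S))
      (sets (vimage_algebra (space M) (\<lambda>\<omega>. \<lambda>k\<in>I. E k \<omega>) (Pi\<^sub>M I (\<lambda>_. borel))))"
  shows "Y \<in> measurable M S" "(\<lambda>\<omega>. \<lambda>k\<in>I. E k \<omega>) \<in> measurable M (Pi\<^sub>M I (\<lambda>_. \<nu>))"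
    "distr M (S \<Otimes>\<^sub>M Pi\<^sub>M I (\<lambda>_. \<nu>)) (\<lambda>\<omega>. (Y \<omega>, \<lambda>k\<in>I. E k \<omega>)) = distr M S Y \<Otimes>\<^sub>M Pi\<^sub>M I (\<lambda>_. \<nu>)"
proof -
  let ?g = "\<lambda>\<omega>. \<lambda>k\<in>I. E k \<omega>"
  let ?P = "Pi\<^sub>M I (\<lambda>_. borel :: 'b measure)"
  have rv: "random_variable borel (E k)" if "k \<in> I" for k
    using indep that by (simp add: indep_vars_def2)
  have g: "?g \<in> measurable M ?P" by (intro measurable_restrict rv)
  have sets_eq: "sets (Pi\<^sub>M I (\<lambda>_. \<nu>)) = sets ?P" by (intro sets_PiM_cong refl) (rule \<nu>)
  \<comment> \<open>Members of independent families are events by definition, so measurability of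
    \<open>Y\<close> is part of the independence hypothesis.\<close>
  show Ym: "Y \<in> measurable M S"
  proof (rule measurableI)
    show "Y \<omega> \<in> space S" if "\<omega> \<in> space M" for \<omega> using Y that by auto
    fix A assume "A \<in> sets S"
    hence "Y -` A \<inter> space M \<in> sets (vimage_algebra (space M) Y S)"
      by (rule in_vimage_algebra)
    thus "Y -` A \<inter> space M \<in> sets M"
      using indep_Y by (auto simp: indep_set_def indep_sets_def split: bool.splits)
  qed
  show "?g \<in> measurable M (Pi\<^sub>M I (\<lambda>_. \<nu>))"
    using g measurable_cong_sets[OF refl sets_eq] by blast
  interpret Y: prob_space "distr M S Y" by (rule prob_space_distr) fact
  interpret g: prob_space "distr M ?P ?g" by (rule prob_space_distr) fact
  have 1: "distr M S Y \<Otimes>\<^sub>M distr M ?P ?g = distr M (S \<Otimes>\<^sub>M ?P) (\<lambda>\<omega>. (Y \<omega>, ?g \<omega>))"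
  proof (rule pair_measure_eqI)
    fix A B assume A: "A \<in> sets (distr M S Y)" and B: "B \<in> sets (distr M ?P ?g)"
    have pre: "(\<lambda>\<omega>. (Y \<omega>, ?g \<omega>)) -` (A \<times> B) \<inter> space M = (Y -` A \<inter> space M) \<inter> (?g -` B \<inter> space M)"
      by auto
    have "prob ((Y -` A \<inter> space M) \<inter> (?g -` B \<inter> space M)) = prob (Y -` A \<inter> space M) * prob (?g -` B \<inter> space M)"
      by (rule indep_setD[OF indep_Y]) (use A B in \<open>auto intro: in_vimage_algebra\<close>)
    hence "emeasure M ((Y -` A \<inter> space M) \<inter> (?g -` B \<inter> space M)) =
      emeasure M (Y -` A \<inter> space M) * emeasure M (?g -` B \<inter> space M)"
      by (simp add: emeasure_eq_measure ennreal_mult)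
    thus "emeasure (distr M S Y) A * emeasure (distr M ?P ?g) B
      = emeasure (distr M (S \<Otimes>\<^sub>M ?P) (\<lambda>\<omega>. (Y \<omega>, ?g \<omega>))) (A \<times> B)"
      using A B Ym g by (simp add: emeasure_distr pre)
  qed (auto intro: Y.sigma_finite_measure_axioms g.sigma_finite_measure_axioms)
  have "distr M ?P ?g = Pi\<^sub>M I (\<lambda>k. distr M borel (E k))"
    using indep_vars_iff_distr_eq_PiM'[where I=I and X=E and M'="\<lambda>_. borel"] I rv indep by simp
  also have "\<dots> = Pi\<^sub>M I (\<lambda>_. \<nu>)" by (intro PiM_cong refl law)
  finally have 2: "distr M ?P ?g = Pi\<^sub>M I (\<lambda>_. \<nu>)" .
  have "distr M (S \<Otimes>\<^sub>M Pi\<^sub>M I (\<lambda>_. \<nu>)) (\<lambda>\<omega>. (Y \<omega>, ?g \<omega>)) = distr M (S \<Otimes>\<^sub>M ?P) (\<lambda>\<omega>. (Y \<omega>, ?g \<omega>))"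
    by (intro distr_cong refl sets_pair_measure_cong sets_eq)
  thus "distr M (S \<Otimes>\<^sub>M Pi\<^sub>M I (\<lambda>_. \<nu>)) (\<lambda>\<omega>. (Y \<omega>, ?g \<omega>)) = distr M S Y \<Otimes>\<^sub>M Pi\<^sub>M I (\<lambda>_. \<nu>)"
    using 1 2 by simp
qed

section \<open>Almost sure concentration for random kernels\<close>

context unit_noise
begin

definition \<kappa>' :: real where "\<kappa>' = 16 * (81 * \<kappa> * (16 * \<kappa> + 1))"

lemma \<kappa>'_nonneg: "0 \<le> \<kappa>'"
  using \<kappa>_nonneg by (simp add: \<kappa>'_def)

lemma hs2_nonneg: "0 \<le> hs2 I F"
  by (simp add: hs2_def sum_nonneg)

text \<open>Dividing by w plus the squared Hilbert-Schmidt norm H makes the bound unconditional: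
  given the kernel, the fourth moment is at most \<kappa>' H^2 / (w + H)^4, hence at most \<kappa>'
  / w^2 however large H is.\<close>

lemma random_qform_moment4:
  assumes M: "prob_space M" and I: "finite I"
    and Y [measurable]: "Y \<in> measurable M S" and g [measurable]: "g \<in> measurable M (Pi\<^sub>M I (\<lambda>_. N))"
    and law: "distr M (S \<Otimes>\<^sub>M Pi\<^sub>M I (\<lambda>_. N)) (\<lambda>\<omega>. (Y \<omega>, g \<omega>)) = distr M S Y \<Otimes>\<^sub>M Pi\<^sub>M I (\<lambda>_. N)"
    and F [measurable]: "\<And>i j. i \<in> I \<Longrightarrow> j \<in> I \<Longrightarrow> (\<lambda>y. F y i j) \<in> borel_measurable S"
    and w: "0 < w"
  shows "(\<lambda>\<omega>. cmod (qform I (F (Y \<omega>)) (g \<omega>)) / (w + hs2 I (F (Y \<omega>)))) \<in> borel_measurable M"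
    and "(\<integral>\<^sup>+\<omega>. ennreal ((cmod (qform I (F (Y \<omega>)) (g \<omega>)) / (w + hs2 I (F (Y \<omega>)))) ^ 4) \<partial>M) \<le> ennreal (\<kappa>' / w\<^sup>2)"
proof -
  interpret M: prob_space M by fact
  interpret D: prob_space "distr M S Y" by (rule M.prob_space_distr) fact
  interpret PG: prob_space "Pi\<^sub>M I (\<lambda>_. N)" by (rule prob_space_PiM_N)
  interpret pair_sigma_finite "distr M S Y" "Pi\<^sub>M I (\<lambda>_. N)" ..
  define Z where "Z y g = cmod (qform I (F y) g) / (w + hs2 I (F y))" for y g
  have hm: "(\<lambda>x. h (snd x i)) \<in> borel_measurable (S \<Otimes>\<^sub>M Pi\<^sub>M I (\<lambda>_. N))" if "i \<in> I" for i
    by (rule measurable_compose[OF measurable_snd measurable_h_component[OF that]])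
  have Fm: "(\<lambda>x. F (fst x) i j) \<in> borel_measurable (S \<Otimes>\<^sub>M Pi\<^sub>M I (\<lambda>_. N))" if "i \<in> I" "j \<in> I" for i j
    by (rule measurable_compose[OF measurable_fst F[OF that]])
  have [measurable]: "(\<lambda>x. qform I (F (fst x)) (snd x)) \<in> borel_measurable (S \<Otimes>\<^sub>M Pi\<^sub>M I (\<lambda>_. N))"
    unfolding qform_def
    by (intro borel_measurable_diff borel_measurable_sum borel_measurable_times borel_measurable_cnj hm Fm)
  have [measurable]: "(\<lambda>x. hs2 I (F (fst x))) \<in> borel_measurable (S \<Otimes>\<^sub>M Pi\<^sub>M I (\<lambda>_. N))"
    unfolding hs2_def
    by (intro borel_measurable_sum borel_measurable_power borel_measurable_norm[THEN measurable_compose[rotated]] Fm measurable_compose[OF Fm borel_measurable_norm])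
  have Zm [measurable]: "(\<lambda>x. Z (fst x) (snd x)) \<in> borel_measurable (S \<Otimes>\<^sub>M Pi\<^sub>M I (\<lambda>_. N))"
    unfolding Z_def by measurable
  have pm: "(\<lambda>\<omega>. (Y \<omega>, g \<omega>)) \<in> measurable M (S \<Otimes>\<^sub>M Pi\<^sub>M I (\<lambda>_. N))" by measurable
  show "(\<lambda>\<omega>. cmod (qform I (F (Y \<omega>)) (g \<omega>)) / (w + hs2 I (F (Y \<omega>)))) \<in> borel_measurable M"
    using measurable_compose[OF pm Zm] by (simp add: Z_def)
  have Zm': "(\<lambda>x. ennreal (Z (fst x) (snd x) ^ 4)) \<in> borel_measurable (distr M S Y \<Otimes>\<^sub>M Pi\<^sub>M I (\<lambda>_. N))"
    using Zm by (simp cong: measurable_cong_sets sets_pair_measure_cong)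
  have inner: "(\<integral>\<^sup>+g. ennreal (Z y g ^ 4) \<partial>Pi\<^sub>M I (\<lambda>_. N)) \<le> ennreal (\<kappa>' / w\<^sup>2)" for y
  proof -
    define H where "H = hs2 I (F y)"
    have H: "0 \<le> H" by (simp add: H_def hs2_nonneg)
    have "(\<integral>\<^sup>+g. ennreal (Z y g ^ 4) \<partial>Pi\<^sub>M I (\<lambda>_. N))
      = (\<integral>\<^sup>+g. ennreal (1 / (w + H) ^ 4) * ennreal (cmod (qform I (F y) g) ^ 4) \<partial>Pi\<^sub>M I (\<lambda>_. N))"
      using H w by (simp add: Z_def H_def power_divide flip: ennreal_mult)
    also have "\<dots> = ennreal (1 / (w + H) ^ 4) * (\<integral>\<^sup>+g. ennreal (cmod (qform I (F y) g) ^ 4) \<partial>Pi\<^sub>M I (\<lambda>_. N))"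
      by (rule nn_integral_cmult) measurable
    also have "\<dots> \<le> ennreal (1 / (w + H) ^ 4) * ennreal (\<kappa>' * H\<^sup>2)"
      unfolding H_def \<kappa>'_def by (intro mult_left_mono qform_moment4 I) auto
    also have "\<dots> = ennreal (\<kappa>' * H\<^sup>2 / (w + H) ^ 4)"
      using H w \<kappa>'_nonneg by (simp flip: ennreal_mult)
    also have "\<dots> \<le> ennreal (\<kappa>' / w\<^sup>2)"
    proof (rule ennreal_leI)
      have "w\<^sup>2 * H\<^sup>2 \<le> (w + H)\<^sup>2 * (w + H)\<^sup>2"
        using H w by (intro mult_mono power_mono) auto
      hence "\<kappa>' * (w\<^sup>2 * H\<^sup>2) \<le> \<kappa>' * (w + H) ^ 4"
        using \<kappa>'_nonneg by (intro mult_left_mono) (simp_all flip: power_add)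
      thus "\<kappa>' * H\<^sup>2 / (w + H) ^ 4 \<le> \<kappa>' / w\<^sup>2"
        using H w by (simp add: pos_divide_le_eq pos_le_divide_eq mult_ac)
    qed
    finally show ?thesis .
  qed
  have "(\<integral>\<^sup>+\<omega>. ennreal (Z (Y \<omega>) (g \<omega>) ^ 4) \<partial>M)
    = (\<integral>\<^sup>+x. ennreal (Z (fst x) (snd x) ^ 4) \<partial>distr M (S \<Otimes>\<^sub>M Pi\<^sub>M I (\<lambda>_. N)) (\<lambda>\<omega>. (Y \<omega>, g \<omega>)))"
    by (subst nn_integral_distr[OF pm]) simp_all
  also have "\<dots> = (\<integral>\<^sup>+x. ennreal (Z (fst x) (snd x) ^ 4) \<partial>(distr M S Y \<Otimes>\<^sub>M Pi\<^sub>M I (\<lambda>_. N)))"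
    by (simp only: law)
  also have "\<dots> = (\<integral>\<^sup>+y. (\<integral>\<^sup>+g. ennreal (Z y g ^ 4) \<partial>Pi\<^sub>M I (\<lambda>_. N)) \<partial>distr M S Y)"
    using sigma_finite_measure.nn_integral_fst[OF PG.sigma_finite_measure_axioms Zm'] by simp
  also have "\<dots> \<le> (\<integral>\<^sup>+y. ennreal (\<kappa>' / w\<^sup>2) \<partial>distr M S Y)"
    by (intro nn_integral_mono inner)
  also have "\<dots> = ennreal (\<kappa>' / w\<^sup>2)" using D.emeasure_space_1 by simp
  finally show "(\<integral>\<^sup>+\<omega>. ennreal ((cmod (qform I (F (Y \<omega>)) (g \<omega>)) / (w + hs2 I (F (Y \<omega>)))) ^ 4) \<partial>M) \<le> ennreal (\<kappa>' / w\<^sup>2)"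
    by (simp only: Z_def)
qed

text \<open>The normalized fourth moments are at most \<kappa>' / n^2, so the sum of the fourth
  powers has finite expectation and its terms tend to zero almost surely. The control of the
  Hilbert-Schmidt norm enters only outcome by outcome, to undo the normalization, with a bound that
  may depend on the outcome.\<close>

lemma AE_qform_tendsto_0:
  assumes M: "prob_space M" and I: "\<And>n. finite (I n)"
    and Y: "\<And>n. 0 < n \<Longrightarrow> Y n \<in> measurable M (S n)"
    and g: "\<And>n. 0 < n \<Longrightarrow> g n \<in> measurable M (Pi\<^sub>M (I n) (\<lambda>_. N))"
    and law: "\<And>n. 0 < n \<Longrightarrow> distr M (S n \<Otimes>\<^sub>M Pi\<^sub>M (I n) (\<lambda>_. N)) (\<lambda>\<omega>. (Y n \<omega>, g n \<omega>))
       = distr M (S n) (Y n) \<Otimes>\<^sub>M Pi\<^sub>M (I n) (\<lambda>_. N)"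
    and F: "\<And>n i j. 0 < n \<Longrightarrow> i \<in> I n \<Longrightarrow> j \<in> I n \<Longrightarrow> (\<lambda>y. F n y i j) \<in> borel_measurable (S n)"
    and w: "\<And>n. 0 < n \<Longrightarrow> real n \<le> w n"
  shows "AE \<omega> in M. (\<forall>\<^sub>F n in sequentially. hs2 (I n) (F n (Y n \<omega>)) \<le> B \<omega> * w n) \<longrightarrow>
    (\<lambda>n. qform (I n) (F n (Y n \<omega>)) (g n \<omega>) / of_real (w n)) \<longlonglongrightarrow> 0"
proof -
  interpret M: prob_space M by fact
  define Z where "Z n \<omega> = cmod (qform (I n) (F n (Y n \<omega>)) (g n \<omega>)) / (w n + hs2 (I n) (F n (Y n \<omega>)))" for n \<omega>
  have wpos: "0 < w n" if "0 < n" for n using w[OF that] that by linarith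
  have m: "Z (Suc n) \<in> borel_measurable M"
    and le: "(\<integral>\<^sup>+\<omega>. ennreal (Z (Suc n) \<omega> ^ 4) \<partial>M) \<le> ennreal (\<kappa>' / (w (Suc n))\<^sup>2)" for n
  proof -
    have n: "0 < Suc n" by simp
    note * = random_qform_moment4[OF M I Y[OF n] g[OF n] law[OF n] F[OF n] wpos[OF n]]
    show "Z (Suc n) \<in> borel_measurable M"
      "(\<integral>\<^sup>+\<omega>. ennreal (Z (Suc n) \<omega> ^ 4) \<partial>M) \<le> ennreal (\<kappa>' / (w (Suc n))\<^sup>2)"
      unfolding Z_def[abs_def] by (rule *; assumption)+
  qed
  have "(\<integral>\<^sup>+\<omega>. (\<Sum>n. ennreal (Z (Suc n) \<omega> ^ 4)) \<partial>M) = (\<Sum>n. \<integral>\<^sup>+\<omega>. ennreal (Z (Suc n) \<omega> ^ 4) \<partial>M)"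
    using m by (intro nn_integral_suminf) measurable
  also have "\<dots> \<le> (\<Sum>n. ennreal (\<kappa>' * (1 / (real (Suc n))\<^sup>2)))"
  proof (intro suminf_le allI)
    fix n
    have "\<kappa>' / (w (Suc n))\<^sup>2 \<le> \<kappa>' * (1 / (real (Suc n))\<^sup>2)"
      using w[of "Suc n"] \<kappa>'_nonneg by (auto intro!: divide_left_mono power_mono mult_pos_pos zero_less_power wpos simp del: of_nat_Suc)
    thus "(\<integral>\<^sup>+\<omega>. ennreal (Z (Suc n) \<omega> ^ 4) \<partial>M) \<le> ennreal (\<kappa>' * (1 / (real (Suc n))\<^sup>2))"
      using le[of n] ennreal_leI order_trans by blast
  qed auto
  also have "\<dots> < \<infinity>"
  proof -
    have "summable (\<lambda>n. \<kappa>' * (1 / (real (Suc n))\<^sup>2))"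
      using inverse_power_summable[of 2, where 'a=real, THEN summable_ignore_initial_segment, of 1]
      by (intro summable_mult) (simp add: field_simps)
    hence "(\<Sum>n. ennreal (\<kappa>' * (1 / (real (Suc n))\<^sup>2))) = ennreal (\<Sum>n. \<kappa>' * (1 / (real (Suc n))\<^sup>2))"
      using \<kappa>'_nonneg by (intro suminf_ennreal2) (auto simp del: of_nat_Suc)
    thus ?thesis by (simp only: ennreal_less_top infinity_ennreal_def)
  qed
  finally have fin: "(\<integral>\<^sup>+\<omega>. (\<Sum>n. ennreal (Z (Suc n) \<omega> ^ 4)) \<partial>M) < \<infinity>" .
  have "(\<lambda>\<omega>. \<Sum>n. ennreal (Z (Suc n) \<omega> ^ 4)) \<in> borel_measurable M"
    using m by measurable
  from nn_integral_noteq_infinite[OF this less_imp_neq[OF fin]]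
  have "AE \<omega> in M. (\<Sum>n. ennreal (Z (Suc n) \<omega> ^ 4)) \<noteq> \<infinity>" .
  thus ?thesis
  proof (rule eventually_mono, intro impI)
    fix \<omega>
    assume "(\<Sum>n. ennreal (Z (Suc n) \<omega> ^ 4)) \<noteq> \<infinity>"
      and bd: "\<forall>\<^sub>F n in sequentially. hs2 (I n) (F n (Y n \<omega>)) \<le> B \<omega> * w n"
    hence "summable (\<lambda>n. Z (Suc n) \<omega> ^ 4)"
      by (intro summable_suminf_not_top) auto
    hence "(\<lambda>n. Z (Suc n) \<omega> ^ 4) \<longlonglongrightarrow> 0" by (rule summable_LIMSEQ_zero)
    hence "(\<lambda>n. root 4 (Z (Suc n) \<omega> ^ 4)) \<longlonglongrightarrow> root 4 0" by (rule tendsto_real_root)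
    moreover have "root 4 (Z (Suc n) \<omega> ^ 4) = Z (Suc n) \<omega>" for n
      using wpos[of "Suc n"] by (intro real_root_power_cancel) (auto simp: Z_def intro!: divide_nonneg_nonneg add_nonneg_nonneg hs2_nonneg)
    ultimately have "(\<lambda>n. Z (Suc n) \<omega>) \<longlonglongrightarrow> 0" by simp
    hence "(\<lambda>n. Z n \<omega>) \<longlonglongrightarrow> 0" by (rule LIMSEQ_imp_Suc)
    hence lim: "(\<lambda>n. Z n \<omega> * (1 + \<bar>B \<omega>\<bar>)) \<longlonglongrightarrow> 0" by (rule tendsto_mult_left_zero)
    show "(\<lambda>n. qform (I n) (F n (Y n \<omega>)) (g n \<omega>) / of_real (w n)) \<longlonglongrightarrow> 0"
    proof (rule Lim_null_comparison[OF _ lim])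
      show "\<forall>\<^sub>F n in sequentially. cmod (qform (I n) (F n (Y n \<omega>)) (g n \<omega>) / of_real (w n)) \<le> Z n \<omega> * (1 + \<bar>B \<omega>\<bar>)"
        using bd eventually_gt_at_top[of 0]
      proof eventually_elim
        case (elim n)
        define H where "H = hs2 (I n) (F n (Y n \<omega>))"
        define q where "q = cmod (qform (I n) (F n (Y n \<omega>)) (g n \<omega>))"
        have wn: "0 < w n" by (rule wpos) (use elim in simp)
        have H: "0 \<le> H" by (simp add: H_def hs2_nonneg)
        have "H \<le> \<bar>B \<omega>\<bar> * w n"
          using elim(1) mult_right_mono[OF abs_ge_self[of "B \<omega>"] less_imp_le[OF wn]]
          unfolding H_def by (rule order_trans)
        hence "w n + H \<le> (1 + \<bar>B \<omega>\<bar>) * w n" by (simp add: algebra_simps)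
        hence "q * (w n + H) \<le> q * ((1 + \<bar>B \<omega>\<bar>) * w n)" by (intro mult_left_mono) (simp_all add: q_def)
        hence "q / w n \<le> q / (w n + H) * (1 + \<bar>B \<omega>\<bar>)" using wn H by (simp add: pos_divide_le_eq pos_le_divide_eq mult_ac)
        thus ?case using wn by (simp add: norm_divide Z_def q_def H_def)
      qed
    qed
  qed
qed

end

section \<open>Singular values of complex matrices\<close>

lemma index_mat_adjoint [simp]:
  "i < dim_col A \<Longrightarrow> j < dim_row A \<Longrightarrow> mat_adjoint A $$ (i, j) = conjugate (A $$ (j, i))"
  "dim_row (mat_adjoint A) = dim_col A" "dim_col (mat_adjoint A) = dim_row A"
  by (simp_all add: mat_adjoint_def mat_of_rows_index)

definition gram :: "nat \<Rightarrow> complex mat \<Rightarrow> nat \<Rightarrow> nat \<Rightarrow> complex" where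
  "gram m A i k = (\<Sum>j<m. A $$ (i, j) * cnj (A $$ (k, j)))"

lemma index_mult_adjoint:
  assumes "A \<in> carrier_mat n m" "i < n" "k < n"
  shows "(A * mat_adjoint A) $$ (i, k) = gram m A i k"
  using assms by (simp add: gram_def scalar_prod_def lessThan_atLeast0)

lemma gram_form:
  "ip {..<n} x (mv {..<n} (gram m A) x) = of_real (\<Sum>j<m. (cmod (\<Sum>i<n. cnj (A $$ (i, j)) * x i))\<^sup>2)"
proof -
  have "ip {..<n} x (mv {..<n} (gram m A) x) = (\<Sum>i<n. \<Sum>k<n. \<Sum>j<m. cnj (x i) * A $$ (i, j) * (cnj (A $$ (k, j)) * x k))"
    by (simp add: ip_def mv_def gram_def sum_distrib_left sum_distrib_right mult.assoc)
  also have "\<dots> = (\<Sum>i<n. \<Sum>j<m. \<Sum>k<n. cnj (x i) * A $$ (i, j) * (cnj (A $$ (k, j)) * x k))"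
    by (intro sum.cong refl sum.swap)
  also have "\<dots> = (\<Sum>j<m. \<Sum>i<n. \<Sum>k<n. cnj (x i) * A $$ (i, j) * (cnj (A $$ (k, j)) * x k))"
    by (rule sum.swap)
  also have "\<dots> = (\<Sum>j<m. cnj (\<Sum>i<n. cnj (A $$ (i, j)) * x i) * (\<Sum>k<n. cnj (A $$ (k, j)) * x k))"
    unfolding cnj_sum sum_product by (intro sum.cong refl) simp
  also have "\<dots> = (\<Sum>j<m. complex_of_real ((cmod (\<Sum>i<n. cnj (A $$ (i, j)) * x i))\<^sup>2))"
    by (intro sum.cong refl) (simp only: complex_norm_square mult.commute)
  finally show ?thesis by (simp only: of_real_sum)
qed

lemma eigenvalue_mult_adjoint:
  assumes A: "A \<in> carrier_mat n m" and e: "eigenvalue (A * mat_adjoint A) e"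
  shows "e = of_real (Re e)" "0 \<le> Re e"
proof -
  have c: "A * mat_adjoint A \<in> carrier_mat n n" using A by auto
  from e obtain v where v: "v \<in> carrier_vec n" "v \<noteq> 0\<^sub>v n" "(A * mat_adjoint A) *\<^sub>v v = e \<cdot>\<^sub>v v"
    unfolding eigenvalue_def eigenvector_def using c by auto
  define x where "x i = v $ i" for i
  have "mv {..<n} (gram m A) x i = e * x i" if "i < n" for i
  proof -
    have "e * x i = ((A * mat_adjoint A) *\<^sub>v v) $ i" using v that by (simp add: x_def)
    also have "\<dots> = (\<Sum>k<n. (A * mat_adjoint A) $$ (i, k) * v $ k)"
      using v(1) c that A by (simp add: scalar_prod_def lessThan_atLeast0)
    also have "\<dots> = mv {..<n} (gram m A) x i"
      using A that by (simp add: mv_def x_def index_mult_adjoint del: index_mult_mat)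
    finally show ?thesis by simp
  qed
  hence "ip {..<n} x (mv {..<n} (gram m A) x) = ip {..<n} x (\<lambda>i. e * x i)"
    by (intro ip_cong) auto
  hence eq: "e * of_real ((nrm {..<n} x)\<^sup>2) = of_real (\<Sum>j<m. (cmod (\<Sum>i<n. cnj (A $$ (i, j)) * x i))\<^sup>2)"
    by (simp only: gram_form ip_scale_right ip_self)
  have "nrm {..<n} x \<noteq> 0"
  proof
    assume "nrm {..<n} x = 0"
    hence "\<forall>i<n. v $ i = 0" by (auto simp: nrm_eq_0 x_def)
    thus False using v by auto
  qed
  hence "e = of_real ((\<Sum>j<m. (cmod (\<Sum>i<n. cnj (A $$ (i, j)) * x i))\<^sup>2) / (nrm {..<n} x)\<^sup>2)"
    using eq by (simp add: field_simps)
  moreover have "0 \<le> (\<Sum>j<m. (cmod (\<Sum>i<n. cnj (A $$ (i, j)) * x i))\<^sup>2) / (nrm {..<n} x)\<^sup>2"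
    by (intro divide_nonneg_nonneg sum_nonneg) simp_all
  ultimately obtain r where "e = of_real r" "0 \<le> r" by blast
  thus "e = of_real (Re e)" "0 \<le> Re e" by simp_all
qed

text \<open>The property under the definite description in \<open>singular_values\<close>, over the
  complex numbers; existence and uniqueness have to be shown before the description says
  anything.\<close>

definition is_singular_values :: "complex mat \<Rightarrow> real list \<Rightarrow> bool" where
  "is_singular_values A s \<longleftrightarrow> sorted_wrt (\<ge>) s \<and> (\<forall>x\<in>set s. 0 \<le> x) \<and>
     char_poly (A * mat_adjoint A) = (\<Prod>x\<leftarrow>s. [:- of_real (x\<^sup>2), 1:])"

lemma proots_prod_linear: "proots (\<Prod>x\<leftarrow>s. [:- f x, 1:]) = mset (map f s)" for f :: "'b \<Rightarrow> complex"
  by (induction s) (simp_all add: proots_mult prod_list_zero_iff image_iff del: mult_pCons_left mult_pCons_right)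

text \<open>The polynomial determines the multiset of squares, nonnegativity the values, and sorting
  their order.\<close>

lemma is_singular_values_unique:
  assumes "is_singular_values A s" "is_singular_values A t"
  shows "s = t"
proof -
  have "mset (map (\<lambda>x. complex_of_real (x\<^sup>2)) s) = mset (map (\<lambda>x. complex_of_real (x\<^sup>2)) t)"
    using assms unfolding is_singular_values_def by (metis proots_prod_linear)
  hence "image_mset (\<lambda>x. sqrt (Re x)) (mset (map (\<lambda>x. complex_of_real (x\<^sup>2)) s))
    = image_mset (\<lambda>x. sqrt (Re x)) (mset (map (\<lambda>x. complex_of_real (x\<^sup>2)) t))" by simp
  hence "mset (map (\<lambda>x. sqrt (Re (complex_of_real (x\<^sup>2)))) s) = mset (map (\<lambda>x. sqrt (Re (complex_of_real (x\<^sup>2)))) t)"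
    by (simp only: mset_map[symmetric] map_map o_def)
  moreover have id: "map (\<lambda>x. sqrt (Re (complex_of_real (x\<^sup>2)))) u = u" if "is_singular_values A u" for u
    using that by (intro map_idI) (simp add: is_singular_values_def del: of_real_power)
  ultimately have "mset (rev s) = mset (rev t)"
    by (simp only: id[OF assms(1)] id[OF assms(2)] mset_rev)
  moreover have "sorted (rev s)" "sorted (rev t)"
    using assms by (simp_all add: is_singular_values_def sorted_wrt_rev)
  ultimately have "rev s = rev t" by (metis properties_for_sort sorted_sort_id)
  thus ?thesis by simp
qed

text \<open>Over the complex numbers the characteristic polynomial splits, and its roots are real
  and nonnegative because they are Rayleigh quotients of A A*.\<close>

lemma is_singular_values_exists:
  assumes A: "A \<in> carrier_mat n m"
  obtains s where "is_singular_values A s" "length s = n"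
proof -
  let ?B = "A * mat_adjoint A"
  have c: "?B \<in> carrier_mat n n" using A by auto
  from char_poly_factorized[OF c] obtain as
    where as: "char_poly ?B = (\<Prod>a\<leftarrow>as. [:- a, 1:])" "length as = n" by auto
  have ev: "a = of_real (Re a) \<and> 0 \<le> Re a" if "a \<in> set as" for a
  proof -
    have "poly (char_poly ?B) a = 0"
      unfolding as(1) using that by (induction as) auto
    hence "eigenvalue ?B a" using eigenvalue_root_char_poly[OF c] by simp
    from eigenvalue_mult_adjoint[OF A this] show ?thesis by simp
  qed
  define s where "s = rev (sort (map (\<lambda>a. sqrt (Re a)) as))"
  have "(\<Prod>x\<leftarrow>s. [:- of_real (x\<^sup>2), 1:]) = prod_mset (image_mset (\<lambda>x. [:- complex_of_real (x\<^sup>2), 1:]) (mset s))"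
    by (simp add: prod_mset_prod_list[symmetric])
  also have "mset s = mset (map (\<lambda>a. sqrt (Re a)) as)" by (simp add: s_def)
  also have "prod_mset (image_mset (\<lambda>x. [:- complex_of_real (x\<^sup>2), 1:]) \<dots>)
     = (\<Prod>a\<leftarrow>as. [:- complex_of_real ((sqrt (Re a))\<^sup>2), 1:])"
    by (simp add: prod_mset_prod_list[symmetric] image_mset.compositionality o_def)
  also have "\<dots> = (\<Prod>a\<leftarrow>as. [:- a, 1:])"
    using ev by (intro arg_cong[where f=prod_list] map_cong) (auto simp del: of_real_power)
  finally have "is_singular_values A s"
    using ev by (auto simp: is_singular_values_def as s_def sorted_wrt_rev)
  moreover have "length s = n" by (simp add: s_def as)
  ultimately show ?thesis by (rule that)
qed

lemma singular_values_eqI: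
  assumes "is_singular_values A s" shows "singular_values A = s"
  unfolding singular_values_def
  using assms is_singular_values_unique[of A]
  by (intro the_equality) (auto simp: is_singular_values_def)

lemma singular_values_complex:
  assumes "A \<in> carrier_mat n m"
  shows "is_singular_values A (singular_values A)" "length (singular_values A) = n"
  using is_singular_values_exists[OF assms] singular_values_eqI by metis+

lemma hd_singular_values:
  fixes A :: "complex mat"
  assumes "A \<in> carrier_mat n m" "0 < n"
  shows "0 \<le> hd (singular_values A)" "x \<in> set (singular_values A) \<Longrightarrow> x \<le> hd (singular_values A)"
    "hd (singular_values A) \<in> set (singular_values A)"
proof -
  note s = singular_values_complex[OF assms(1)]
  then obtain a t where at: "singular_values A = a # t" using assms(2) by (cases "singular_values A") auto
  show "0 \<le> hd (singular_values A)" "hd (singular_values A) \<in> set (singular_values A)"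
    using s at by (auto simp: is_singular_values_def)
  show "x \<le> hd (singular_values A)" if "x \<in> set (singular_values A)"
    using that s at by (auto simp: is_singular_values_def)
qed

lemma nrm_mv_le: "(nrm I (mv I A x))\<^sup>2 \<le> (\<Sum>i\<in>I. \<Sum>j\<in>I. (cmod (A i j))\<^sup>2) * (nrm I x)\<^sup>2"
proof -
  have "(cmod (mv I A x i))\<^sup>2 \<le> (\<Sum>j\<in>I. (cmod (A i j))\<^sup>2) * (nrm I x)\<^sup>2" for i
  proof -
    have "mv I A x i = ip I (\<lambda>j. cnj (A i j)) x" by (simp add: mv_def ip_def)
    hence "cmod (mv I A x i) \<le> nrm I (\<lambda>j. cnj (A i j)) * nrm I x"
      using ip_Cauchy_Schwarz by metis
    from power_mono[OF this, of 2] show ?thesis by (simp add: power_mult_distrib nrm_sq)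
  qed
  thus ?thesis unfolding nrm_sq[of I "mv I A x"] sum_distrib_right by (intro sum_mono)
qed

text \<open>The supremum \<open>L\<close> of the Rayleigh quotient of \<open>A A\<^sup>*\<close> is an eigenvalue: otherwise \<open>L - A A\<^sup>*\<close>,
  being invertible and positive, would be bounded below by a positive multiple of the identity.\<close>

lemma adjoint_norm_le:
  fixes A :: "complex mat"
  assumes A: "A \<in> carrier_mat n m" and n: "0 < n"
  shows "(\<Sum>j<m. (cmod (\<Sum>i<n. cnj (A $$ (i, j)) * x i))\<^sup>2) \<le> (hd (singular_values A))\<^sup>2 * (nrm {..<n} x)\<^sup>2"
proof -
  let ?I = "{..<n}" and ?B = "A * mat_adjoint A"
  define f where "f x = (\<Sum>j<m. (cmod (\<Sum>i<n. cnj (A $$ (i, j)) * x i))\<^sup>2)" for x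
  have f0: "0 \<le> f x" for x by (simp add: f_def sum_nonneg)
  have f: "ip ?I x (mv ?I (gram m A) x) = of_real (f x)" for x
    unfolding f_def by (rule gram_form)
  have f_scale: "f (\<lambda>i. c * x i) = (cmod c)\<^sup>2 * f x" for c x
  proof -
    have "complex_of_real (f (\<lambda>i. c * x i)) = (c * cnj c) * of_real (f x)"
    proof -
      have "mv ?I (gram m A) (\<lambda>i. c * x i) = (\<lambda>i. c * mv ?I (gram m A) x i)"
        by (rule ext) (simp add: mv_linear)
      hence "complex_of_real (f (\<lambda>i. c * x i)) = ip ?I (\<lambda>i. c * x i) (\<lambda>i. c * mv ?I (gram m A) x i)"
        using f[of "\<lambda>i. c * x i"] by simp
      also have "\<dots> = (c * cnj c) * of_real (f x)" by (simp add: ip_linear f)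
      finally show ?thesis .
    qed
    thus ?thesis by (metis complex_norm_square of_real_eq_iff of_real_mult)
  qed
  define S where "S = f ` {x. nrm ?I x = 1}"
  define L where "L = Sup S"
  define T where "T = (\<Sum>i<n. \<Sum>k<n. (cmod (gram m A i k))\<^sup>2)"
  have bdd: "bdd_above S"
  proof (rule bdd_aboveI)
    fix y assume "y \<in> S"
    then obtain x where x: "nrm ?I x = 1" "y = f x" by (auto simp: S_def)
    have "y = cmod (ip ?I x (mv ?I (gram m A) x))" using f f0 x by simp
    also have "\<dots> \<le> nrm ?I x * nrm ?I (mv ?I (gram m A) x)" by (rule ip_Cauchy_Schwarz)
    also have "\<dots> \<le> sqrt T"
      using nrm_mv_le[of ?I "gram m A" x] x by (simp add: T_def real_le_rsqrt)
    finally show "y \<le> sqrt T" .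
  qed
  have f_le: "f x \<le> L * (nrm ?I x)\<^sup>2" for x
  proof (cases "nrm ?I x = 0")
    case True
    hence "f x = 0" by (auto simp: f_def nrm_eq_0)
    thus ?thesis using True by simp
  next
    case False
    define y where "y i = of_real (1 / nrm ?I x) * x i" for i
    have "nrm ?I y = 1" unfolding y_def nrm_scale norm_of_real using False by simp
    hence "f y \<le> L" unfolding L_def S_def using bdd[unfolded S_def] by (intro cSup_upper) auto
    moreover have "f y = f x / (nrm ?I x)\<^sup>2" unfolding y_def f_scale norm_of_real using False by (simp add: power_divide)
    ultimately show ?thesis using False by (simp add: field_simps)
  qed
  have "L \<le> (hd (singular_values A))\<^sup>2"
  proof (cases "0 < L")
    case False
    thus ?thesis by (smt (verit) zero_le_power2)
  next
    case True
    have c: "?B \<in> carrier_mat n n" using A by auto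
    define C where "C = of_real L \<cdot>\<^sub>m 1\<^sub>m n - ?B"
    have C: "C \<in> carrier_mat n n" unfolding C_def using c by (rule minus_carrier_mat)
    have Cv: "(C *\<^sub>v vec n y) $ i = of_real L * y i - mv ?I (gram m A) y i" if "i < n" for y i
    proof -
      have "(C *\<^sub>v vec n y) $ i = (\<Sum>k<n. (of_real L * (if i = k then 1 else 0) - gram m A i k) * y k)"
        using that A by (simp add: C_def scalar_prod_def lessThan_atLeast0 index_mult_adjoint del: index_mult_mat)
          (auto intro!: sum.cong simp: scalar_prod_def gram_def lessThan_atLeast0)
      also have "\<dots> = (\<Sum>k<n. (if i = k then of_real L * y k else 0)) - mv ?I (gram m A) y i"
        unfolding mv_def sum_subtractf[symmetric] by (intro sum.cong) (auto simp: algebra_simps)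
      finally show ?thesis using that by simp
    qed
    have "det C = 0"
    proof (rule ccontr)
      assume d: "det C \<noteq> 0"
      \<comment> \<open>The inverse of C = L - A A* by Cramer's rule; \<open>T'\<close> bounds its
        squared operator norm by the squared Hilbert-Schmidt norm.\<close>
      define G where "G i k = adj_mat C $$ (i, k) / det C" for i k
      define T' where "T' = (\<Sum>i<n. \<Sum>k<n. (cmod (G i k))\<^sup>2)"
      have inv: "mv ?I G (\<lambda>i. of_real L * y i - mv ?I (gram m A) y i) i = y i" if "i < n" for y i
      proof -
        have "adj_mat C *\<^sub>v (C *\<^sub>v vec n y) = (adj_mat C * C) *\<^sub>v vec n y"
          using adj_mat(1)[OF C] C by (simp add: assoc_mult_mat_vec)
        also have "\<dots> = (det C \<cdot>\<^sub>m 1\<^sub>m n) *\<^sub>v vec n y" by (simp only: adj_mat(3)[OF C])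
        finally have "(adj_mat C *\<^sub>v (C *\<^sub>v vec n y)) $ i = (\<Sum>k<n. (det C * (if k = i then 1 else 0)) * y k)"
          using that by (simp add: scalar_prod_def lessThan_atLeast0)
        also have "\<dots> = (\<Sum>k<n. if k = i then det C * y k else 0)" by (intro sum.cong) auto
        also have "\<dots> = det C * y i" using that by simp
        finally have "(adj_mat C *\<^sub>v (C *\<^sub>v vec n y)) $ i = det C * y i" .
        moreover have "(adj_mat C *\<^sub>v (C *\<^sub>v vec n y)) $ i = (\<Sum>k<n. adj_mat C $$ (i, k) * (C *\<^sub>v vec n y) $ k)"
          using adj_mat(1)[OF C] C that by (simp add: scalar_prod_def lessThan_atLeast0)
        ultimately have "(\<Sum>k<n. adj_mat C $$ (i, k) * (of_real L * y k - mv ?I (gram m A) y k)) = det C * y i"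
          by (simp add: Cv)
        thus ?thesis using d by (simp add: mv_def G_def sum_divide_distrib[symmetric])
      qed
      have lower: "(nrm ?I y)\<^sup>2 \<le> T' * (L * (L * (nrm ?I y)\<^sup>2 - f y))" for y
      proof -
        define g where "g i = of_real L * y i - mv ?I (gram m A) y i" for i
        \<comment> \<open>Here g = C y. Nonnegativity of the form of C at t = y - g / L yields |C
          y|^2 \<le> L (y, C y), the form version of C^2 \<le> L C for an operator between 0 and
          L.\<close>
        define t where "t i = y i - of_real (1 / L) * g i" for i
        interpret Hm: hermitian_op ?I "gram m A" L
          by standard (use f f_le in \<open>auto simp: gram_def mult.commute\<close>)
        have gg: "ip ?I g (\<lambda>i. of_real L * x i - mv ?I (gram m A) x i) = ip ?I (\<lambda>i. of_real L * g i - mv ?I (gram m A) g i) x" for g x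
          by (simp add: ip_linear Hm.ip_herm)
        have mt: "mv ?I (gram m A) t i = mv ?I (gram m A) y i - of_real (1 / L) * mv ?I (gram m A) g i" for i
          unfolding t_def[abs_def] by (simp only: mv_linear)
        have L: "of_real L * t i = of_real L * y i - g i" for i
          using True by (simp add: t_def algebra_simps)
        have tS: "(\<lambda>i. of_real L * t i - mv ?I (gram m A) t i)
          = (\<lambda>i. g i - of_real (1 / L) * (of_real L * g i - mv ?I (gram m A) g i))"
          unfolding L mt using True by (intro ext) (simp add: g_def field_simps)
        have "0 \<le> L * (nrm ?I t)\<^sup>2 - f t" using f_le[of t] by simp
        also have "\<dots> = Re (ip ?I t (\<lambda>i. of_real L * t i - mv ?I (gram m A) t i))"
          by (simp only: ip_linear f ip_self) simp
        also have "\<dots> = Re (ip ?I y g) - 2 * (1 / L) * (nrm ?I g)\<^sup>2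
            + (1 / L)\<^sup>2 * (L * (nrm ?I g)\<^sup>2 - f g)"
        proof -
          have 1: "ip ?I y (\<lambda>i. of_real L * g i - mv ?I (gram m A) g i) = of_real ((nrm ?I g)\<^sup>2)"
            using gg[of y g] by (simp only: g_def[symmetric] ip_self)
          have 2: "ip ?I g (\<lambda>i. of_real L * g i - mv ?I (gram m A) g i) = of_real (L * (nrm ?I g)\<^sup>2 - f g)"
            by (simp only: ip_linear f ip_self) simp
          define Sg where "Sg i = of_real L * g i - mv ?I (gram m A) g i" for i
          have it: "ip ?I t x = ip ?I y x - of_real (1 / L) * ip ?I g x" for x
            unfolding t_def[abs_def] ip_diff_left ip_scale_left by simp
          have "ip ?I t (\<lambda>i. of_real L * t i - mv ?I (gram m A) t i) = ip ?I t (\<lambda>i. g i - of_real (1 / L) * Sg i)"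
            by (simp only: tS Sg_def)
          also have "\<dots> = ip ?I t g - of_real (1 / L) * ip ?I t Sg"
            by (simp only: ip_diff_right ip_scale_right)
          also have "\<dots> = ip ?I y g - of_real (1 / L) * of_real ((nrm ?I g)\<^sup>2)
              - of_real (1 / L) * (of_real ((nrm ?I g)\<^sup>2) - of_real (1 / L) * of_real (L * (nrm ?I g)\<^sup>2 - f g))"
            unfolding it using 1 2 by (simp only: Sg_def[abs_def] ip_self)
          finally have "Re (ip ?I t (\<lambda>i. of_real L * t i - mv ?I (gram m A) t i)) =
            Re (ip ?I y g) - (1 / L) * (nrm ?I g)\<^sup>2 - (1 / L) * ((nrm ?I g)\<^sup>2 - (1 / L) * (L * (nrm ?I g)\<^sup>2 - f g))"
            by (simp only: minus_complex.simps Re_complex_of_real flip: of_real_mult of_real_diff)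
          thus ?thesis by (simp add: algebra_simps power2_eq_square)
        qed
        also have "\<dots> \<le> Re (ip ?I y g) - (1 / L) * (nrm ?I g)\<^sup>2"
          using f0[of g] True by (simp add: power2_eq_square field_simps)
        also have "Re (ip ?I y g) = L * (nrm ?I y)\<^sup>2 - f y"
          unfolding g_def by (simp only: ip_linear f ip_self) simp
        finally have g_le: "(nrm ?I g)\<^sup>2 \<le> L * (L * (nrm ?I y)\<^sup>2 - f y)"
          using True by (simp add: field_simps)
        have "(nrm ?I y)\<^sup>2 = (nrm ?I (mv ?I G g))\<^sup>2"
          unfolding nrm_sq using inv[of _ y] by (simp add: g_def[abs_def])
        also have "\<dots> \<le> T' * (nrm ?I g)\<^sup>2" unfolding T'_def by (rule nrm_mv_le)
        also have "\<dots> \<le> T' * (L * (L * (nrm ?I y)\<^sup>2 - f y))"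
          by (intro mult_left_mono g_le) (simp add: T'_def sum_nonneg)
        finally show ?thesis .
      qed
      have ne: "S \<noteq> {}"
      proof -
        have "nrm ?I (\<lambda>i. if i = 0 then 1 else 0) = 1"
          using n by (simp add: nrm_def if_distrib[of cmod] if_distrib[of "\<lambda>x. x\<^sup>2"] cong: if_cong)
        thus ?thesis by (auto simp: S_def)
      qed
      have T'0: "0 \<le> T'" by (simp add: T'_def sum_nonneg)
      have pos: "0 < T' * L + 1" using T'0 True by (simp add: add_nonneg_pos)
      \<comment> \<open>A unit vector whose Rayleigh quotient is this close to the supremum violates
        \<open>lower\<close>: 1 would be at most T' L / (T' L + 1).\<close>
      have "L - 1 / (T' * L + 1) < L" using pos by simp
      hence "\<exists>u\<in>S. L - 1 / (T' * L + 1) < u"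
        using less_cSup_iff[OF ne bdd, of "L - 1 / (T' * L + 1)"] unfolding L_def[symmetric] by blast
      then obtain y where y: "nrm ?I y = 1" "L - 1 / (T' * L + 1) < f y"
        by (auto simp: S_def)
      have "1 \<le> T' * L * (L - f y)" using lower[of y] y by (simp add: mult.assoc)
      also have "\<dots> \<le> T' * L * (1 / (T' * L + 1))"
        using y T'0 True by (intro mult_left_mono) auto
      also have "\<dots> < 1" using pos by (simp add: field_simps)
      finally show False by simp
    qed
    then obtain v where v: "v \<in> carrier_vec n" "v \<noteq> 0\<^sub>v n" "C *\<^sub>v v = 0\<^sub>v n"
      using det_0_iff_vec_prod_zero[OF C] by auto
    have "?B *\<^sub>v v = of_real L \<cdot>\<^sub>v v"
    proof (rule eq_vecI)
      fix i assume "i < dim_vec (of_real L \<cdot>\<^sub>v v)"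
      hence i: "i < n" using v by simp
      have vv: "vec n (\<lambda>i. v $ i) = v" using v by auto
      have "0 = (C *\<^sub>v v) $ i" using v i by simp
      also have "\<dots> = of_real L * v $ i - mv ?I (gram m A) (\<lambda>i. v $ i) i"
        using Cv[OF i, of "\<lambda>i. v $ i"] vv by simp
      also have "mv ?I (gram m A) (\<lambda>i. v $ i) i = (?B *\<^sub>v v) $ i"
        using c A v i by (simp add: mv_def scalar_prod_def lessThan_atLeast0 gram_def)
      finally show "(?B *\<^sub>v v) $ i = (of_real L \<cdot>\<^sub>v v) $ i" using v i by simp
    qed (use c v A in simp)
    hence "eigenvalue ?B (of_real L)" using v c A unfolding eigenvalue_def eigenvector_def by auto
    hence "poly (char_poly ?B) (of_real L) = 0" using eigenvalue_root_char_poly[OF c] by simp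
    hence "\<exists>x\<in>set (singular_values A). complex_of_real L = of_real (x\<^sup>2)"
      using singular_values_complex(1)[OF A] unfolding is_singular_values_def
      by (auto simp: poly_prod_list prod_list_zero_iff simp del: of_real_power)
    then obtain x where x: "x \<in> set (singular_values A)" "L = x\<^sup>2" by (auto simp del: of_real_power)
    thus ?thesis using hd_singular_values[OF A n] singular_values_complex(1)[OF A]
      by (auto simp: is_singular_values_def intro!: power_mono)
  qed
  thus ?thesis using f_le[of x] mult_right_mono[of L "(hd (singular_values A))\<^sup>2" "(nrm ?I x)\<^sup>2"]
    unfolding f_def by simp
qed

section \<open>The resolvent of the Hermitian dilation\<close>

definition idx :: "nat \<Rightarrow> nat \<Rightarrow> (nat + nat) set" where "idx n m = {..<n} <+> {..<m}"

definition dilation :: "complex mat \<Rightarrow> nat + nat \<Rightarrow> nat + nat \<Rightarrow> complex" where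
  "dilation X p q = (case (p, q) of (Inl i, Inr j) \<Rightarrow> X $$ (i, j) | (Inr j, Inl i) \<Rightarrow> cnj (X $$ (i, j)) | _ \<Rightarrow> 0)"

lemma dilation_simps [simp]:
  "dilation X (Inl i) (Inl k) = 0" "dilation X (Inl i) (Inr j) = X $$ (i, j)"
  "dilation X (Inr j) (Inl i) = cnj (X $$ (i, j))" "dilation X (Inr j) (Inr l) = 0"
  by (simp_all add: dilation_def)

lemma finite_idx [simp]: "finite (idx n m)"
  by (simp add: idx_def)

lemma sum_idx: "sum f (idx n m) = (\<Sum>i<n. f (Inl i)) + (\<Sum>j<m. f (Inr j))"
  by (simp add: idx_def sum.Plus)

lemma idx_iff [simp]: "Inl i \<in> idx n m \<longleftrightarrow> i < n" "Inr j \<in> idx n m \<longleftrightarrow> j < m"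
  by (auto simp: idx_def)

lemma mv_dilation:
  "mv (idx n m) (dilation X) y (Inl i) = (\<Sum>j<m. X $$ (i, j) * y (Inr j))"
  "mv (idx n m) (dilation X) y (Inr j) = (\<Sum>i<n. cnj (X $$ (i, j)) * y (Inl i))"
  by (simp_all add: mv_def sum_idx)

lemma dilation_form:
  "ip (idx n m) y (mv (idx n m) (dilation X) y) =
    of_real (2 * Re (\<Sum>j<m. cnj (\<Sum>i<n. cnj (X $$ (i, j)) * y (Inl i)) * y (Inr j)))"
proof -
  let ?S = "\<Sum>j<m. cnj (\<Sum>i<n. cnj (X $$ (i, j)) * y (Inl i)) * y (Inr j)"
  have "(\<Sum>i<n. cnj (y (Inl i)) * (\<Sum>j<m. X $$ (i, j) * y (Inr j))) = ?S"
    unfolding sum_distrib_left cnj_sum sum_distrib_right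
    by (subst sum.swap) (simp add: mult_ac)
  moreover have "(\<Sum>j<m. cnj (y (Inr j)) * (\<Sum>i<n. cnj (X $$ (i, j)) * y (Inl i))) = cnj ?S"
    unfolding cnj_sum by (intro sum.cong refl) (simp add: mult.commute)
  ultimately have "ip (idx n m) y (mv (idx n m) (dilation X) y) = ?S + cnj ?S"
    unfolding ip_def sum_idx mv_dilation by simp
  thus ?thesis by (simp only: complex_add_cnj)
qed

lemma nrm_idx: "(nrm (idx n m) y)\<^sup>2 = (nrm {..<n} (\<lambda>i. y (Inl i)))\<^sup>2 + (nrm {..<m} (\<lambda>j. y (Inr j)))\<^sup>2"
  by (simp add: nrm_sq sum_idx)

text \<open>The form is twice the real part of (X* x, y), at most 2 s |x| |y| \<le> s (|x|^2 +
  |y|^2), where x and y are the two components and s is the largest singular value.\<close>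

lemma dilation_form_le:
  assumes X: "X \<in> carrier_mat n m" and n: "0 < n"
  shows "Re (ip (idx n m) y (mv (idx n m) (dilation X) y)) \<le> hd (singular_values X) * (nrm (idx n m) y)\<^sup>2"
proof -
  define s where "s = hd (singular_values X)"
  define T where "T j = (\<Sum>i<n. cnj (X $$ (i, j)) * y (Inl i))" for j
  define a where "a = nrm {..<n} (\<lambda>i. y (Inl i))"
  define b where "b = nrm {..<m} (\<lambda>j. y (Inr j))"
  have s: "0 \<le> s" unfolding s_def using hd_singular_values[OF X n] by simp
  have "(nrm {..<m} T)\<^sup>2 \<le> (s * a)\<^sup>2"
    unfolding nrm_sq T_def power_mult_distrib s_def a_def
    using adjoint_norm_le[OF X n, of "\<lambda>i. y (Inl i)"] by (simp only: nrm_sq)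
  hence T: "nrm {..<m} T \<le> s * a" by (rule power2_le_imp_le) (simp add: s a_def)
  have "Re (ip {..<m} T (\<lambda>j. y (Inr j))) \<le> nrm {..<m} T * b"
    unfolding b_def using ip_Cauchy_Schwarz complex_Re_le_cmod order_trans by blast
  also have "\<dots> \<le> (s * a) * b" using T by (intro mult_right_mono) (simp_all add: b_def)
  finally have "2 * Re (ip {..<m} T (\<lambda>j. y (Inr j))) \<le> s * (2 * a * b)" by simp
  also have "\<dots> \<le> s * (a\<^sup>2 + b\<^sup>2)"
    using s sum_squares_bound[of a b] by (intro mult_left_mono) auto
  finally have "2 * Re (ip {..<m} T (\<lambda>j. y (Inr j))) \<le> s * (a\<^sup>2 + b\<^sup>2)" .
  moreover have "(\<Sum>j<m. cnj (\<Sum>i<n. cnj (X $$ (i, j)) * y (Inl i)) * y (Inr j)) = ip {..<m} T (\<lambda>j. y (Inr j))"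
    by (simp only: ip_def T_def)
  ultimately show ?thesis
    unfolding dilation_form nrm_idx a_def[symmetric] b_def[symmetric] s_def[symmetric] by simp
qed

lemma hermitian_op_dilation:
  assumes "X \<in> carrier_mat n m" "0 < n"
  shows "hermitian_op (idx n m) (dilation X) (hd (singular_values X))"
proof
  show "dilation X j i = cnj (dilation X i j)" for i j
    by (cases i; cases j) simp_all
qed (use dilation_form_le[OF assms] in auto)

definition shifted_gram :: "real \<Rightarrow> complex mat \<Rightarrow> complex mat" where
  "shifted_gram z X = of_real (z\<^sup>2) \<cdot>\<^sub>m 1\<^sub>m (dim_row X) - X * mat_adjoint X"

text \<open>The inverse of z^2 - X X* by Cramer's rule. Being rational in the entries of X and their
  conjugates, and 0 where the determinant vanishes, it is total and measurable on all
  matrices.\<close>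

definition gram_resolvent :: "real \<Rightarrow> complex mat \<Rightarrow> nat \<Rightarrow> nat \<Rightarrow> complex" where
  "gram_resolvent z X i k = adj_mat (shifted_gram z X) $$ (i, k) / det (shifted_gram z X)"

text \<open>Block inversion by the Schur complement: with G the inverse of z^2 - X X*, the blocks
  are z G, G X, X* G and (1 + X* G X) / z.\<close>

definition dilation_resolvent :: "real \<Rightarrow> complex mat \<Rightarrow> nat + nat \<Rightarrow> nat + nat \<Rightarrow> complex" where
  "dilation_resolvent z X p q = (let G = gram_resolvent z X; n = dim_row X in
    case (p, q) of
      (Inl i, Inl k) \<Rightarrow> of_real z * G i k
    | (Inl i, Inr l) \<Rightarrow> (\<Sum>k<n. G i k * X $$ (k, l))
    | (Inr j, Inl k) \<Rightarrow> (\<Sum>i<n. cnj (X $$ (i, j)) * G i k)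
    | (Inr j, Inr l) \<Rightarrow> ((if j = l then 1 else 0) + (\<Sum>i<n. cnj (X $$ (i, j)) * (\<Sum>k<n. G i k * X $$ (k, l)))) / of_real z)"

lemma dilation_resolvent_index:
  assumes "dim_row X = n"
  shows
  "dilation_resolvent z X (Inl i) (Inl k) = of_real z * gram_resolvent z X i k"
  "dilation_resolvent z X (Inl i) (Inr l) = (\<Sum>k<n. gram_resolvent z X i k * X $$ (k, l))"
  "dilation_resolvent z X (Inr j) (Inl k) = (\<Sum>i<n. cnj (X $$ (i, j)) * gram_resolvent z X i k)"
  "dilation_resolvent z X (Inr j) (Inr l) =
    ((if j = l then 1 else 0) + (\<Sum>i<n. cnj (X $$ (i, j)) * (\<Sum>k<n. gram_resolvent z X i k * X $$ (k, l)))) / of_real z"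
  using assms by (auto simp: dilation_resolvent_def Let_def)

context
  fixes X :: "complex mat" and n m :: nat and z :: real
  assumes X: "X \<in> carrier_mat n m" and n: "0 < n" and z: "hd (singular_values X) < z"
begin

lemma z_pos: "0 < z"
  using hd_singular_values(1)[OF X n] z by linarith

lemma shifted_gram_carrier: "shifted_gram z X \<in> carrier_mat n n"
  using X by (auto simp: shifted_gram_def intro!: minus_carrier_mat)

lemma index_shifted_gram:
  "i < n \<Longrightarrow> k < n \<Longrightarrow> shifted_gram z X $$ (i, k) = of_real (z\<^sup>2) * (if i = k then 1 else 0) - gram m X i k"
  using X by (simp add: shifted_gram_def index_mult_adjoint del: index_mult_mat of_real_power) 
    (auto simp: gram_def scalar_prod_def lessThan_atLeast0)

lemma det_shifted_gram: "det (shifted_gram z X) \<noteq> 0"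
proof
  let ?C = "shifted_gram z X"
  assume "det ?C = 0"
  then obtain v where v: "v \<in> carrier_vec n" "v \<noteq> 0\<^sub>v n" "?C *\<^sub>v v = 0\<^sub>v n"
    using det_0_iff_vec_prod_zero[OF shifted_gram_carrier] by auto
  define x where "x i = v $ i" for i
  have "mv {..<n} (gram m X) x i = of_real (z\<^sup>2) * x i" if "i < n" for i
  proof -
    have "0 = (?C *\<^sub>v v) $ i" using v that by simp
    also have "\<dots> = (\<Sum>k<n. ?C $$ (i, k) * x k)"
      using shifted_gram_carrier v(1) that by (simp add: scalar_prod_def lessThan_atLeast0 x_def)
    also have "\<dots> = (\<Sum>k<n. (if i = k then of_real (z\<^sup>2) * x k else 0)) - mv {..<n} (gram m X) x i"
      unfolding mv_def sum_subtractf[symmetric]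
      by (intro sum.cong) (auto simp: index_shifted_gram that algebra_simps)
    finally show ?thesis using that by simp
  qed
  hence "ip {..<n} x (mv {..<n} (gram m X) x) = ip {..<n} x (\<lambda>i. of_real (z\<^sup>2) * x i)"
    by (intro ip_cong) auto
  hence "(\<Sum>j<m. (cmod (\<Sum>i<n. cnj (X $$ (i, j)) * x i))\<^sup>2) = z\<^sup>2 * (nrm {..<n} x)\<^sup>2"
    unfolding gram_form ip_scale_right ip_self by (simp only: of_real_mult[symmetric] of_real_eq_iff)
  hence "z\<^sup>2 * (nrm {..<n} x)\<^sup>2 \<le> (hd (singular_values X))\<^sup>2 * (nrm {..<n} x)\<^sup>2"
    using adjoint_norm_le[OF X n, of x] by simp
  moreover have "nrm {..<n} x \<noteq> 0"
  proof
    assume "nrm {..<n} x = 0"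
    hence "\<forall>i<n. v $ i = 0" by (auto simp: nrm_eq_0 x_def)
    thus False using v by auto
  qed
  ultimately have "z\<^sup>2 \<le> (hd (singular_values X))\<^sup>2" by simp
  thus False using hd_singular_values(1)[OF X n] z by (simp add: power2_le_iff_abs_le)
qed

lemma gram_resolvent_inverse:
  assumes "i < n" "l < n"
  shows "(\<Sum>k<n. gram m X i k * gram_resolvent z X k l) = of_real (z\<^sup>2) * gram_resolvent z X i l - (if i = l then 1 else 0)"
proof -
  let ?C = "shifted_gram z X"
  have "(\<Sum>k<n. ?C $$ (i, k) * adj_mat ?C $$ (k, l)) = (?C * adj_mat ?C) $$ (i, l)"
    using shifted_gram_carrier adj_mat(1)[OF shifted_gram_carrier] assms
    by (simp add: scalar_prod_def lessThan_atLeast0)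
  also have "\<dots> = det ?C * (if i = l then 1 else 0)"
    using assms by (simp add: adj_mat(2)[OF shifted_gram_carrier])
  finally have "(\<Sum>k<n. ?C $$ (i, k) * gram_resolvent z X k l) = (if i = l then 1 else 0)"
    using det_shifted_gram by (simp add: gram_resolvent_def sum_divide_distrib[symmetric])
  also have "(\<Sum>k<n. ?C $$ (i, k) * gram_resolvent z X k l)
      = (\<Sum>k<n. if i = k then of_real (z\<^sup>2) * gram_resolvent z X k l else 0) - (\<Sum>k<n. gram m X i k * gram_resolvent z X k l)"
    unfolding sum_subtractf[symmetric]
    by (intro sum.cong) (auto simp: index_shifted_gram assms algebra_simps)
  finally show ?thesis using assms by (simp add: algebra_simps)
qed

lemma gram_sum: "(\<Sum>j<m. X $$ (i, j) * (\<Sum>p<n. cnj (X $$ (p, j)) * f p)) = (\<Sum>p<n. gram m X i p * f p)"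
  unfolding gram_def sum_distrib_left sum_distrib_right
  by (subst sum.swap) (simp add: mult.assoc)

lemmas dilation_resolvent_simps = dilation_resolvent_index[OF carrier_matD(1)[OF X]]

lemma dilation_resolvent_inverse:
  assumes "p \<in> idx n m" "q \<in> idx n m"
  shows "of_real z * dilation_resolvent z X p q - (\<Sum>r\<in>idx n m. dilation X p r * dilation_resolvent z X r q) = (if p = q then 1 else 0)"
proof -
  let ?G = "gram_resolvent z X"
  have z0: "complex_of_real z \<noteq> 0" using z_pos by simp
  consider i k where "p = Inl i" "q = Inl k" | i l where "p = Inl i" "q = Inr l"
    | j k where "p = Inr j" "q = Inl k" | j l where "p = Inr j" "q = Inr l"
    by (cases p; cases q) auto
  thus ?thesis
  proof cases
    case 1
    thus ?thesis using assms
      by (simp add: sum_idx dilation_resolvent_simps gram_sum gram_resolvent_inverse power2_eq_square mult.assoc)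
  next
    case 2
    have i: "i < n" and l: "l < m" using assms 2 by simp_all
    have "(\<Sum>j<m. X $$ (i, j) * (((if j = l then 1 else 0) + (\<Sum>p<n. cnj (X $$ (p, j)) * (\<Sum>k<n. ?G p k * X $$ (k, l)))) / of_real z))
      = ((\<Sum>j<m. X $$ (i, j) * (if j = l then 1 else 0)) + (\<Sum>p<n. gram m X i p * (\<Sum>k<n. ?G p k * X $$ (k, l)))) / of_real z"
      by (simp add: distrib_left sum.distrib gram_sum add_divide_distrib flip: sum_divide_distrib)
    also have "(\<Sum>j<m. X $$ (i, j) * (if j = l then 1 else 0)) = X $$ (i, l)"
      using l by (simp add: if_distrib cong: if_cong)
    also have "(\<Sum>p<n. gram m X i p * (\<Sum>k<n. ?G p k * X $$ (k, l))) = (\<Sum>k<n. (\<Sum>p<n. gram m X i p * ?G p k) * X $$ (k, l))"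
      unfolding sum_distrib_left sum_distrib_right by (subst sum.swap) (simp add: mult.assoc)
    also have "\<dots> = (\<Sum>k<n. of_real (z\<^sup>2) * (?G i k * X $$ (k, l)) - (if i = k then X $$ (k, l) else 0))"
      using i by (intro sum.cong) (auto simp: gram_resolvent_inverse algebra_simps)
    also have "\<dots> = of_real (z\<^sup>2) * (\<Sum>k<n. ?G i k * X $$ (k, l)) - X $$ (i, l)"
      using i by (simp add: sum_subtractf sum_distrib_left)
    finally show ?thesis using 2 z0
      by (simp add: sum_idx dilation_resolvent_simps power2_eq_square)
  next
    case 3
    thus ?thesis by (simp add: sum_idx dilation_resolvent_simps sum_distrib_left mult_ac)
  next
    case 4
    thus ?thesis using z0 by (simp add: sum_idx dilation_resolvent_simps)
  qed
qed

lemma resolvent_dilation: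
  "resolvent (idx n m) (dilation X) (hd (singular_values X)) z (dilation_resolvent z X)"
proof -
  interpret hermitian_op "idx n m" "dilation X" "hd (singular_values X)"
    by (rule hermitian_op_dilation[OF X n])
  let ?I = "idx n m" and ?R = "dilation_resolvent z X"
  show ?thesis
  proof
    fix i x assume i: "i \<in> ?I"
    have "mv ?I (dilation X) (mv ?I ?R x) i = (\<Sum>q\<in>?I. (\<Sum>r\<in>?I. dilation X i r * ?R r q) * x q)"
      unfolding mv_def sum_distrib_left sum_distrib_right by (subst sum.swap) (simp add: mult.assoc)
    hence "of_real z * mv ?I ?R x i - mv ?I (dilation X) (mv ?I ?R x) i
        = (\<Sum>q\<in>?I. (of_real z * ?R i q - (\<Sum>r\<in>?I. dilation X i r * ?R r q)) * x q)"
      by (simp add: mv_def sum_distrib_left left_diff_distrib sum_subtractf mult.assoc)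
    also have "\<dots> = (\<Sum>q\<in>?I. if i = q then x q else 0)"
      using i by (intro sum.cong) (auto simp: dilation_resolvent_inverse)
    also have "\<dots> = x i" using i by simp
    finally show "of_real z * mv ?I ?R x i - mv ?I (dilation X) (mv ?I ?R x) i = x i" .
  qed (rule z)
qed

text \<open>The trace of X* G X equals that of X X* G, which is z^2 tr G - n. The surplus (m - n) /
  z stands for the m - n extra null directions on the column side and is the origin of the term (1 -
  c) / z.\<close>

lemma trace_dilation_resolvent:
  "(\<Sum>i<n. dilation_resolvent z X (Inl i) (Inl i)) = of_real z * (\<Sum>i<n. gram_resolvent z X i i)"
  "(\<Sum>j<m. dilation_resolvent z X (Inr j) (Inr j)) =
    of_real z * (\<Sum>i<n. gram_resolvent z X i i) + (of_nat m - of_nat n) / of_real z"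
proof -
  let ?G = "gram_resolvent z X"
  show "(\<Sum>i<n. dilation_resolvent z X (Inl i) (Inl i)) = of_real z * (\<Sum>i<n. ?G i i)"
    by (simp add: dilation_resolvent_simps sum_distrib_left)
  have "(\<Sum>j<m. \<Sum>i<n. cnj (X $$ (i, j)) * (\<Sum>k<n. ?G i k * X $$ (k, j))) = (\<Sum>k<n. \<Sum>i<n. gram m X k i * ?G i k)"
  proof -
    have "(\<Sum>j<m. \<Sum>i<n. cnj (X $$ (i, j)) * (\<Sum>k<n. ?G i k * X $$ (k, j)))
      = (\<Sum>j<m. \<Sum>k<n. \<Sum>i<n. X $$ (k, j) * cnj (X $$ (i, j)) * ?G i k)"
    proof (rule sum.cong[OF refl])
      fix j
      show "(\<Sum>i<n. cnj (X $$ (i, j)) * (\<Sum>k<n. ?G i k * X $$ (k, j)))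
        = (\<Sum>k<n. \<Sum>i<n. X $$ (k, j) * cnj (X $$ (i, j)) * ?G i k)"
        unfolding sum_distrib_left by (subst sum.swap) (simp add: mult_ac)
    qed
    also have "\<dots> = (\<Sum>k<n. \<Sum>j<m. \<Sum>i<n. X $$ (k, j) * cnj (X $$ (i, j)) * ?G i k)" by (rule sum.swap)
    also have "\<dots> = (\<Sum>k<n. \<Sum>i<n. \<Sum>j<m. X $$ (k, j) * cnj (X $$ (i, j)) * ?G i k)"
      by (intro sum.cong refl sum.swap)
    finally show ?thesis by (simp add: gram_def sum_distrib_right)
  qed
  also have "\<dots> = of_real (z\<^sup>2) * (\<Sum>k<n. ?G k k) - of_nat n"
    by (simp add: gram_resolvent_inverse sum_subtractf sum_distrib_left)
  finally show "(\<Sum>j<m. dilation_resolvent z X (Inr j) (Inr j)) =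
      of_real z * (\<Sum>i<n. ?G i i) + (of_nat m - of_nat n) / of_real z"
    using z_pos by (simp add: dilation_resolvent_simps sum.distrib field_simps power2_eq_square flip: sum_divide_distrib)
qed

lemma poly_char_poly_det: "A \<in> carrier_mat k k \<Longrightarrow> poly (char_poly A) c = det (c \<cdot>\<^sub>m 1\<^sub>m k - A)" for A :: "complex mat"
  by (subst char_poly_matrix, assumption, rule arg_cong[where f=det], rule eq_matI)
    (auto simp: char_matrix_def)

lemma poly_pderiv_prod_linear:
  fixes f :: "'b \<Rightarrow> complex"
  assumes "\<And>a. a \<in> set s \<Longrightarrow> c \<noteq> f a"
  shows "poly (pderiv (\<Prod>a\<leftarrow>s. [:- f a, 1:])) c = poly (\<Prod>a\<leftarrow>s. [:- f a, 1:]) c * (\<Sum>a\<leftarrow>s. 1 / (c - f a))"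
  using assms
proof (induction s)
  case (Cons a s)
  hence IH: "poly (pderiv (\<Prod>a\<leftarrow>s. [:- f a, 1:])) c = poly (\<Prod>a\<leftarrow>s. [:- f a, 1:]) c * (\<Sum>a\<leftarrow>s. 1 / (c - f a))" by simp
  have "c - f a \<noteq> 0" using Cons.prems by simp
  thus ?case by (simp add: pderiv_mult IH pderiv_pCons field_simps del: mult_pCons_left mult_pCons_right)
qed simp

text \<open>The trace of the adjugate is the derivative of the characteristic polynomial at z^2, so
  the trace of the inverse is its logarithmic derivative.\<close>

lemma trace_gram_resolvent:
  "(\<Sum>i<n. gram_resolvent z X i i) = of_real (\<Sum>s\<leftarrow>singular_values X. 1 / (z\<^sup>2 - s\<^sup>2))"
proof -
  let ?B = "X * mat_adjoint X" and ?C = "shifted_gram z X"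
  define c where "c = complex_of_real (z\<^sup>2)"
  have B: "?B \<in> carrier_mat n n" using X by auto
  have C: "?C = c \<cdot>\<^sub>m 1\<^sub>m n - ?B" using X by (simp add: shifted_gram_def c_def)
  have adj: "adj_mat ?C $$ (i, i) = poly (char_poly (mat_delete ?B i i)) c" if "i < n" for i
  proof -
    have "mat_delete ?B i i \<in> carrier_mat (n - 1) (n - 1)" using X by (auto simp: mat_delete_def)
    from poly_char_poly_det[OF this, of c]
    have "poly (char_poly (mat_delete ?B i i)) c = det (c \<cdot>\<^sub>m 1\<^sub>m (n - 1) - mat_delete ?B i i)" .
    also have "c \<cdot>\<^sub>m 1\<^sub>m (n - 1) - mat_delete ?B i i = mat_delete ?C i i"
      unfolding C using X by (intro eq_matI) (auto simp: mat_delete_def)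
    finally show ?thesis
      using that shifted_gram_carrier by (simp add: adj_mat_def cofactor_def)
  qed
  have sv: "char_poly ?B = (\<Prod>x\<leftarrow>singular_values X. [:- of_real (x\<^sup>2), 1:])"
    using singular_values_complex(1)[OF X] by (simp add: is_singular_values_def)
  have ne: "c \<noteq> of_real (x\<^sup>2)" if "x \<in> set (singular_values X)" for x
  proof -
    have "0 \<le> x" using singular_values_complex(1)[OF X] that by (simp add: is_singular_values_def)
    moreover have "x < z" using hd_singular_values(2)[OF X n that] z by linarith
    ultimately have "x\<^sup>2 < z\<^sup>2" by (simp add: power_strict_mono)
    thus ?thesis unfolding c_def of_real_eq_iff by simp
  qed
  have "(\<Sum>i<n. adj_mat ?C $$ (i, i)) = poly (pderiv (char_poly ?B)) c"
    by (simp add: pderiv_char_poly[OF B] poly_sum adj)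
  also have "\<dots> = poly (char_poly ?B) c * (\<Sum>x\<leftarrow>singular_values X. 1 / (c - of_real (x\<^sup>2)))"
    unfolding sv by (rule poly_pderiv_prod_linear[OF ne])
  also have "poly (char_poly ?B) c = det ?C" by (simp add: poly_char_poly_det[OF B] C)
  finally have "(\<Sum>i<n. gram_resolvent z X i i) = (\<Sum>x\<leftarrow>singular_values X. 1 / (c - of_real (x\<^sup>2)))"
    using det_shifted_gram by (simp add: gram_resolvent_def flip: sum_divide_distrib)
  also have "\<dots> = of_real (\<Sum>s\<leftarrow>singular_values X. 1 / (z\<^sup>2 - s\<^sup>2))"
  proof -
    have "(\<Sum>x\<leftarrow>l. 1 / (complex_of_real (z\<^sup>2) - of_real (x\<^sup>2))) = of_real (\<Sum>s\<leftarrow>l. 1 / (z\<^sup>2 - s\<^sup>2))" for l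
      by (induction l) simp_all
    thus ?thesis unfolding c_def .
  qed
  finally show ?thesis .
qed

end

section \<open>Transforms of the limiting distribution\<close>

locale edge_distribution = real_distribution \<mu> for \<mu> :: "real measure" +
  fixes b :: real
  assumes b_nonneg: "0 \<le> b" and AE_edge: "AE t in \<mu>. 0 \<le> t \<and> t \<le> b"
begin

lemma diff_sq_pos: "0 \<le> t \<Longrightarrow> t \<le> b \<Longrightarrow> b < z \<Longrightarrow> 0 < z\<^sup>2 - b\<^sup>2 \<and> z\<^sup>2 - b\<^sup>2 \<le> z\<^sup>2 - t\<^sup>2 \<and> z\<^sup>2 - t\<^sup>2 \<le> z\<^sup>2 \<and> 0 < z\<^sup>2 - t\<^sup>2"
  using power_strict_mono[of t z 2] power_strict_mono[of b z 2] power_mono[of t b 2] b_nonneg by auto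

lemma AE_edgeI: "(\<And>t. 0 \<le> t \<Longrightarrow> t \<le> b \<Longrightarrow> P t) \<Longrightarrow> AE t in \<mu>. P t"
  using AE_edge by (rule eventually_mono) blast

lemma expectation_const: "expectation (\<lambda>_. k) = k" for k :: real
  using prob_space by simp

lemma integrable_edge:
  fixes f :: "real \<Rightarrow> real"
  assumes [measurable]: "f \<in> borel_measurable borel" and "\<And>t. 0 \<le> t \<Longrightarrow> t \<le> b \<Longrightarrow> \<bar>f t\<bar> \<le> B"
  shows "integrable \<mu> f"
  using assms(2) by (intro integrable_const_bound[where B=B] AE_edgeI) auto

lemma integrable_phi: "b < z \<Longrightarrow> integrable \<mu> (\<lambda>t. z / (z\<^sup>2 - t\<^sup>2))"
proof (rule integrable_edge[where B="z / (z\<^sup>2 - b\<^sup>2)"])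
  fix t assume "b < z" "0 \<le> t" "t \<le> b"
  thus "\<bar>z / (z\<^sup>2 - t\<^sup>2)\<bar> \<le> z / (z\<^sup>2 - b\<^sup>2)"
    using diff_sq_pos[of t z] b_nonneg by (auto intro!: divide_left_mono mult_pos_pos)
qed measurable

text \<open>The kernel minus 1 / x equals t^2 / (x (x^2 - t^2)), which decreases in x. The kernel
  thus falls at least as much as 1 / x, for every t at once, and strict decrease survives the
  integration.\<close>

lemma phi_diff_ge:
  assumes "b < y" "y < z"
  shows "1 / y - 1 / z \<le> phi \<mu> y - phi \<mu> z"
proof -
  have "1 / y - 1 / z \<le> y / (y\<^sup>2 - t\<^sup>2) - z / (z\<^sup>2 - t\<^sup>2)" if "0 \<le> t" "t \<le> b" for t
  proof -
    have y: "0 < y" and z: "0 < z" using b_nonneg assms by linarith+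
    have 1: "x / (x\<^sup>2 - t\<^sup>2) - 1 / x = t\<^sup>2 / (x * (x\<^sup>2 - t\<^sup>2))" if "b < x" for x
    proof -
      have "x \<noteq> 0" "x\<^sup>2 - t\<^sup>2 \<noteq> 0" using diff_sq_pos[of t x] that \<open>0 \<le> t\<close> \<open>t \<le> b\<close> b_nonneg by auto
      thus ?thesis by (simp add: divide_simps power2_eq_square algebra_simps)
    qed
    have "t\<^sup>2 / (z * (z\<^sup>2 - t\<^sup>2)) \<le> t\<^sup>2 / (y * (y\<^sup>2 - t\<^sup>2))"
      using diff_sq_pos[of t y] diff_sq_pos[of t z] that assms y z power_mono[of y z 2]
      by (intro divide_left_mono mult_mono mult_pos_pos) auto
    thus ?thesis using 1[of y] 1[of z] assms by linarith
  qed
  hence "AE t in \<mu>. 1 / y - 1 / z \<le> y / (y\<^sup>2 - t\<^sup>2) - z / (z\<^sup>2 - t\<^sup>2)"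
    by (rule AE_edgeI)
  hence "expectation (\<lambda>t. 1 / y - 1 / z) \<le> expectation (\<lambda>t. y / (y\<^sup>2 - t\<^sup>2) - z / (z\<^sup>2 - t\<^sup>2))"
    using assms by (intro integral_mono_AE Bochner_Integration.integrable_diff integrable_phi) auto
  thus ?thesis
    using assms unfolding phi_def expectation_const
    by (subst (asm) Bochner_Integration.integral_diff) (auto intro!: integrable_phi)
qed

lemma phi_strict_decreasing: "b < y \<Longrightarrow> y < z \<Longrightarrow> phi \<mu> z < phi \<mu> y"
  using phi_diff_ge[of y z] b_nonneg by (smt (verit) frac_less2)

lemma phi_pos: "b < z \<Longrightarrow> 0 < phi \<mu> z"
proof -
  assume z: "b < z"
  have "AE t in \<mu>. 1 / z \<le> z / (z\<^sup>2 - t\<^sup>2)"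
    using AE_edge
  proof (rule eventually_mono)
    fix t assume "0 \<le> t \<and> t \<le> b"
    hence "0 < z\<^sup>2 - t\<^sup>2" "z\<^sup>2 - t\<^sup>2 \<le> z\<^sup>2" "0 < z" using diff_sq_pos[of t z] z b_nonneg by auto
    thus "1 / z \<le> z / (z\<^sup>2 - t\<^sup>2)" by (simp add: divide_simps power2_eq_square)
  qed
  hence "expectation (\<lambda>t. 1 / z) \<le> phi \<mu> z"
    unfolding phi_def using z by (intro integral_mono_AE integrable_phi) auto
  moreover have "0 < 1 / z" using z b_nonneg by simp
  ultimately show "0 < phi \<mu> z" by (simp only: expectation_const)
qed

text \<open>By partial fractions the kernel is the mean of 1 / (z - t) and 1 / (z + t). The
  first-order remainder of each is (y - z)^2 over a product of three factors not smaller than r - b.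
  The bound is free of t, which permits differentiation under the integral.\<close>

lemma phi_kernel_remainder:
  assumes t: "0 \<le> t" "t \<le> b" and r: "b < r" "r \<le> y" "r \<le> z"
  shows "\<bar>y / (y\<^sup>2 - t\<^sup>2) - z / (z\<^sup>2 - t\<^sup>2) + (y - z) * ((z\<^sup>2 + t\<^sup>2) / (z\<^sup>2 - t\<^sup>2)\<^sup>2)\<bar> \<le> (y - z)\<^sup>2 / (r - b) ^ 3"
proof -
  have pos: "r - b \<le> y - t" "r - b \<le> y + t" "r - b \<le> z - t" "r - b \<le> z + t" "0 < r - b"
    using t r by auto
  have part: "1 / (y + s) - 1 / (z + s) + (y - z) / (z + s)\<^sup>2 = (y - z)\<^sup>2 / ((y + s) * (z + s)\<^sup>2)"
    if "0 < y + s" "0 < z + s" for s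
  proof -
    have "1 / (y + s) - 1 / (z + s) + (y - z) / (z + s)\<^sup>2
       = ((z + s)\<^sup>2 - (y + s) * (z + s) + (y - z) * (y + s)) / ((y + s) * (z + s)\<^sup>2)"
      using that by (simp add: divide_simps) (simp add: power2_eq_square algebra_simps)
    also have "(z + s)\<^sup>2 - (y + s) * (z + s) + (y - z) * (y + s) = (y - z)\<^sup>2"
      by (simp add: power2_eq_square algebra_simps)
    finally show ?thesis .
  qed
  have bound: "0 \<le> (y - z)\<^sup>2 / ((y + s) * (z + s)\<^sup>2) \<and> (y - z)\<^sup>2 / ((y + s) * (z + s)\<^sup>2) \<le> (y - z)\<^sup>2 / (r - b) ^ 3"
    if "r - b \<le> y + s" "r - b \<le> z + s" for s
  proof -
    have "(r - b) ^ 3 = (r - b) * (r - b)\<^sup>2" by (simp add: power3_eq_cube power2_eq_square)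
    also have "\<dots> \<le> (y + s) * (z + s)\<^sup>2"
      using that pos(5) by (intro mult_mono power_mono) auto
    finally show ?thesis using pos(5) that by (auto intro!: divide_left_mono mult_pos_pos)
  qed
  have nz: "y - t \<noteq> 0" "y + t \<noteq> 0" "z - t \<noteq> 0" "z + t \<noteq> 0" using pos by auto
  have sq: "x\<^sup>2 - t\<^sup>2 = (x - t) * (x + t)" for x by (simp add: power2_eq_square algebra_simps)
  have split: "x / (x\<^sup>2 - t\<^sup>2) = (1 / (x - t) + 1 / (x + t)) / 2" if "x - t \<noteq> 0" "x + t \<noteq> 0" for x
    unfolding sq using that by (simp add: divide_simps)
  have "(z\<^sup>2 + t\<^sup>2) / (z\<^sup>2 - t\<^sup>2)\<^sup>2 = (1 / (z - t)\<^sup>2 + 1 / (z + t)\<^sup>2) / 2"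
  proof -
    have gen: "x / w = u / 2" if "u = 2 * x / w" for x w u :: real using that by simp
    have "1 / (z - t)\<^sup>2 + 1 / (z + t)\<^sup>2 = ((z + t)\<^sup>2 + (z - t)\<^sup>2) / ((z - t)\<^sup>2 * (z + t)\<^sup>2)"
      using nz by (simp add: add_frac_eq)
    also have "(z + t)\<^sup>2 + (z - t)\<^sup>2 = 2 * (z\<^sup>2 + t\<^sup>2)" by (simp add: power2_eq_square algebra_simps)
    finally show ?thesis unfolding sq power_mult_distrib by (rule gen)
  qed
  hence "y / (y\<^sup>2 - t\<^sup>2) - z / (z\<^sup>2 - t\<^sup>2) + (y - z) * ((z\<^sup>2 + t\<^sup>2) / (z\<^sup>2 - t\<^sup>2)\<^sup>2)
    = ((1 / (y - t) - 1 / (z - t) + (y - z) / (z - t)\<^sup>2) + (1 / (y + t) - 1 / (z + t) + (y - z) / (z + t)\<^sup>2)) / 2"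
    using split[of y] split[of z] nz by (simp add: algebra_simps add_divide_distrib diff_divide_distrib)
  also have "\<dots> = ((y - z)\<^sup>2 / ((y - t) * (z - t)\<^sup>2) + (y - z)\<^sup>2 / ((y + t) * (z + t)\<^sup>2)) / 2"
    using part[of "- t"] part[of t] pos by simp
  finally have E: "y / (y\<^sup>2 - t\<^sup>2) - z / (z\<^sup>2 - t\<^sup>2) + (y - z) * ((z\<^sup>2 + t\<^sup>2) / (z\<^sup>2 - t\<^sup>2)\<^sup>2)
    = ((y - z)\<^sup>2 / ((y - t) * (z - t)\<^sup>2) + (y - z)\<^sup>2 / ((y + t) * (z + t)\<^sup>2)) / 2" .
  have "0 \<le> (y - z)\<^sup>2 / ((y - t) * (z - t)\<^sup>2) \<and> (y - z)\<^sup>2 / ((y - t) * (z - t)\<^sup>2) \<le> (y - z)\<^sup>2 / (r - b) ^ 3"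
    using bound[of "- t"] pos by simp
  moreover have "0 \<le> (y - z)\<^sup>2 / ((y + t) * (z + t)\<^sup>2) \<and> (y - z)\<^sup>2 / ((y + t) * (z + t)\<^sup>2) \<le> (y - z)\<^sup>2 / (r - b) ^ 3"
    using bound[of t] pos by simp
  moreover have "\<bar>(p + q) / 2\<bar> \<le> B" if "0 \<le> p \<and> p \<le> B" "0 \<le> q \<and> q \<le> B" for p q B :: real
    using that by auto
  ultimately show ?thesis unfolding E by blast
qed

text \<open>The term \<open>deriv\<close> carries information only where a derivative exists; this
  makes the hypothesis at the edge usable in the mean value theorem. The midpoint \<open>r\<close>
  keeps nearby points away from the edge.\<close>

lemma phi_has_derivative:
  assumes z: "b < z"
  shows "(phi \<mu> has_real_derivative - expectation (\<lambda>t. (z\<^sup>2 + t\<^sup>2) / (z\<^sup>2 - t\<^sup>2)\<^sup>2)) (at z)"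
proof -
  define r where "r = (b + z) / 2"
  have r: "b < r" "r < z" using z by (auto simp: r_def)
  define A where "A = expectation (\<lambda>t. (z\<^sup>2 + t\<^sup>2) / (z\<^sup>2 - t\<^sup>2)\<^sup>2)"
  have intA: "integrable \<mu> (\<lambda>t. (z\<^sup>2 + t\<^sup>2) / (z\<^sup>2 - t\<^sup>2)\<^sup>2)"
  proof (rule integrable_edge[where B="(z\<^sup>2 + b\<^sup>2) / (z\<^sup>2 - b\<^sup>2)\<^sup>2"])
    fix t assume "0 \<le> t" "t \<le> b"
    thus "\<bar>(z\<^sup>2 + t\<^sup>2) / (z\<^sup>2 - t\<^sup>2)\<^sup>2\<bar> \<le> (z\<^sup>2 + b\<^sup>2) / (z\<^sup>2 - b\<^sup>2)\<^sup>2"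
      using diff_sq_pos[of t z] z power_mono[of t b 2] by (auto intro!: frac_le power_mono)
  qed measurable
  have rem: "\<bar>phi \<mu> y - phi \<mu> z + (y - z) * A\<bar> \<le> (y - z)\<^sup>2 / (r - b) ^ 3" if y: "r < y" for y
  proof -
    let ?f = "\<lambda>t. y / (y\<^sup>2 - t\<^sup>2) - z / (z\<^sup>2 - t\<^sup>2) + (y - z) * ((z\<^sup>2 + t\<^sup>2) / (z\<^sup>2 - t\<^sup>2)\<^sup>2)"
    have int: "integrable \<mu> ?f"
      using y r z by (intro Bochner_Integration.integrable_add Bochner_Integration.integrable_diff integrable_phi integrable_mult_right intA) auto
    have eq: "phi \<mu> y - phi \<mu> z + (y - z) * A = expectation ?f"
    proof -
      define k where "k x t = x / (x\<^sup>2 - t\<^sup>2)" for x t :: real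
      define a where "a t = (z\<^sup>2 + t\<^sup>2) / (z\<^sup>2 - t\<^sup>2)\<^sup>2" for t
      have "integrable \<mu> (k y)" "integrable \<mu> (k z)" "integrable \<mu> a"
        using integrable_phi y r z intA by (simp_all add: k_def[abs_def] a_def[abs_def])
      hence "expectation (k y) - expectation (k z) + (y - z) * expectation a
        = expectation (\<lambda>t. k y t - k z t + (y - z) * a t)" by simp
      thus ?thesis by (simp only: k_def[abs_def] a_def[abs_def] phi_def A_def)
    qed
    have "\<bar>expectation ?f\<bar> \<le> expectation (\<lambda>t. \<bar>?f t\<bar>)" by (rule integral_abs_bound)
    also have "\<dots> \<le> expectation (\<lambda>t. (y - z)\<^sup>2 / (r - b) ^ 3)"
      using int phi_kernel_remainder[of _ r y z] y r
      by (intro integral_mono_AE AE_edgeI) auto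
    finally show ?thesis unfolding eq by (simp only: expectation_const)
  qed
  have "((\<lambda>y. (phi \<mu> y - phi \<mu> z) / (y - z)) \<longlongrightarrow> - A) (at z)"
  proof (rule Lim_transform_bound[where g="\<lambda>y. \<bar>y - z\<bar> / (r - b) ^ 3", THEN LIM_zero_cancel])
    show "\<forall>\<^sub>F y in at z. norm ((phi \<mu> y - phi \<mu> z) / (y - z) - - A) \<le> norm (\<bar>y - z\<bar> / (r - b) ^ 3)"
    proof -
      have "\<forall>\<^sub>F y in at z. r < y" by (rule order_tendstoD(1)[OF tendsto_ident_at r(2)])
      moreover have "\<forall>\<^sub>F y in at z. y \<noteq> z" by (rule eventually_neq_at_within)
      ultimately show ?thesis
    proof eventually_elim
      case (elim y)
      have "\<bar>(phi \<mu> y - phi \<mu> z) / (y - z) - - A\<bar> = \<bar>phi \<mu> y - phi \<mu> z + (y - z) * A\<bar> / \<bar>y - z\<bar>"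
        using elim by (simp add: field_simps flip: abs_divide)
      also have "\<dots> \<le> (y - z)\<^sup>2 / (r - b) ^ 3 / \<bar>y - z\<bar>"
        by (intro divide_right_mono rem elim) simp
      also have "(y - z)\<^sup>2 = \<bar>y - z\<bar> * \<bar>y - z\<bar>" by (simp add: power2_eq_square)
      also have "\<bar>y - z\<bar> * \<bar>y - z\<bar> / (r - b) ^ 3 / \<bar>y - z\<bar> = \<bar>y - z\<bar> / (r - b) ^ 3"
      proof -
        have cancel: "d * d / q / d = d / q" if "d \<noteq> 0" for d q :: real using that by simp
        show ?thesis by (rule cancel) (use elim in simp)
      qed
      finally show ?case using r by simp
    qed
    qed
    have "((\<lambda>y. \<bar>y - z\<bar> / (r - b) ^ 3) \<longlongrightarrow> \<bar>z - z\<bar> / (r - b) ^ 3) (at z)"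
      using r by (intro tendsto_intros) auto
    thus "((\<lambda>y. \<bar>y - z\<bar> / (r - b) ^ 3) \<longlongrightarrow> 0) (at z)" by simp
  qed
  thus ?thesis by (simp add: has_field_derivative_iff A_def)
qed

text \<open>By the mean value theorem each quotient is minus a derivative at a point between
  \<open>z (Suc k)\<close> and \<open>z k\<close>.\<close>

lemma phi_slope_at_top:
  assumes deriv: "filterlim (deriv (phi \<mu>)) at_bot (at_right b)"
    and z: "\<And>k. b < z k" "\<And>k. z (Suc k) < z k" "z \<longlonglongrightarrow> b"
  shows "filterlim (\<lambda>k. (phi \<mu> (z (Suc k)) - phi \<mu> (z k)) / (z k - z (Suc k))) at_top sequentially"
  unfolding filterlim_at_top
proof
  fix K :: real
  have "\<forall>\<^sub>F x in at_right b. deriv (phi \<mu>) x \<le> - K"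
    using deriv unfolding filterlim_at_bot by blast
  then obtain c where c: "b < c" "\<And>x. b < x \<Longrightarrow> x < c \<Longrightarrow> deriv (phi \<mu>) x \<le> - K"
    unfolding eventually_at_right_field by auto
  show "\<forall>\<^sub>F k in sequentially. K \<le> (phi \<mu> (z (Suc k)) - phi \<mu> (z k)) / (z k - z (Suc k))"
    using order_tendstoD(2)[OF z(3) c(1)]
  proof (rule eventually_mono)
    fix k assume k: "z k < c"
    obtain x where x: "z (Suc k) < x" "x < z k" "phi \<mu> (z k) - phi \<mu> (z (Suc k)) = (z k - z (Suc k)) * deriv (phi \<mu>) x"
    proof -
      have "(phi \<mu> has_real_derivative deriv (phi \<mu>) x) (at x)" if "z (Suc k) \<le> x" for x
        using phi_has_derivative[of x] DERIV_imp_deriv z(1)[of "Suc k"] that by fastforce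
      from MVT2[OF z(2)[of k], of "phi \<mu>" "deriv (phi \<mu>)", OF this] that show ?thesis by blast
    qed
    have "(phi \<mu> (z (Suc k)) - phi \<mu> (z k)) / (z k - z (Suc k)) = - deriv (phi \<mu>) x"
      using x(3) z(2)[of k] by (simp add: field_simps)
    thus "K \<le> (phi \<mu> (z (Suc k)) - phi \<mu> (z k)) / (z k - z (Suc k))"
      using c(2)[of x] x(1,2) k z(1)[of "Suc k"] by simp
  qed
qed

section \<open>The D-transform and the subcritical regime\<close>

definition psi :: "real \<Rightarrow> real \<Rightarrow> real" where "psi c z = c * phi \<mu> z + (1 - c) / z"

lemma D_transform_eq: "D_transform c \<mu> z = phi \<mu> z * psi c z"
  by (simp add: D_transform_def phi_def psi_def)

context
  fixes c :: real assumes c: "0 \<le> c" "c \<le> 1"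
begin

lemma psi_pos: "b < z \<Longrightarrow> 0 < psi c z"
  using phi_pos[of z] b_nonneg c unfolding psi_def
  by (cases "c = 0") (auto intro!: add_pos_nonneg)

lemma psi_decreasing: "b < y \<Longrightarrow> y < z \<Longrightarrow> psi c z \<le> psi c y"
  using phi_strict_decreasing[of y z] b_nonneg c unfolding psi_def
  by (intro add_mono mult_left_mono divide_left_mono mult_pos_pos) auto

lemma D_transform_strict_decreasing: "b < y \<Longrightarrow> y < z \<Longrightarrow> D_transform c \<mu> z < D_transform c \<mu> y"
  unfolding D_transform_eq
  using phi_strict_decreasing[of y z] psi_decreasing[of y z] psi_pos[of z] phi_pos[of z]
  by (intro mult_less_le_imp_less) auto

text \<open>D is decreasing, so its limit from the right at the edge exists as an extended real and
  is the supremum; \<open>Lim\<close> then denotes it.\<close>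

lemma D_limit_eq: "D_limit c \<mu> b = (SUP z\<in>{b<..}. ereal (D_transform c \<mu> z))"
proof -
  let ?D = "\<lambda>z. ereal (D_transform c \<mu> z)" and ?S = "SUP z\<in>{b<..}. ereal (D_transform c \<mu> z)"
  have "(?D \<longlongrightarrow> ?S) (at_right b)"
  proof (rule order_tendstoI)
    fix a assume "a < ?S"
    then obtain y where y: "b < y" "a < ?D y" by (auto simp: less_SUP_iff)
    have "a < ?D z" if "b < z" "z < y" for z
      using D_transform_strict_decreasing[OF that] y(2) less_trans by fastforce
    thus "\<forall>\<^sub>F z in at_right b. a < ?D z" unfolding eventually_at_right_field using y(1) by blast
  next
    fix a assume a: "?S < a"
    have "?D z < a" if "b < z" for z
      using SUP_upper[of z "{b<..}" ?D] that a by (auto intro: le_less_trans)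
    thus "\<forall>\<^sub>F z in at_right b. ?D z < a"
      unfolding eventually_at_right_field using gt_ex[of b] by blast
  qed
  thus ?thesis unfolding D_limit_def by (intro tendsto_Lim) auto
qed

text \<open>As t > 0, the threshold is not 0, so the limit of D at the edge is a finite L with t^2 L
  \<le> 1. Strict decrease gives D(z) < L, hence strict inequality even at the threshold
  itself.\<close>

lemma subcritical:
  assumes t: "0 < t" "t \<le> theta_bar c \<mu> b"
  obtains F where "\<And>z. b < z \<Longrightarrow> t\<^sup>2 * (phi \<mu> z * psi c z) < 1" "\<And>z. b < z \<Longrightarrow> z \<le> b + 1 \<Longrightarrow> phi \<mu> z \<le> F"
proof -
  have fin: "D_limit c \<mu> b \<noteq> \<infinity>" using t by (auto simp: theta_bar_def)
  have ge: "ereal (D_transform c \<mu> z) \<le> D_limit c \<mu> b" if "b < z" for z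
    unfolding D_limit_eq using that by (intro SUP_upper) auto
  obtain L where L: "D_limit c \<mu> b = ereal L"
    using fin ge[of "b + 1"] by (cases "D_limit c \<mu> b") auto
  have DL: "D_transform c \<mu> z \<le> L" if "b < z" for z using ge[OF that] by (simp add: L)
  have Dpos: "0 < D_transform c \<mu> z" if "b < z" for z
    unfolding D_transform_eq using phi_pos[OF that] psi_pos[OF that] by simp
  have Lpos: "0 < L" using DL[of "b + 1"] Dpos[of "b + 1"] by simp
  have "t \<le> L powr (- 1 / 2)" using t L by (simp add: theta_bar_def)
  hence "t\<^sup>2 \<le> (L powr (- 1 / 2))\<^sup>2" using t by (intro power_mono) auto
  also have "(L powr (- 1 / 2))\<^sup>2 = L powr (- 1)" by (simp add: power2_eq_square flip: powr_add)
  finally have tL: "t\<^sup>2 * L \<le> 1" using Lpos by (simp add: powr_minus field_simps)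
  show thesis
  \<comment> \<open>The bound on \<phi> comes from \<phi> \<psi> \<le> L and covers two cases: for c
    \<ge> 1/2 the factor \<psi> is at least \<phi> / 2, and otherwise at least 1 / (2 (b + 1)). The
    constant dominates both outcomes.\<close>
  proof (rule that[of "1 + 2 * L + 2 * (b + 1) * L"])
    fix z assume z: "b < z"
    have "D_transform c \<mu> z < L"
      using D_transform_strict_decreasing[of "(b + z) / 2" z] DL[of "(b + z) / 2"] z by auto
    hence "t\<^sup>2 * D_transform c \<mu> z < t\<^sup>2 * L" using t by simp
    thus "t\<^sup>2 * (phi \<mu> z * psi c z) < 1" using tL by (simp add: D_transform_eq)
  next
    fix z assume z: "b < z" "z \<le> b + 1"
    define p where "p = phi \<mu> z"
    have p: "0 < p" "p * psi c z \<le> L" using phi_pos[OF z(1)] DL[OF z(1)] by (simp_all add: p_def D_transform_eq)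
    have z0: "0 < z" using z b_nonneg by linarith
    show "phi \<mu> z \<le> 1 + 2 * L + 2 * (b + 1) * L"
    proof (cases "1 / 2 \<le> c")
      case True
      have "p / 2 \<le> psi c z"
        unfolding psi_def p_def[symmetric] using True p z0 c mult_right_mono[of "1/2" c p] by (simp add: add_increasing2)
      hence "p * (p / 2) \<le> L" using p mult_left_mono[of "p / 2" "psi c z" p] by linarith
      moreover have "0 \<le> (p - 1)\<^sup>2" by simp
      ultimately have "p \<le> 1 + 2 * L" using p by (simp add: power2_eq_square algebra_simps)
      thus ?thesis using Lpos b_nonneg by (simp add: p_def add_increasing2)
    next
      case False
      have "1 / (2 * (b + 1)) = (1 / 2) / (b + 1)" by simp
      also have "\<dots> \<le> (1 - c) / z"
        by (rule frac_le) (use False z z0 in auto)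
      also have "\<dots> \<le> psi c z" unfolding psi_def p_def[symmetric] using p c by simp
      finally have "p * (1 / (2 * (b + 1))) \<le> p * psi c z" using p(1) by (intro mult_left_mono) linarith+
      hence "p * (1 / (2 * (b + 1))) \<le> L" using p(2) by linarith
      hence "p \<le> 2 * (b + 1) * L" using b_nonneg by (simp add: field_simps)
      thus ?thesis using Lpos by (simp add: p_def)
    qed
  qed
qed

end

end

section \<open>Empirical singular value distributions and their limit\<close>

lemma integral_empirical:
  fixes f :: "real \<Rightarrow> real"
  assumes [measurable]: "f \<in> borel_measurable borel"
  shows "(\<integral>t. f t \<partial>distr (uniform_count_measure {..<length l}) borel (\<lambda>i. l ! i)) = (\<Sum>x\<leftarrow>l. f x) / length l"
proof -
  have m: "(\<lambda>i. l ! i) \<in> measurable (uniform_count_measure {..<length l}) borel"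
    by (simp add: measurable_def sets_uniform_count_measure space_uniform_count_measure)
  have "(\<integral>t. f t \<partial>distr (uniform_count_measure {..<length l}) borel (\<lambda>i. l ! i)) = (\<Sum>i<length l. f (l ! i)) / length l"
    by (subst integral_distr[OF m]) (simp_all add: integral_uniform_count_measure)
  also have "(\<Sum>i<length l. f (l ! i)) = (\<Sum>x\<leftarrow>l. f x)"
    by (simp add: sum_list_sum_nth lessThan_atLeast0)
  finally show ?thesis .
qed

lemma real_distribution_empirical:
  assumes "l \<noteq> []"
  shows "real_distribution (distr (uniform_count_measure {..<length l}) borel (\<lambda>i. l ! i :: real))"
proof -
  have m: "(\<lambda>i. l ! i) \<in> measurable (uniform_count_measure {..<length l}) borel"
    by (simp add: measurable_def sets_uniform_count_measure space_uniform_count_measure)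
  have "prob_space (uniform_count_measure {..<length l})"
    using assms by (intro prob_space_uniform_count_measure) auto
  from prob_space.real_distribution_distr[OF this m] show ?thesis .
qed

text \<open>Lengths start at one, by a shift of the index, so that each list has a head and each
  empirical measure is a probability measure.\<close>

context
  fixes l :: "nat \<Rightarrow> real list" and \<mu> :: "real measure" and b :: real
  assumes len: "\<And>n. length (l n) = Suc n"
    and range: "\<And>n x. x \<in> set (l n) \<Longrightarrow> 0 \<le> x \<and> x \<le> hd (l n)"
    and edge: "(\<lambda>n. hd (l n)) \<longlonglongrightarrow> b"
    and \<mu>: "real_distribution \<mu>"
    and weak: "weak_conv_m (\<lambda>n. distr (uniform_count_measure {..<length (l n)}) borel (\<lambda>i. l n ! i)) \<mu>"
begin

lemma empirical_mean_tendsto: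
  fixes f :: "real \<Rightarrow> real"
  assumes f: "continuous_on UNIV f" and bdd: "\<And>x. \<bar>f x\<bar> \<le> B"
  shows "(\<lambda>n. (\<Sum>x\<leftarrow>l n. f x) / Suc n) \<longlonglongrightarrow> (\<integral>t. f t \<partial>\<mu>)"
proof -
  have ne: "l n \<noteq> []" for n using len[of n] by auto
  have "isCont f x" for x using f by (simp add: continuous_on_eq_continuous_at)
  from weak_conv_imp_integral_bdd_continuous_conv[OF real_distribution_empirical[OF ne] \<mu> weak this, of B]
  have "(\<lambda>n. \<integral>t. f t \<partial>distr (uniform_count_measure {..<length (l n)}) borel (\<lambda>i. l n ! i)) \<longlonglongrightarrow> (\<integral>t. f t \<partial>\<mu>)"
    using bdd by simp
  moreover have "(\<lambda>n. \<integral>t. f t \<partial>distr (uniform_count_measure {..<length (l n)}) borel (\<lambda>i. l n ! i))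
    = (\<lambda>n. (\<Sum>x\<leftarrow>l n. f x) / Suc n)"
    by (rule ext, subst integral_empirical) (simp_all only: borel_measurable_continuous_onI[OF f] len)
  ultimately show ?thesis by (simp only:)
qed

lemma edge_nonneg: "0 \<le> b"
proof (rule LIMSEQ_le_const[OF edge], intro exI allI impI)
  fix n have "l n \<noteq> []" using len[of n] by auto
  thus "0 \<le> hd (l n)" using range[of "hd (l n)" n] by simp
qed

text \<open>A bounded continuous nonnegative function that eventually vanishes at all sample points
  has integral zero in the limit, so it vanishes almost everywhere.\<close>

lemma AE_le_zero_of_integral:
  fixes f :: "real \<Rightarrow> real"
  assumes f: "continuous_on UNIV f" "\<And>x. 0 \<le> f x" "\<And>x. f x \<le> 1"
    and zero: "\<forall>\<^sub>F n in sequentially. \<forall>x\<in>set (l n). f x = 0"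
  shows "AE t in \<mu>. f t = 0"
proof -
  interpret real_distribution \<mu> by (rule \<mu>)
  have [measurable]: "f \<in> borel_measurable borel" using f(1) by (rule borel_measurable_continuous_onI)
  have "(\<lambda>n. (\<Sum>x\<leftarrow>l n. f x) / Suc n) \<longlonglongrightarrow> (\<integral>t. f t \<partial>\<mu>)"
    using f by (intro empirical_mean_tendsto[where B=1]) auto
  moreover have "(\<lambda>n. (\<Sum>x\<leftarrow>l n. f x) / Suc n) \<longlonglongrightarrow> 0"
    by (rule tendsto_eventually, rule eventually_mono[OF zero]) (simp add: sum_list_0 cong: map_cong)
  ultimately have "(\<integral>t. f t \<partial>\<mu>) = 0" using LIMSEQ_unique by blast
  moreover have "integrable \<mu> f" using f by (intro integrable_const_bound[where B=1]) auto
  ultimately show ?thesis using integral_nonneg_eq_0_iff_AE[of \<mu> f] f by auto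
qed

text \<open>Tested with the clipped negative part, and with the clipped excess over b + 1/(k+1) for
  every k.\<close>

lemma edge_distribution: "edge_distribution \<mu> b"
proof -
  interpret real_distribution \<mu> by (rule \<mu>)
  have "AE t in \<mu>. min 1 (max 0 (- t)) = 0"
    using range by (intro AE_le_zero_of_integral) (auto intro!: continuous_intros always_eventually)
  hence 1: "AE t in \<mu>. 0 \<le> t" by (rule eventually_mono) (simp add: min_def max_def split: if_splits)
  have "AE t in \<mu>. t \<le> b + 1 / Suc k" for k
  proof -
    have "\<forall>\<^sub>F n in sequentially. hd (l n) < b + 1 / Suc k" by (rule order_tendstoD[OF edge]) simp
    hence "\<forall>\<^sub>F n in sequentially. \<forall>x\<in>set (l n). min 1 (max 0 (x - (b + 1 / Suc k))) = 0"
    proof (rule eventually_mono)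
      fix n assume "hd (l n) < b + 1 / Suc k"
      hence "x - (b + 1 / Suc k) \<le> 0" if "x \<in> set (l n)" for x using range[OF that] by linarith
      thus "\<forall>x\<in>set (l n). min 1 (max 0 (x - (b + 1 / Suc k))) = 0" by (simp add: max_absorb1)
    qed
    hence "AE t in \<mu>. min 1 (max 0 (t - (b + 1 / Suc k))) = 0"
      by (intro AE_le_zero_of_integral) (auto intro!: continuous_intros)
    thus ?thesis by (rule eventually_mono) (simp add: min_def max_def split: if_splits)
  qed
  hence "AE t in \<mu>. \<forall>k. t \<le> b + 1 / Suc k" by (simp add: AE_all_countable)
  hence 2: "AE t in \<mu>. t \<le> b"
  proof (rule eventually_mono)
    fix t assume t: "\<forall>k. t \<le> b + 1 / Suc k"
    have "(\<lambda>k. b + 1 / Suc k) \<longlonglongrightarrow> b + 0"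
      by (intro tendsto_intros LIMSEQ_Suc[OF lim_1_over_n])
    thus "t \<le> b" using t by (intro LIMSEQ_le_const[where X="\<lambda>k. b + 1 / Suc k"]) auto
  qed
  show ?thesis
    using 1 2 edge_nonneg by unfold_locales auto
qed

text \<open>The kernel is unbounded, so its argument is clamped to [0, r] with r between b and z.
  This changes neither the limit integral nor, once the largest singular value is below r, the
  empirical sums.\<close>

lemma empirical_phi_tendsto:
  assumes z: "b < z"
  shows "(\<lambda>n. (\<Sum>x\<leftarrow>l n. z / (z\<^sup>2 - x\<^sup>2)) / Suc n) \<longlonglongrightarrow> phi \<mu> z"
proof -
  interpret edge_distribution \<mu> b by (rule edge_distribution)
  define r where "r = (b + z) / 2"
  have r: "b < r" "r < z" "0 \<le> r" using z b_nonneg by (auto simp: r_def)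
  define h where "h t = z / (z\<^sup>2 - (max 0 (min t r))\<^sup>2)" for t
  have pos: "z\<^sup>2 - r\<^sup>2 \<le> z\<^sup>2 - (max 0 (min t r))\<^sup>2 \<and> 0 < z\<^sup>2 - r\<^sup>2" for t
    using power_strict_mono[of r z 2] power_mono[of "max 0 (min t r)" r 2] r by auto
  have eq: "h t = z / (z\<^sup>2 - t\<^sup>2)" if "0 \<le> t" "t \<le> r" for t using that by (simp add: h_def)
  have "(\<lambda>n. (\<Sum>x\<leftarrow>l n. h x) / Suc n) \<longlonglongrightarrow> (\<integral>t. h t \<partial>\<mu>)"
  proof (rule empirical_mean_tendsto[where B="z / (z\<^sup>2 - r\<^sup>2)"])
    have "z\<^sup>2 - (max 0 (min t r))\<^sup>2 \<noteq> 0" for t using pos[of t] by linarith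
    thus "continuous_on UNIV h" unfolding h_def by (intro continuous_intros) auto
    show "\<bar>h t\<bar> \<le> z / (z\<^sup>2 - r\<^sup>2)" for t
    proof -
      have "0 < z" using z b_nonneg by linarith
      thus ?thesis unfolding h_def using pos[of t] by (auto intro!: divide_left_mono mult_pos_pos)
    qed
  qed
  moreover have "(\<integral>t. h t \<partial>\<mu>) = phi \<mu> z"
    unfolding phi_def
  proof (rule integral_cong_AE)
    show "h \<in> borel_measurable \<mu>" unfolding h_def by measurable
    show "AE t in \<mu>. h t = z / (z\<^sup>2 - t\<^sup>2)" using eq r by (intro AE_edgeI) auto
  qed measurable
  moreover have "\<forall>\<^sub>F n in sequentially. (\<Sum>x\<leftarrow>l n. h x) / Suc n = (\<Sum>x\<leftarrow>l n. z / (z\<^sup>2 - x\<^sup>2)) / Suc n"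
    using order_tendstoD(2)[OF edge r(1)]
  proof (rule eventually_mono)
    fix n assume "hd (l n) < r"
    hence "h x = z / (z\<^sup>2 - x\<^sup>2)" if "x \<in> set (l n)" for x
      using range[OF that] by (intro eq) auto
    thus "(\<Sum>x\<leftarrow>l n. h x) / Suc n = (\<Sum>x\<leftarrow>l n. z / (z\<^sup>2 - x\<^sup>2)) / Suc n"
      by (simp cong: map_cong)
  qed
  ultimately show ?thesis using Lim_transform_eventually by fastforce
qed

end

section \<open>Embedding the scalars into the complex numbers\<close>

lemma conjugate_diff: "conjugate (x - y) = conjugate x - conjugate y" for x y :: "'a::conjugatable_ring"
  using conjugate_dist_add[of x "- y"] by (simp add: conjugate_neg)

lemma conjugate_of_real [simp]: "conjugate (of_real r :: 'a::real_or_complex) = of_real r"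
proof (cases "r = 0")
  case False
  have "of_real r * conjugate (of_real r :: 'a) = of_real r * of_real r"
    using mult_conjugate[of "of_real r :: 'a"] by (simp add: power2_eq_square scaleR_conv_of_real)
  thus ?thesis using False by simp
qed simp

text \<open>Polarization: expand (x + 1) times its conjugate, which is |x + 1|^2, and compare with
  the inner product.\<close>

lemma add_conjugate: "x + conjugate x = of_real (2 * inner x 1)" for x :: "'a::real_or_complex"
proof -
  have "conjugate (x + 1) = conjugate x + 1"
    using conjugate_of_real[of 1, where 'a='a] by (simp add: conjugate_dist_add)
  hence "(x + 1) * (conjugate x + 1) = (norm (x + 1))\<^sup>2 *\<^sub>R 1" using mult_conjugate[of "x + 1"] by simp
  hence "x * conjugate x + (x + conjugate x) + 1 = of_real ((norm (x + 1))\<^sup>2)"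
    by (simp add: scaleR_conv_of_real algebra_simps)
  hence "x + conjugate x = of_real ((norm (x + 1))\<^sup>2 - (norm x)\<^sup>2 - 1)"
    by (simp add: mult_conjugate scaleR_conv_of_real algebra_simps)
  also have "(norm (x + 1))\<^sup>2 - (norm x)\<^sup>2 - 1 = 2 * inner x 1"
  proof -
    have "inner (1::'a) 1 = 1" by (simp add: power2_norm_eq_inner[symmetric])
    thus ?thesis by (simp add: power2_norm_eq_inner inner_add_left inner_add_right inner_commute)
  qed
  finally show ?thesis .
qed

lemma self_conjugate_real: "conjugate q = q \<Longrightarrow> q = of_real (inner q 1)" for q :: "'a::real_or_complex"
proof -
  assume "conjugate q = q"
  hence "2 * q = 2 * of_real (inner q 1)" using add_conjugate[of q] by simp
  thus ?thesis by simp
qed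

lemma imaginary_part: "conjugate (x - of_real (inner x 1)) = - (x - of_real (inner x 1))" for x :: "'a::real_or_complex"
  using add_conjugate[of x] by (simp add: conjugate_diff algebra_simps)

definition complex_embedding :: "('a::real_or_complex \<Rightarrow> complex) \<Rightarrow> bool" where
  "complex_embedding h \<longleftrightarrow> (\<forall>x y. h (x + y) = h x + h y) \<and> (\<forall>x y. h (x * y) = h x * h y) \<and>
    (\<forall>r. h (of_real r) = of_real r) \<and> (\<forall>x. cmod (h x) = norm x) \<and> (\<forall>x. h (conjugate x) = cnj (h x))"

text \<open>If only 0 satisfies conjugate y = - y, every scalar is real. Otherwise such a y,
  normalized, is an element j with j * j = - 1. The product of j with the imaginary part of any x is
  self-conjugate, hence real, so x = a + b j with real a and b, and this inverts the natural map
  from the complex numbers.\<close>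

lemma complex_embedding_exists: "\<exists>h :: 'a::real_or_complex \<Rightarrow> complex. complex_embedding h"
proof (cases "\<exists>y :: 'a. y \<noteq> 0 \<and> conjugate y = - y")
  case False
  have x: "x = of_real (inner x 1)" for x :: 'a
  proof -
    have "x - of_real (inner x 1) = 0" using False imaginary_part[of x] by blast
    thus ?thesis by (simp only: right_minus_eq)
  qed
  have in_of_real: "inner (of_real r :: 'a) 1 = r" for r
    using x[of "of_real r"] by (simp only: of_real_eq_iff)
  have "complex_embedding (\<lambda>x :: 'a. complex_of_real (inner x 1))"
    unfolding complex_embedding_def
  proof (intro conjI allI)
    fix x' y' :: 'a and r :: real
    have "x' * y' = of_real (inner x' 1) * of_real (inner y' 1)"
      by (rule arg_cong2[OF x x, of "(*)"])
    hence "inner (x' * y') 1 = inner x' 1 * inner y' 1"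
      by (simp only: of_real_mult[symmetric] in_of_real)
    thus "complex_of_real (inner (x' * y') 1) = complex_of_real (inner x' 1) * complex_of_real (inner y' 1)"
      by simp
    show "cmod (complex_of_real (inner x' 1)) = norm x'"
      using arg_cong[OF x[of x'], of norm] by (simp only: norm_of_real)
    have "conjugate x' = of_real (inner x' 1)"
      using arg_cong[OF x[of x'], of conjugate] by (simp only: conjugate_of_real)
    hence "inner (conjugate x') 1 = inner x' 1" by (simp only: in_of_real)
    thus "complex_of_real (inner (conjugate x') 1) = cnj (complex_of_real (inner x' 1))"
      by simp
  qed (simp_all add: inner_add_left in_of_real)
  thus ?thesis by blast
next
  case True
  then obtain y0 :: 'a where y0: "y0 \<noteq> 0" "conjugate y0 = - y0" by blast
  define j where "j = of_real (1 / norm y0) * y0"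
  have cj: "conjugate j = - j"
    unfolding j_def conjugate_dist_mul conjugate_of_real y0(2) by simp
  have "norm j = 1" using y0(1) unfolding j_def norm_mult norm_of_real by simp
  hence "j * conjugate j = 1" using mult_conjugate[of j] by simp
  hence jj: "j * j = - 1" by (simp add: cj) (metis add.inverse_inverse)
  hence j0: "j \<noteq> 0" by auto
  have ex: "\<exists>a b. x = of_real a + of_real b * j" for x :: 'a
  proof -
    define y where "y = x - of_real (inner x 1)"
    have "conjugate (- (y * j)) = - (y * j)"
      using imaginary_part[of x] by (simp add: y_def[symmetric] conjugate_dist_mul conjugate_neg cj)
    from self_conjugate_real[OF this] obtain b where b: "- (y * j) = of_real b" by blast
    have "y = - (y * j) * j" using jj by (simp add: mult.assoc)
    hence "y = of_real b * j" by (simp only: b)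
    hence "x = of_real (inner x 1) + of_real b * j" by (simp add: y_def algebra_simps)
    thus ?thesis by blast
  qed
  define f where "f c = of_real (Re c) + of_real (Im c) * j" for c
  have f_mult: "f (c * d) = f c * f d" for c d
  proof -
    have "f c * f d = of_real (Re c * Re d) + of_real (Im c * Im d) * (j * j) + of_real (Re c * Im d + Im c * Re d) * j"
      by (simp add: f_def algebra_simps)
    thus ?thesis by (simp add: jj) (simp add: f_def algebra_simps)
  qed
  have f_add: "f (c + d) = f c + f d" for c d by (simp add: f_def algebra_simps)
  have f_cnj: "f (cnj c) = conjugate (f c)" for c
    by (simp add: f_def conjugate_dist_add conjugate_dist_mul cj)
  have f_real: "f (of_real r) = of_real r" for r by (simp add: f_def)
  have f_norm: "norm (f c) = cmod c" for c
  proof -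
    have "of_real ((norm (f c))\<^sup>2) = f c * conjugate (f c)"
      by (simp add: mult_conjugate scaleR_conv_of_real)
    also have "\<dots> = f (c * cnj c)" by (simp add: f_cnj f_mult)
    also have "\<dots> = of_real ((cmod c)\<^sup>2)" by (simp only: complex_norm_square[symmetric] f_real)
    finally have "(norm (f c))\<^sup>2 = (cmod c)\<^sup>2" by (simp only: of_real_eq_iff)
    thus ?thesis by (simp add: power2_eq_iff_nonneg)
  qed
  have "inj f"
  proof (rule injI)
    fix c d assume "f c = f d"
    hence "f (c - d) = 0" using f_add[of "c - d" d] by simp
    thus "c = d" using f_norm[of "c - d"] by simp
  qed
  moreover have "surj f"
    unfolding surj_def
  proof
    fix x
    obtain a b where "x = of_real a + of_real b * j" using ex by blast
    hence "f (Complex a b) = x" by (simp add: f_def)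
    thus "\<exists>c. x = f c" by blast
  qed
  ultimately obtain g where inv: "g (f c) = c" "f (g x) = x" for c x
    using surj_f_inv_f inv_f_f by metis
  have "complex_embedding g"
    unfolding complex_embedding_def
  proof (intro conjI allI)
    fix x y :: 'a and r :: real
    show "g (x + y) = g x + g y" using f_add[of "g x" "g y"] by (simp only: inv) (metis inv(1))
    show "g (x * y) = g x * g y" using f_mult[of "g x" "g y"] by (simp only: inv) (metis inv(1))
    show "g (of_real r) = of_real r" using f_real[of r] by (metis inv(1))
    show "cmod (g x) = norm x" using f_norm[of "g x"] by (simp only: inv)
    show "g (conjugate x) = cnj (g x)" using f_cnj[of "g x"] by (simp only: inv) (metis inv(1))
  qed
  thus ?thesis by blast
qed

text \<open>Over the complex field there are two embeddings, exchanged by conjugation; one is fixed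
  by choice and used only through the properties in \<open>complex_embedding\<close>.\<close>

definition cemb :: "'a::real_or_complex \<Rightarrow> complex" where "cemb = (SOME h. complex_embedding h)"

lemma complex_embedding_cemb: "complex_embedding cemb"
  unfolding cemb_def using complex_embedding_exists by (rule someI_ex)

lemma cemb_simps [simp]:
  fixes x y :: "'a::real_or_complex"
  shows "cemb (x + y) = cemb x + cemb y" "cemb (x * y) = cemb x * cemb y"
    "cemb (of_real r :: 'a) = of_real r" "cmod (cemb x) = norm x" "cemb (conjugate x) = cnj (cemb x)"
    "cemb (0 :: 'a) = 0" "cemb (1 :: 'a) = 1" "cemb (- x) = - cemb x" "cemb (x - y) = cemb x - cemb y"
proof -
  note E = complex_embedding_cemb[unfolded complex_embedding_def]
  show 1: "cemb (x + y) = cemb x + cemb y" for x y :: 'a using E by blast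
  show "cemb (x * y) = cemb x * cemb y" "cmod (cemb x) = norm x" "cemb (conjugate x) = cnj (cemb x)"
    using E by blast+
  show 2: "cemb (of_real r :: 'a) = of_real r" for r using E by blast
  show 3: "cemb (0 :: 'a) = 0" "cemb (1 :: 'a) = 1" using 2[of 0] 2[of 1] by simp_all
  show "cemb (- x) = - cemb x" using 1[of x "- x"] 3 by (simp add: eq_neg_iff_add_eq_0 add.commute)
  show "cemb (x - y) = cemb x - cemb y" using 1[of "x - y" y] by simp
qed

lemma cemb_inject [simp]: "cemb x = cemb y \<longleftrightarrow> x = y"
proof
  assume "cemb x = cemb y"
  hence "cmod (cemb (x - y)) = 0" by (simp del: cemb_simps(4))
  hence "norm (x - y) = 0" by (simp only: cemb_simps(4))
  thus "x = y" by simp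
qed simp

lemma cemb_sum: "cemb (sum f A) = (\<Sum>i\<in>A. cemb (f i))"
  by (induction A rule: infinite_finite_induct) simp_all

lemma bounded_linear_cemb: "bounded_linear (cemb :: 'a::real_or_complex \<Rightarrow> complex)"
  by (rule bounded_linear_intro[where K=1]) (simp_all add: scaleR_conv_of_real)

interpretation cemb: inj_comm_ring_hom "cemb :: 'a::real_or_complex \<Rightarrow> complex"
proof unfold_locales
  show "x = 0" if "cemb x = 0" for x :: 'a using that cemb_inject[of x 0] by simp
qed simp_all

lemma map_mat_cemb_adjoint: "map_mat cemb (mat_adjoint A) = mat_adjoint (map_mat cemb A)"
  by (rule eq_matI) (simp_all)

text \<open>An injective ring homomorphism preserves and reflects the polynomial identity, so both
  definite descriptions have the same body. Existence of singular values over the original field is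
  thereby inherited from the complex case.\<close>

lemma singular_values_map_cemb:
  fixes A :: "'a::real_or_complex mat"
  assumes A: "A \<in> carrier_mat n m"
  shows "singular_values (map_mat cemb A) = singular_values A"
proof -
  interpret mp: map_poly_inj_comm_ring_hom "cemb :: 'a \<Rightarrow> complex" ..
  let ?B = "A * mat_adjoint A"
  have B: "?B \<in> carrier_mat n n" using A by auto
  have "map_mat cemb ?B = map_mat cemb A * mat_adjoint (map_mat cemb A)"
    using A by (subst cemb.mat_hom_mult[of _ n m _ n]) (auto simp: map_mat_cemb_adjoint)
  hence 1: "char_poly (map_mat cemb A * mat_adjoint (map_mat cemb A)) = map_poly cemb (char_poly ?B)"
    using cemb.char_poly_hom[OF B] by simp
  have 2: "map_poly cemb (\<Prod>x\<leftarrow>s. [:- (of_real (x\<^sup>2) :: 'a), 1:]) = (\<Prod>x\<leftarrow>s. [:- of_real (x\<^sup>2), 1:])" for s :: "real list"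
    by (induction s) (simp_all add: mp.hom_mult del: mult_pCons_left mult_pCons_right of_real_power)
  have "(char_poly ?B = (\<Prod>x\<leftarrow>s. [:- of_real (x\<^sup>2), 1:])) \<longleftrightarrow>
     (char_poly (map_mat cemb A * mat_adjoint (map_mat cemb A)) = (\<Prod>x\<leftarrow>s. [:- of_real (x\<^sup>2), 1:]))" for s
    unfolding 1 2[symmetric] by (simp only: mp.eq_iff)
  thus ?thesis unfolding singular_values_def by simp
qed

text \<open>The two singular vector equations form one eigenvalue equation for the dilation of
  \<open>Xt\<close>. The condition \<open>top\<close> is \<open>dilation_form_le\<close> for
  \<open>Xt\<close>, whose form differs from that of \<open>X\<close> by the two conjugate cross
  terms.\<close>

lemma spiked_resolvent_singular_vectors:
  assumes X: "X \<in> carrier_mat n m" and n: "0 < n" and z: "hd (singular_values X) < z" and t: "0 < t"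
    and Xt: "Xt \<in> carrier_mat n m" "\<And>i j. i < n \<Longrightarrow> j < m \<Longrightarrow> Xt $$ (i, j) = X $$ (i, j) + of_real t * a i * cnj (b j)"
    and left: "\<And>i. i < n \<Longrightarrow> (\<Sum>j<m. Xt $$ (i, j) * y j) = of_real (hd (singular_values Xt)) * x i"
    and right: "\<And>j. j < m \<Longrightarrow> (\<Sum>i<n. cnj (Xt $$ (i, j)) * x i) = of_real (hd (singular_values Xt)) * y j"
  shows "spiked_resolvent (idx n m) (dilation X) (hd (singular_values X)) z (dilation_resolvent z X)
    (case_sum a (\<lambda>_. 0)) (case_sum (\<lambda>_. 0) b) (case_sum x y) t (hd (singular_values Xt))"
proof -
  interpret R: resolvent "idx n m" "dilation X" "hd (singular_values X)" z "dilation_resolvent z X"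
    by (rule resolvent_dilation[OF X n z])
  let ?a = "case_sum a (\<lambda>_. 0)" and ?b = "case_sum (\<lambda>_. 0) b" and ?w = "case_sum x y"
  have ips: "ip (idx n m) ?a w = (\<Sum>i<n. cnj (a i) * w (Inl i))" "ip (idx n m) ?b w = (\<Sum>j<m. cnj (b j) * w (Inr j))"
    "ip (idx n m) w ?a = (\<Sum>i<n. cnj (w (Inl i)) * a i)" for w
    by (simp_all add: ip_def sum_idx)
  show ?thesis
  proof
    show "0 < t" by (rule t)
    fix p assume p: "p \<in> idx n m"
    show "of_real (hd (singular_values Xt)) * ?w p = mv (idx n m) (dilation X) ?w p
      + of_real t * (?a p * ip (idx n m) ?b ?w + ?b p * ip (idx n m) ?a ?w)"
    proof (cases p)
      case (Inl i)
      thus ?thesis using p left[of i, symmetric]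
        by (simp add: mv_dilation ips Xt(2) distrib_right distrib_left sum.distrib sum_distrib_left mult_ac)
    next
      case (Inr j)
      thus ?thesis using p right[of j, symmetric]
        by (simp add: mv_dilation ips Xt(2) distrib_right distrib_left sum.distrib sum_distrib_left mult_ac)
    qed
  next
    fix w
    have "(\<Sum>j<m. cnj (\<Sum>i<n. cnj (Xt $$ (i, j)) * w (Inl i)) * w (Inr j))
      = (\<Sum>j<m. (cnj (\<Sum>i<n. cnj (X $$ (i, j)) * w (Inl i)) + of_real t * (cnj (b j) * (\<Sum>i<n. cnj (w (Inl i)) * a i))) * w (Inr j))"
    proof (intro sum.cong refl)
      fix j assume "j \<in> {..<m}"
      hence e: "(\<Sum>i<n. cnj (Xt $$ (i, j)) * w (Inl i)) =
          (\<Sum>i<n. cnj (X $$ (i, j)) * w (Inl i)) + of_real t * (b j * (\<Sum>i<n. cnj (a i) * w (Inl i)))"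
        by (simp add: Xt(2) distrib_right distrib_left sum.distrib sum_distrib_left mult_ac)
      show "cnj (\<Sum>i<n. cnj (Xt $$ (i, j)) * w (Inl i)) * w (Inr j) =
          (cnj (\<Sum>i<n. cnj (X $$ (i, j)) * w (Inl i)) + of_real t * (cnj (b j) * (\<Sum>i<n. cnj (w (Inl i)) * a i))) * w (Inr j)"
        unfolding e by (simp add: mult.commute)
    qed
    also have "\<dots> = (\<Sum>j<m. cnj (\<Sum>i<n. cnj (X $$ (i, j)) * w (Inl i)) * w (Inr j))
       + of_real t * (ip (idx n m) w ?a * ip (idx n m) ?b w)"
      by (simp add: ips distrib_right distrib_left sum.distrib sum_distrib_left mult_ac)
    finally have "Re (ip (idx n m) w (mv (idx n m) (dilation Xt) w)) =
      Re (ip (idx n m) w (mv (idx n m) (dilation X) w)) + 2 * t * Re (ip (idx n m) w ?a * ip (idx n m) ?b w)"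
      unfolding dilation_form Re_complex_of_real by simp
    thus "Re (ip (idx n m) w (mv (idx n m) (dilation X) w)) + 2 * t * Re (ip (idx n m) w ?a * ip (idx n m) ?b w)
      \<le> hd (singular_values Xt) * (nrm (idx n m) w)\<^sup>2"
      using dilation_form_le[OF Xt(1) n, of w] by simp
  qed
qed

text \<open>Column q is the resolvent applied to a unit vector, so the operator norm bound controls
  each column separately.\<close>

lemma hs_dilation_resolvent:
  assumes "X \<in> carrier_mat n m" "0 < n" "hd (singular_values X) < z" "q \<in> idx n m"
  shows "(\<Sum>p\<in>idx n m. (cmod (dilation_resolvent z X p q))\<^sup>2) \<le> 1 / (z - hd (singular_values X))\<^sup>2"
proof -
  interpret R: resolvent "idx n m" "dilation X" "hd (singular_values X)" z "dilation_resolvent z X"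
    by (rule resolvent_dilation[OF assms(1-3)])
  define d where "d r = (if r = q then 1 else (0::complex))" for r
  have "R.K d p = dilation_resolvent z X p q" for p
    using assms(4) by (simp add: mv_def d_def if_distrib cong: if_cong)
  moreover have "(nrm (idx n m) d)\<^sup>2 = 1"
    using assms(4) by (simp add: nrm_sq d_def if_distrib[of cmod] if_distrib[of "\<lambda>x. x\<^sup>2"] cong: if_cong)
  ultimately show ?thesis using R.nrm_res_sq[of d] by (simp add: nrm_sq)
qed

section \<open>Almost sure convergence\<close>

lemma vnorm_nonneg: "0 \<le> vnorm x"
  by (simp add: vnorm_def sum_nonneg)

lemma vnorm_smult: "vnorm (k \<cdot>\<^sub>v x) = norm k * vnorm x"
  by (simp add: vnorm_def norm_mult power_mult_distrib sum_distrib_left[symmetric] real_sqrt_mult)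

lemma sum_conjugate_self: "w \<in> carrier_vec n \<Longrightarrow> (\<Sum>i<n. conjugate (w $ i) * w $ i) = of_real ((vnorm w)\<^sup>2)"
  for w :: "'a::real_or_complex vec"
proof -
  assume w: "w \<in> carrier_vec n"
  have "conjugate x * x = of_real ((norm x)\<^sup>2)" for x :: 'a
    using mult_conjugate[of x] by (simp add: scaleR_conv_of_real mult.commute)
  thus ?thesis using w by (simp add: vnorm_def sum_nonneg del: of_real_power)
qed

text \<open>The matrix is \<tau> w w*, with nonzero eigenvalue \<tau> |w|^2. The kernel is therefore
  the line through w, and the projection of x is (w, x) / |w|^2 times w.\<close>

lemma proj_norm_kernel_rank_one:
  fixes w x :: "'a::real_or_complex vec"
  assumes w: "w \<in> carrier_vec n" "vnorm w \<noteq> 0" and \<tau>: "\<tau> \<noteq> 0"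
    and A: "A \<in> carrier_mat n n" "\<And>i k. i < n \<Longrightarrow> k < n \<Longrightarrow> A $$ (i, k) = of_real \<tau> * w $ i * conjugate (w $ k)"
    and x: "x \<in> carrier_vec n" and \<theta>: "\<theta>2 = \<tau> * (vnorm w)\<^sup>2"
  shows "proj_norm x (mat_kernel (of_real \<theta>2 \<cdot>\<^sub>m 1\<^sub>m n - A)) = norm (\<Sum>i<n. conjugate (w $ i) * x $ i) / vnorm w"
proof -
  define F where "F = mat_kernel (of_real \<theta>2 \<cdot>\<^sub>m 1\<^sub>m n - A)"
  define c where "c y = (\<Sum>i<n. conjugate (w $ i) * y $ i)" for y :: "'a vec"
  define N where "N = (of_real ((vnorm w)\<^sup>2) :: 'a)"
  have N: "N \<noteq> 0" using w(2) by (simp add: N_def)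
  have cw: "c w = N" unfolding c_def N_def by (rule sum_conjugate_self[OF w(1)])
  have mulv: "((of_real \<theta>2 \<cdot>\<^sub>m 1\<^sub>m n - A) *\<^sub>v y) $ i = of_real \<tau> * (N * y $ i - c y * w $ i)"
    if "y \<in> carrier_vec n" "i < n" for y i
  proof -
    have "((of_real \<theta>2 \<cdot>\<^sub>m 1\<^sub>m n - A) *\<^sub>v y) $ i
      = (\<Sum>k<n. (of_real \<theta>2 * (if i = k then 1 else 0) - of_real \<tau> * w $ i * conjugate (w $ k)) * y $ k)"
      using that A by (simp add: scalar_prod_def lessThan_atLeast0)
    also have "\<dots> = (\<Sum>k<n. if i = k then of_real \<theta>2 * y $ k else 0) - (\<Sum>k<n. of_real \<tau> * w $ i * (conjugate (w $ k) * y $ k))"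
      unfolding sum_subtractf[symmetric] by (intro sum.cong) (auto simp: algebra_simps)
    also have "\<dots> = of_real \<theta>2 * y $ i - of_real \<tau> * w $ i * c y"
      using that(2) by (simp add: c_def sum_distrib_left)
    finally show ?thesis by (simp add: \<theta> N_def algebra_simps)
  qed
  have F_iff: "y \<in> F \<longleftrightarrow> y \<in> carrier_vec n \<and> y = (c y / N) \<cdot>\<^sub>v w" for y
  proof
    assume "y \<in> F"
    hence y: "y \<in> carrier_vec n" "(of_real \<theta>2 \<cdot>\<^sub>m 1\<^sub>m n - A) *\<^sub>v y = 0\<^sub>v n"
      using A by (auto simp: F_def mat_kernel_def)
    have "y $ i = c y / N * w $ i" if "i < n" for i
    proof -
      have "of_real \<tau> * (N * y $ i - c y * w $ i) = 0" using mulv[OF y(1) that] y(2) that by simp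
      hence "N * y $ i = c y * w $ i" using \<tau> by simp
      thus ?thesis using N by (simp add: field_simps)
    qed
    hence "y = (c y / N) \<cdot>\<^sub>v w" using y(1) w(1) by (intro eq_vecI) auto
    with y show "y \<in> carrier_vec n \<and> y = (c y / N) \<cdot>\<^sub>v w" by blast
  next
    assume y: "y \<in> carrier_vec n \<and> y = (c y / N) \<cdot>\<^sub>v w"
    have "y $ i = c y / N * w $ i" if "i < n" for i
      using arg_cong[OF conjunct2[OF y], of "\<lambda>v. v $ i"] that w(1) by simp
    hence "N * y $ i = c y * w $ i" if "i < n" for i using that N by (simp add: field_simps)
    hence "(of_real \<theta>2 \<cdot>\<^sub>m 1\<^sub>m n - A) *\<^sub>v y = 0\<^sub>v n"
      using mulv[of y] y A by (intro eq_vecI) (auto simp del: index_mult_mat_vec)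
    thus "y \<in> F" using y A by (auto simp: F_def mat_kernel_def)
  qed
  have c_smult: "c (k \<cdot>\<^sub>v w) = k * N" for k
  proof -
    have "c (k \<cdot>\<^sub>v w) = k * c w" using w(1) by (simp add: c_def sum_distrib_left mult_ac)
    thus ?thesis by (simp add: cw)
  qed
  have kw: "k \<cdot>\<^sub>v w \<in> F" for k unfolding F_iff c_smult using w(1) N by simp
  define p where "p = (c x / N) \<cdot>\<^sub>v w"
  have orth: "(x - k \<cdot>\<^sub>v w) \<bullet>c w = c x - k * N" for k
  proof -
    have "(x - k \<cdot>\<^sub>v w) \<bullet>c w = (\<Sum>i<n. (x $ i - k * w $ i) * conjugate (w $ i))"
      using x w(1) by (simp add: scalar_prod_def lessThan_atLeast0)
    also have "\<dots> = c x - k * c w"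
      by (simp add: c_def algebra_simps sum_subtractf sum_distrib_left)
    finally show ?thesis by (simp add: cw)
  qed
  have "orth_proj F x = p"
    unfolding orth_proj_def
  proof (rule the_equality)
    show "p \<in> F \<and> (\<forall>y\<in>F. (x - p) \<bullet>c y = 0)"
    proof (intro conjI ballI)
      show "p \<in> F" unfolding p_def by (rule kw)
      fix y assume "y \<in> F"
      then obtain k where k: "y = k \<cdot>\<^sub>v w" using F_iff by blast
      have "(x - p) \<bullet>c (k \<cdot>\<^sub>v w) = conjugate k * ((x - p) \<bullet>c w)"
        using x w(1) by (simp add: p_def scalar_prod_def conjugate_dist_mul sum_distrib_left mult_ac)
      thus "(x - p) \<bullet>c y = 0" using N by (simp add: k p_def orth)
    qed
  next
    fix q assume q: "q \<in> F \<and> (\<forall>y\<in>F. (x - q) \<bullet>c y = 0)"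
    then obtain k where k: "q = k \<cdot>\<^sub>v w" using F_iff by blast
    have "w \<in> F" using kw[of 1] by simp
    hence "c x - k * N = 0" using q orth[of k] k by simp
    hence "k = c x / N" using N by (simp add: field_simps)
    thus "q = p" by (simp add: k p_def)
  qed
  hence "proj_norm x F = norm (c x / N) * vnorm w"
    by (simp add: proj_norm_def p_def vnorm_smult)
  also have "\<dots> = norm (c x) / vnorm w"
  proof -
    have "norm N = (vnorm w)\<^sup>2" unfolding N_def norm_of_real by simp
    thus ?thesis using w(2) by (simp add: norm_divide power2_eq_square)
  qed
  finally show ?thesis by (simp add: F_def c_def)
qed

lemma rank_one_mat_gram:
  fixes u v :: "'a::real_or_complex vec"
  assumes u: "u \<in> carrier_vec n" and v: "v \<in> carrier_vec m" and "i < n" "k < n"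
  shows "(rank_one_mat t u v * mat_adjoint (rank_one_mat t u v)) $$ (i, k) = of_real (t\<^sup>2 * (vnorm v)\<^sup>2) * u $ i * conjugate (u $ k)"
proof -
  let ?P = "rank_one_mat t u v"
  have P: "?P \<in> carrier_mat n m" "\<And>i j. i < n \<Longrightarrow> j < m \<Longrightarrow> ?P $$ (i, j) = of_real t * u $ i * conjugate (v $ j)"
    using u v by (auto simp: rank_one_mat_def)
  have "(?P * mat_adjoint ?P) $$ (i, k) = (\<Sum>j<m. of_real (t\<^sup>2) * u $ i * conjugate (u $ k) * (conjugate (v $ j) * v $ j))"
    using P(1) assms(3,4) by (simp add: scalar_prod_def lessThan_atLeast0)
      (auto intro!: sum.cong simp: P(2) conjugate_dist_mul power2_eq_square)
  also have "\<dots> = of_real (t\<^sup>2) * u $ i * conjugate (u $ k) * of_real ((vnorm v)\<^sup>2)"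
    unfolding sum_distrib_left[symmetric] sum_conjugate_self[OF v] ..
  finally show ?thesis by (simp add: mult_ac)
qed

lemma adjoint_rank_one_mat: "mat_adjoint (rank_one_mat t u v) = rank_one_mat t v u" for u v :: "'a::real_or_complex vec"
  by (rule eq_matI) (auto simp: rank_one_mat_def conjugate_dist_mul)

lemma proj_norm_rank_one:
  fixes u v :: "'a::real_or_complex vec"
  assumes u: "u \<in> carrier_vec n" and v: "v \<in> carrier_vec m" and ne: "vnorm u \<noteq> 0" "vnorm v \<noteq> 0" "t \<noteq> 0"
    and x: "x \<in> carrier_vec n"
  shows "proj_norm x (mat_kernel (of_real ((t * vnorm u * vnorm v)\<^sup>2) \<cdot>\<^sub>m 1\<^sub>m n
      - rank_one_mat t u v * mat_adjoint (rank_one_mat t u v))) = norm (\<Sum>i<n. conjugate (u $ i) * x $ i) / vnorm u"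
proof (rule proj_norm_kernel_rank_one[OF u ne(1) _ _ rank_one_mat_gram[OF u v] x])
  show "t\<^sup>2 * (vnorm v)\<^sup>2 \<noteq> 0" using ne by simp
  show "rank_one_mat t u v * mat_adjoint (rank_one_mat t u v) \<in> carrier_mat n n"
    using u v by (auto simp: rank_one_mat_def)
qed (simp_all add: power_mult_distrib)

section \<open>Measurability of the resolvent entries\<close>

lemma borel_measurable_det:
  fixes C :: "'b \<Rightarrow> complex mat"
  assumes "\<And>y. C y \<in> carrier_mat n n" and m: "\<And>i j. i < n \<Longrightarrow> j < n \<Longrightarrow> (\<lambda>y. C y $$ (i, j)) \<in> borel_measurable S"
  shows "(\<lambda>y. det (C y)) \<in> borel_measurable S"
proof -
  have "det (C y) = (\<Sum>p\<in>{p. p permutes {0..<n}}. signof p * (\<Prod>i = 0..<n. C y $$ (i, p i)))" for y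
    by (rule det_def'[OF assms(1)])
  moreover have "(\<lambda>y. C y $$ (i, p i)) \<in> borel_measurable S" if "p permutes {0..<n}" "i \<in> {0..<n}" for p i
    using that permutes_in_image[of p "{0..<n}" i] by (intro m) auto
  ultimately show ?thesis
    by (simp only:) (intro borel_measurable_sum borel_measurable_times borel_measurable_const borel_measurable_prod; simp)
qed

lemma borel_measurable_cemb: "cemb \<in> borel_measurable borel"
  by (intro borel_measurable_continuous_onI linear_continuous_on bounded_linear_cemb)

text \<open>Independence is stated for the family of entries; rebuilding the matrix from that family
  makes its resolvent a function on a product space.\<close>

definition entry_mat :: "nat \<Rightarrow> nat \<Rightarrow> (nat \<times> nat \<Rightarrow> 'a::real_or_complex) \<Rightarrow> complex mat" where
  "entry_mat n m y = mat n m (\<lambda>p. cemb (y p))"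

lemma borel_measurable_dilation_resolvent:
  assumes pq: "p \<in> idx n m" "q \<in> idx n m"
  shows "(\<lambda>y. dilation_resolvent z (entry_mat n m y) p q)
    \<in> borel_measurable (Pi\<^sub>M ({..<n} \<times> {..<m}) (\<lambda>_. borel :: 'a::real_or_complex measure))" (is "_ \<in> borel_measurable ?S")
proof -
  let ?X = "\<lambda>y :: nat \<times> nat \<Rightarrow> 'a. entry_mat n m y"
  have dims: "dim_row (?X y) = n" "dim_col (?X y) = m" "?X y \<in> carrier_mat n m" for y
    by (simp_all add: entry_mat_def)
  have X: "(\<lambda>y. ?X y $$ (i, j)) \<in> borel_measurable ?S" if "i < n" "j < m" for i j
  proof -
    have "(\<lambda>y. cemb (y (i, j))) \<in> borel_measurable ?S"
    proof -
      have "(\<lambda>y. y (i, j)) \<in> measurable ?S borel"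
        using that by (intro measurable_component_singleton) auto
      from measurable_compose[OF this borel_measurable_cemb] show ?thesis .
    qed
    thus ?thesis using that by (simp add: entry_mat_def)
  qed
  define C where "C y = shifted_gram z (?X y)" for y
  have C_carrier: "C y \<in> carrier_mat n n" for y
    by (auto simp: C_def shifted_gram_def entry_mat_def intro!: minus_carrier_mat)
  have C: "(\<lambda>y. C y $$ (i, k)) \<in> borel_measurable ?S" if "i < n" "k < n" for i k
  proof -
    have "C y $$ (i, k) = of_real (z\<^sup>2) * (if i = k then 1 else 0) - (\<Sum>j<m. ?X y $$ (i, j) * cnj (?X y $$ (k, j)))" for y
      using that by (simp add: C_def shifted_gram_def dims scalar_prod_def lessThan_atLeast0)
    thus ?thesis using that
      by (simp only:) (intro borel_measurable_diff borel_measurable_const borel_measurable_sum borel_measurable_times borel_measurable_cnj X; simp)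
  qed
  have det: "(\<lambda>y. det (C y)) \<in> borel_measurable ?S"
    by (rule borel_measurable_det[OF C_carrier C])
  have adj: "(\<lambda>y. adj_mat (C y) $$ (i, k)) \<in> borel_measurable ?S" if ik: "i < n" "k < n" for i k
  proof -
    have "(\<lambda>y. det (mat_delete (C y) k i)) \<in> borel_measurable ?S"
    proof (rule borel_measurable_det)
      show "mat_delete (C y) k i \<in> carrier_mat (n - 1) (n - 1)" for y
        using C_carrier[of y] by (auto simp: mat_delete_def)
      fix r s assume rs: "r < n - 1" "s < n - 1"
      have "mat_delete (C y) k i $$ (r, s) = C y $$ (if r < k then r else Suc r, if s < i then s else Suc s)" for y
        using rs C_carrier[of y] by (auto simp: mat_delete_def)
      thus "(\<lambda>y. mat_delete (C y) k i $$ (r, s)) \<in> borel_measurable ?S"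
        using rs ik by (simp only:) (rule C; auto)
    qed
    moreover have "adj_mat (C y) $$ (i, k) = (- 1) ^ (k + i) * det (mat_delete (C y) k i)" for y
      using C_carrier[of y] ik by (simp add: adj_mat_def cofactor_def)
    ultimately show ?thesis by simp
  qed
  have G: "(\<lambda>y. gram_resolvent z (?X y) i k) \<in> borel_measurable ?S" if "i < n" "k < n" for i k
    unfolding gram_resolvent_def C_def[symmetric] using adj[OF that] det by (rule borel_measurable_divide)
  have sum1: "(\<lambda>y. \<Sum>k<n. gram_resolvent z (?X y) i k * ?X y $$ (k, l)) \<in> borel_measurable ?S" if "i < n" "l < m" for i l
    using that by (intro borel_measurable_sum borel_measurable_times G X) auto
  show ?thesis
  proof (cases p; cases q)
    fix i k assume "p = Inl i" "q = Inl k"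
    thus ?thesis using pq
      by (simp add: dilation_resolvent_index[OF dims(1)]) (intro borel_measurable_times borel_measurable_const G)
  next
    fix i l assume "p = Inl i" "q = Inr l"
    thus ?thesis using pq by (simp add: dilation_resolvent_index[OF dims(1)] sum1)
  next
    fix j k assume "p = Inr j" "q = Inl k"
    thus ?thesis using pq
      by (simp add: dilation_resolvent_index[OF dims(1)])
        (intro borel_measurable_sum borel_measurable_times borel_measurable_cnj X G; simp)
  next
    fix j l assume jl: "p = Inr j" "q = Inr l"
    have "(\<lambda>y. \<Sum>i<n. cnj (?X y $$ (i, j)) * (\<Sum>k<n. gram_resolvent z (?X y) i k * ?X y $$ (k, l))) \<in> borel_measurable ?S"
    proof (rule borel_measurable_sum)
      fix i assume "i \<in> {..<n}"
      thus "(\<lambda>y. cnj (?X y $$ (i, j)) * (\<Sum>k<n. gram_resolvent z (?X y) i k * ?X y $$ (k, l))) \<in> borel_measurable ?S"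
        using pq jl by (intro borel_measurable_times[OF borel_measurable_cnj[OF X] sum1]) auto
    qed
    thus ?thesis
      unfolding jl dilation_resolvent_index[OF dims(1)]
      by (rule borel_measurable_divide[OF borel_measurable_add[OF borel_measurable_const] borel_measurable_const])
  qed
qed

text \<open>\<open>True\<close> selects the row component and \<open>False\<close> the column
  component. Together with \<open>block\<close>, every form in one or both noise vectors becomes a
  quadratic form in the joint vector, so a single concentration result serves all of them.\<close>

definition part :: "bool \<Rightarrow> (nat + nat \<Rightarrow> complex) \<Rightarrow> nat + nat \<Rightarrow> complex" where
  "part s \<gamma> p = (if isl p = s then \<gamma> p else 0)"

definition block :: "bool \<Rightarrow> bool \<Rightarrow> (nat + nat \<Rightarrow> nat + nat \<Rightarrow> complex) \<Rightarrow> nat + nat \<Rightarrow> nat + nat \<Rightarrow> complex" where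
  "block s t R p q = (if isl p = s \<and> isl q = t then R p q else 0)"

lemma block_form:
  "(\<Sum>p\<in>I. \<Sum>q\<in>I. cnj (\<gamma> p) * block s t R p q * \<gamma> q) = ip I (part s \<gamma>) (mv I R (part t \<gamma>))"
  unfolding ip_def mv_def sum_distrib_left
  by (intro sum.cong refl) (simp add: block_def part_def)

lemma block_trace:
  "(\<Sum>p\<in>idx n m. block True True R p p) = (\<Sum>i<n. R (Inl i) (Inl i))"
  "(\<Sum>p\<in>idx n m. block False False R p p) = (\<Sum>j<m. R (Inr j) (Inr j))"
  "(\<Sum>p\<in>idx n m. block False True R p p) = 0"
  by (simp_all add: sum_idx block_def)

text \<open>Only columns of the second type contribute, n or m in number, each at most B.\<close>

lemma block_hs:
  assumes "\<And>q. q \<in> idx n m \<Longrightarrow> (\<Sum>p\<in>idx n m. (cmod (R p q))\<^sup>2) \<le> B"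
  shows "(\<Sum>p\<in>idx n m. \<Sum>q\<in>idx n m. (cmod (block s True R p q))\<^sup>2) \<le> real n * B"
    "(\<Sum>p\<in>idx n m. \<Sum>q\<in>idx n m. (cmod (block s False R p q))\<^sup>2) \<le> real m * B"
proof -
  have col: "(\<Sum>p\<in>idx n m. (cmod (block s t R p q))\<^sup>2) \<le> (if isl q = t then B else 0)" if "q \<in> idx n m" for q t
  proof -
    have "(\<Sum>p\<in>idx n m. (cmod (block s t R p q))\<^sup>2) \<le> (\<Sum>p\<in>idx n m. if isl q = t then (cmod (R p q))\<^sup>2 else 0)"
      by (intro sum_mono) (simp add: block_def)
    also have "\<dots> \<le> (if isl q = t then B else 0)" using assms[OF that] by simp
    finally show ?thesis .
  qed
  have "(\<Sum>p\<in>idx n m. \<Sum>q\<in>idx n m. (cmod (block s t R p q))\<^sup>2) \<le> (\<Sum>q\<in>idx n m. if isl q = t then B else 0)" for t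
    by (subst sum.swap) (intro sum_mono col)
  from this[of True] this[of False]
  show "(\<Sum>p\<in>idx n m. \<Sum>q\<in>idx n m. (cmod (block s True R p q))\<^sup>2) \<le> real n * B"
    "(\<Sum>p\<in>idx n m. \<Sum>q\<in>idx n m. (cmod (block s False R p q))\<^sup>2) \<le> real m * B"
    by (simp_all add: sum_idx)
qed

lemma tendsto_Re_of_real:
  fixes f :: "nat \<Rightarrow> complex"
  assumes "f \<longlonglongrightarrow> of_real l" shows "(\<lambda>n. Re (f n)) \<longlonglongrightarrow> l"
  using tendsto_Re[OF assms] by simp

text \<open>The statement for one fixed outcome: \<gamma>u and \<gamma>v are the raw noise vectors,
  \<tau>u and \<tau>v the scalars by which either model normalizes them, and the concentration of
  the forms is a hypothesis. Trace limits supply the values of the forms.\<close>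

theorem singular_vectors_delocalized:
  fixes X Xt :: "nat \<Rightarrow> complex mat" and m :: "nat \<Rightarrow> nat" and \<gamma>u \<gamma>v x y :: "nat \<Rightarrow> nat \<Rightarrow> complex"
    and \<tau>u \<tau>v :: "nat \<Rightarrow> real" and \<mu> :: "real measure" and b c t :: real
  defines "R \<equiv> \<lambda>k n. dilation_resolvent (b + 1 / Suc k) (X n)"
    and "\<gamma> \<equiv> \<lambda>n. case_sum (\<gamma>u n) (\<gamma>v n)"
  assumes X: "\<And>n. X n \<in> carrier_mat n (m n)" and m: "\<And>n. n \<le> m n"
    and c: "0 \<le> c" "c \<le> 1" "(\<lambda>n. real n / real (m n)) \<longlonglongrightarrow> c"
    and \<mu>: "real_distribution \<mu>"
    and weak: "weak_conv_m (\<lambda>n. empirical_sv (X n)) \<mu>"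
    and edge: "(\<lambda>n. hd (singular_values (X n))) \<longlonglongrightarrow> b"
    and t: "0 < t" "t \<le> theta_bar c \<mu> b"
    and deriv: "filterlim (deriv (phi \<mu>)) at_bot (at_right b)"
    and Xt: "\<And>n. Xt n \<in> carrier_mat n (m n)"
      "\<And>n i j. i < n \<Longrightarrow> j < m n \<Longrightarrow> Xt n $$ (i, j) = X n $$ (i, j)
        + of_real t * (of_real (\<tau>u n) * \<gamma>u n i) * cnj (of_real (\<tau>v n) * \<gamma>v n j)"
    and left: "\<And>n i. i < n \<Longrightarrow> (\<Sum>j<m n. Xt n $$ (i, j) * y n j) = of_real (hd (singular_values (Xt n))) * x n i"
    and right: "\<And>n j. 0 < n \<Longrightarrow> j < m n \<Longrightarrow> (\<Sum>i<n. cnj (Xt n $$ (i, j)) * x n i) = of_real (hd (singular_values (Xt n))) * y n j"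
    and unit: "\<And>n. 0 < n \<Longrightarrow> (\<Sum>i<n. (cmod (x n i))\<^sup>2) = 1" "\<And>n. 0 < n \<Longrightarrow> (\<Sum>j<m n. (cmod (y n j))\<^sup>2) = 1"
    and \<tau>: "(\<lambda>n. \<tau>u n * sqrt (real n)) \<longlonglongrightarrow> 1" "(\<lambda>n. \<tau>v n * sqrt (real (m n))) \<longlonglongrightarrow> 1"
    and Pform: "\<And>k. (\<lambda>n. (ip (idx n (m n)) (part True (\<gamma> n)) (mv (idx n (m n)) (R k n) (part True (\<gamma> n)))
        - (\<Sum>i<n. R k n (Inl i) (Inl i))) / of_real (real n)) \<longlonglongrightarrow> 0"
    and Qform: "\<And>k. (\<lambda>n. (ip (idx n (m n)) (part False (\<gamma> n)) (mv (idx n (m n)) (R k n) (part False (\<gamma> n)))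
        - (\<Sum>j<m n. R k n (Inr j) (Inr j))) / of_real (real (m n))) \<longlonglongrightarrow> 0"
    and Eform: "\<And>k. (\<lambda>n. ip (idx n (m n)) (part False (\<gamma> n)) (mv (idx n (m n)) (R k n) (part True (\<gamma> n)))
        / of_real (sqrt (real n * real (m n)))) \<longlonglongrightarrow> 0"
    and norms: "(\<lambda>n. (\<Sum>i<n. (cmod (\<gamma>u n i))\<^sup>2) / real n) \<longlonglongrightarrow> 1" "(\<lambda>n. (\<Sum>j<m n. (cmod (\<gamma>v n j))\<^sup>2) / real (m n)) \<longlonglongrightarrow> 1"
  shows "(\<lambda>n. \<Sum>i<n. cnj (of_real (\<tau>u n) * \<gamma>u n i) * x n i) \<longlonglongrightarrow> 0"
    "(\<lambda>n. \<Sum>j<m n. cnj (of_real (\<tau>v n) * \<gamma>v n j) * y n j) \<longlonglongrightarrow> 0"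
proof -
  let ?I = "\<lambda>n. idx n (m n)"
  define z where "z k = b + 1 / Suc k" for k
  define s where "s n = hd (singular_values (X n))" for n
  define l where "l n = singular_values (X (Suc n))" for n
  define a where "a n = case_sum (\<lambda>i. of_real (\<tau>u n) * \<gamma>u n i) (\<lambda>_ :: nat. 0)" for n
  define d where "d n = case_sum (\<lambda>_ :: nat. 0) (\<lambda>j. of_real (\<tau>v n) * \<gamma>v n j)" for n
  define w where "w n = case_sum (x n) (y n)" for n
  have R_eq: "R k n = dilation_resolvent (z k) (X n)" for k n by (simp only: R_def z_def)
  have a_part: "a n = (\<lambda>p. of_real (\<tau>u n) * part True (\<gamma> n) p)" for n
    by (rule ext) (auto simp: a_def part_def \<gamma>_def split: sum.split)
  have d_part: "d n = (\<lambda>p. of_real (\<tau>v n) * part False (\<gamma> n) p)" for n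
    by (rule ext) (auto simp: d_def part_def \<gamma>_def split: sum.split)
  have z: "b < z k" "z (Suc k) < z k" "z k \<le> b + 1" for k
    by (auto simp: z_def intro!: divide_strict_left_mono)
  have z_lim: "z \<longlonglongrightarrow> b"
  proof -
    have "(\<lambda>k. b + 1 / real (Suc k)) \<longlonglongrightarrow> b + 0"
      by (intro tendsto_intros LIMSEQ_Suc[OF lim_1_over_n])
    thus ?thesis by (simp add: z_def[abs_def])
  qed
  have len: "length (l n) = Suc n" for n
    unfolding l_def by (rule singular_values_complex(2)[OF X])
  have range: "0 \<le> u \<and> u \<le> hd (l n)" if "u \<in> set (l n)" for n u
    using hd_singular_values(2)[OF X[of "Suc n"]] singular_values_complex(1)[OF X[of "Suc n"]] that
    by (auto simp: l_def is_singular_values_def)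
  have edge': "(\<lambda>n. hd (l n)) \<longlonglongrightarrow> b" unfolding l_def by (rule LIMSEQ_Suc[OF edge])
  have weak': "weak_conv_m (\<lambda>n. distr (uniform_count_measure {..<length (l n)}) borel (\<lambda>i. l n ! i)) \<mu>"
    using weak unfolding weak_conv_m_def weak_conv_def empirical_sv_def l_def
    by (auto intro: LIMSEQ_Suc)
  interpret E: edge_distribution \<mu> b by (rule edge_distribution[OF len range edge' \<mu> weak'])
  obtain F where F: "\<And>z. b < z \<Longrightarrow> t\<^sup>2 * (phi \<mu> z * E.psi c z) < 1" "\<And>z. b < z \<Longrightarrow> z \<le> b + 1 \<Longrightarrow> phi \<mu> z \<le> F"
    using E.subcritical[OF c(1,2) t] by blast
  have ev_s: "\<forall>\<^sub>F n in sequentially. s n < z k" for k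
    unfolding s_def using order_tendstoD(2)[OF edge z(1)] .
  have m_pos: "0 < m n" if "0 < n" for n using m[of n] that by linarith

  have spiked: "\<forall>\<^sub>F n in sequentially.
      spiked_resolvent (?I n) (dilation (X n)) (s n) (z k) (R k n) (a n) (d n) (w n) t (hd (singular_values (Xt n)))" for k
    using ev_s[of k] eventually_gt_at_top[of 0]
  proof eventually_elim
    case (elim n)
    show ?case
      unfolding s_def R_eq a_def d_def w_def
      by (rule spiked_resolvent_singular_vectors[OF X elim(2) elim(1)[unfolded s_def] t(1) Xt(1)])
        (use Xt(2) left right elim(2) in auto)
  qed

  have trace1: "(\<lambda>n. (\<Sum>i<n. R k n (Inl i) (Inl i)) / of_real (real n)) \<longlonglongrightarrow> of_real (phi \<mu> (z k))" for k
  proof -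
    define S where "S n = (\<Sum>u\<leftarrow>singular_values (X n). z k / ((z k)\<^sup>2 - u\<^sup>2)) / real n" for n
    have "S \<longlonglongrightarrow> phi \<mu> (z k)"
      by (rule LIMSEQ_imp_Suc)
        (use empirical_phi_tendsto[OF len range edge' \<mu> weak' z(1)] in \<open>simp add: S_def l_def\<close>)
    hence "(\<lambda>n. complex_of_real (S n)) \<longlonglongrightarrow> of_real (phi \<mu> (z k))" by (rule tendsto_of_real)
    moreover have "\<forall>\<^sub>F n in sequentially. complex_of_real (S n) = (\<Sum>i<n. R k n (Inl i) (Inl i)) / of_real (real n)"
      using ev_s[of k] eventually_gt_at_top[of 0]
    proof eventually_elim
      case (elim n)
      have "(\<Sum>i<n. R k n (Inl i) (Inl i)) = of_real (z k * (\<Sum>u\<leftarrow>singular_values (X n). 1 / ((z k)\<^sup>2 - u\<^sup>2)))"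
        using trace_dilation_resolvent(1)[OF X elim(2) elim(1)[unfolded s_def]]
          trace_gram_resolvent[OF X elim(2) elim(1)[unfolded s_def]]
        by (simp add: R_eq)
      thus ?case by (simp add: S_def sum_list_const_mult[symmetric])
    qed
    ultimately show ?thesis by (rule Lim_transform_eventually)
  qed

  have trace2: "(\<lambda>n. (\<Sum>j<m n. R k n (Inr j) (Inr j)) / of_real (real (m n))) \<longlonglongrightarrow> of_real (E.psi c (z k))" for k
  proof -
    have "(\<lambda>n. of_real (real n / real (m n)) * ((\<Sum>i<n. R k n (Inl i) (Inl i)) / of_real (real n))
        + of_real ((1 - real n / real (m n)) / z k)) \<longlonglongrightarrow> of_real c * of_real (phi \<mu> (z k)) + complex_of_real ((1 - c) / z k)"
      using z(1)[of k] E.b_nonneg by (intro tendsto_intros trace1 c(3)) auto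
    moreover have "\<forall>\<^sub>F n in sequentially. of_real (real n / real (m n)) * ((\<Sum>i<n. R k n (Inl i) (Inl i)) / of_real (real n))
        + of_real ((1 - real n / real (m n)) / z k) = (\<Sum>j<m n. R k n (Inr j) (Inr j)) / of_real (real (m n))"
      using ev_s[of k] eventually_gt_at_top[of 0]
    proof eventually_elim
      case (elim n)
      have "(\<Sum>j<m n. R k n (Inr j) (Inr j)) = (\<Sum>i<n. R k n (Inl i) (Inl i)) + (of_nat (m n) - of_nat n) / of_real (z k)"
        using trace_dilation_resolvent[OF X elim(2) elim(1)[unfolded s_def]]
        by (simp add: R_eq)
      thus ?case using elim(2) m_pos[OF elim(2)] by (simp add: add_divide_distrib diff_divide_distrib)
    qed
    ultimately have "(\<lambda>n. (\<Sum>j<m n. R k n (Inr j) (Inr j)) / of_real (real (m n))) \<longlonglongrightarrow>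
        of_real c * of_real (phi \<mu> (z k)) + complex_of_real ((1 - c) / z k)"
      by (rule Lim_transform_eventually)
    thus ?thesis by (simp add: E.psi_def)
  qed

  have scale: "(\<lambda>n. complex_of_real ((\<tau> n * sqrt (real (N n)))\<^sup>2) * ((f n - T n) / of_real (real (N n)) + T n / of_real (real (N n)))) \<longlonglongrightarrow> L"
    if "(\<lambda>n. \<tau> n * sqrt (real (N n))) \<longlonglongrightarrow> 1" "(\<lambda>n. (f n - T n) / of_real (real (N n))) \<longlonglongrightarrow> 0"
      "(\<lambda>n. T n / of_real (real (N n))) \<longlonglongrightarrow> L" for \<tau> N f T L
  proof -
    have "(\<lambda>n. complex_of_real ((\<tau> n * sqrt (real (N n)))\<^sup>2) * ((f n - T n) / of_real (real (N n)) + T n / of_real (real (N n))))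
       \<longlonglongrightarrow> complex_of_real (1\<^sup>2) * (0 + L)"
      by (intro tendsto_intros that)
    thus ?thesis by simp
  qed
  have cancel: "complex_of_real ((\<tau> * sqrt N)\<^sup>2) * ((f - T) / of_real N + T / of_real N) = of_real \<tau> * (of_real \<tau> * f)"
    if "0 < N" for \<tau> N f T
    using that by (simp add: power_mult_distrib diff_divide_distrib) (simp add: power2_eq_square)

  have mv_scale: "mv J A (\<lambda>p. k * g p) = (\<lambda>i. k * mv J A g i)" for J :: "(nat + nat) set" and A k g
    by (rule ext) (rule mv_linear)

  have p: "(\<lambda>n. ip (?I n) (a n) (mv (?I n) (R k n) (a n))) \<longlonglongrightarrow> of_real (phi \<mu> (z k))" for k
  proof (rule Lim_transform_eventually[OF scale[OF \<tau>(1) Pform[of k] trace1[of k]]])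
    show "\<forall>\<^sub>F n in sequentially. complex_of_real ((\<tau>u n * sqrt (real n))\<^sup>2) *
      ((ip (?I n) (part True (\<gamma> n)) (mv (?I n) (R k n) (part True (\<gamma> n))) - (\<Sum>i<n. R k n (Inl i) (Inl i))) / of_real (real n)
        + (\<Sum>i<n. R k n (Inl i) (Inl i)) / of_real (real n)) = ip (?I n) (a n) (mv (?I n) (R k n) (a n))"
      using eventually_gt_at_top[of 0]
    proof eventually_elim
      case (elim n)
      show ?case
        unfolding a_part using cancel[of "real n"] elim
        by (simp only: mv_scale ip_scale_left ip_scale_right complex_cnj_complex_of_real of_nat_0_less_iff)
    qed
  qed
  have q: "(\<lambda>n. ip (?I n) (d n) (mv (?I n) (R k n) (d n))) \<longlonglongrightarrow> of_real (E.psi c (z k))" for k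
  proof (rule Lim_transform_eventually[OF scale[OF \<tau>(2) Qform[of k] trace2[of k]]])
    show "\<forall>\<^sub>F n in sequentially. complex_of_real ((\<tau>v n * sqrt (real (m n)))\<^sup>2) *
      ((ip (?I n) (part False (\<gamma> n)) (mv (?I n) (R k n) (part False (\<gamma> n))) - (\<Sum>j<m n. R k n (Inr j) (Inr j))) / of_real (real (m n))
        + (\<Sum>j<m n. R k n (Inr j) (Inr j)) / of_real (real (m n))) = ip (?I n) (d n) (mv (?I n) (R k n) (d n))"
      using eventually_gt_at_top[of 0]
    proof eventually_elim
      case (elim n)
      show ?case
        unfolding d_part using cancel[of "real (m n)"] m_pos[OF elim]
        by (simp only: mv_scale ip_scale_left ip_scale_right complex_cnj_complex_of_real of_nat_0_less_iff)
    qed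
  qed
  \<comment> \<open>The hypothesis concerns (d, R a); as R is self-adjoint, the required pairing is
    its conjugate.\<close>
  have e: "(\<lambda>n. ip (?I n) (a n) (mv (?I n) (R k n) (d n))) \<longlonglongrightarrow> 0" for k
  proof -
    have "(\<lambda>n. complex_of_real (\<tau>v n * sqrt (real (m n))) * (complex_of_real (\<tau>u n * sqrt (real n)) *
       (ip (?I n) (part False (\<gamma> n)) (mv (?I n) (R k n) (part True (\<gamma> n))) / of_real (sqrt (real n * real (m n))))))
      \<longlonglongrightarrow> complex_of_real 1 * (complex_of_real 1 * 0)"
      by (intro tendsto_intros \<tau> Eform)
    hence "(\<lambda>n. cnj (complex_of_real (\<tau>v n * sqrt (real (m n))) * (complex_of_real (\<tau>u n * sqrt (real n)) *
       (ip (?I n) (part False (\<gamma> n)) (mv (?I n) (R k n) (part True (\<gamma> n))) / of_real (sqrt (real n * real (m n))))))) \<longlonglongrightarrow> cnj 0"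
      by (intro tendsto_cnj) simp
    moreover have "\<forall>\<^sub>F n in sequentially. cnj (complex_of_real (\<tau>v n * sqrt (real (m n))) * (complex_of_real (\<tau>u n * sqrt (real n)) *
       (ip (?I n) (part False (\<gamma> n)) (mv (?I n) (R k n) (part True (\<gamma> n))) / of_real (sqrt (real n * real (m n))))))
       = ip (?I n) (a n) (mv (?I n) (R k n) (d n))"
      using spiked[of k] eventually_gt_at_top[of 0]
    proof eventually_elim
      case (elim n)
      interpret spiked_resolvent "?I n" "dilation (X n)" "s n" "z k" "R k n" "a n" "d n" "w n" t "hd (singular_values (Xt n))"
        by (rule elim)
      have "ip (?I n) (a n) (K (d n)) = cnj (ip (?I n) (d n) (K (a n)))"
        using ip_sym[of "?I n" "K (a n)" "d n"] by (simp add: ip_res)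
      also have "ip (?I n) (d n) (K (a n)) = of_real (\<tau>v n) * (of_real (\<tau>u n) * ip (?I n) (part False (\<gamma> n)) (K (part True (\<gamma> n))))"
        unfolding a_part d_part by (simp only: mv_scale ip_scale_left ip_scale_right complex_cnj_complex_of_real)
      finally show ?case using elim(2) m_pos[OF elim(2)] by (simp add: real_sqrt_mult)
    qed
    ultimately have "(\<lambda>n. ip (?I n) (a n) (mv (?I n) (R k n) (d n))) \<longlonglongrightarrow> cnj 0"
      by (rule Lim_transform_eventually)
    thus ?thesis by simp
  qed

  have nrm_le: "\<forall>\<^sub>F n in sequentially. nrm (?I n) (v n) \<le> 2"
    if "\<And>n. (nrm (?I n) (v n))\<^sup>2 = (\<tau> n)\<^sup>2 * S n" "(\<lambda>n. \<tau> n * sqrt (real (N n))) \<longlonglongrightarrow> 1"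
      "(\<lambda>n. S n / real (N n)) \<longlonglongrightarrow> 1" "\<And>n. 0 < n \<Longrightarrow> 0 < N n" for v \<tau> S N
  proof -
    have "(\<lambda>n. (\<tau> n * sqrt (real (N n)))\<^sup>2 * (S n / real (N n))) \<longlonglongrightarrow> 1\<^sup>2 * 1"
      by (intro tendsto_intros that)
    hence "\<forall>\<^sub>F n in sequentially. (\<tau> n * sqrt (real (N n)))\<^sup>2 * (S n / real (N n)) \<le> 4"
      by (rule eventually_upper) simp
    thus ?thesis using eventually_gt_at_top[of 0]
    proof eventually_elim
      case (elim n)
      have "(nrm (?I n) (v n))\<^sup>2 \<le> 2\<^sup>2"
        using elim that(1)[of n] that(4)[of n] by (simp add: power_mult_distrib)
      thus ?case by (rule power2_le_imp_le) simp
    qed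
  qed
  have a_le: "\<forall>\<^sub>F n in sequentially. nrm (?I n) (a n) \<le> 2"
    by (rule nrm_le[OF _ \<tau>(1) norms(1)])
      (simp_all add: nrm_sq sum_idx a_def norm_mult power_mult_distrib sum_distrib_left)
  have d_le: "\<forall>\<^sub>F n in sequentially. nrm (?I n) (d n) \<le> 2"
    by (rule nrm_le[OF _ \<tau>(2) norms(2)])
      (simp_all add: nrm_sq sum_idx d_def norm_mult power_mult_distrib sum_distrib_left m_pos)
  have w_norm: "\<forall>\<^sub>F n in sequentially. (nrm (?I n) (w n))\<^sup>2 = 2"
    using eventually_gt_at_top[of 0] by eventually_elim (simp add: nrm_sq sum_idx w_def unit)

  note concl = spiked_eigenvector_delocalization[OF spiked edge[folded s_def] z(1,2) z_lim w_norm a_le d_le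
    tendsto_Re_of_real[OF p] tendsto_Re_of_real[OF q] e
    E.phi_pos[OF z(1)] F(2)[OF z(1,3)] E.psi_pos[OF c(1,2) z(1)] E.psi_decreasing[OF c(1,2) z(1,2)] F(1)[OF z(1)]
    E.phi_slope_at_top[OF deriv z(1,2) z_lim]]
  show "(\<lambda>n. \<Sum>i<n. cnj (of_real (\<tau>u n) * \<gamma>u n i) * x n i) \<longlonglongrightarrow> 0"
    using concl(1) by (simp add: ip_def sum_idx a_def w_def)
  show "(\<lambda>n. \<Sum>j<m n. cnj (of_real (\<tau>v n) * \<gamma>v n j) * y n j) \<longlonglongrightarrow> 0"
    using concl(2) by (simp add: ip_def sum_idx d_def w_def)
qed

section \<open>The two perturbation models\<close>

lemma model_vec_eq:
  fixes g :: "'a::real_or_complex vec"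
  shows "model_vec model g = of_real (case model of IID \<Rightarrow> 1 / sqrt (dim_vec g) | Orthonormalized \<Rightarrow> 1 / vnorm g) \<cdot>\<^sub>v g"
  by (cases model) simp_all

lemma vnorm_sq: "(vnorm g)\<^sup>2 = (\<Sum>i<dim_vec g. (norm (g $ i))\<^sup>2)"
  by (simp add: vnorm_def sum_nonneg)

text \<open>In the i.i.d. model the product is exactly 1 as soon as N n > 0; in the orthonormalized
  model it is the inverse square root of |g|^2 / N.\<close>

lemma model_scale_tendsto:
  fixes g :: "nat \<Rightarrow> 'a::real_or_complex vec"
  assumes dim: "\<And>n. dim_vec (g n) = N n" and N: "\<forall>\<^sub>F n in sequentially. 0 < N n"
    and lim: "(\<lambda>n. (vnorm (g n))\<^sup>2 / real (N n)) \<longlonglongrightarrow> 1"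
  shows "(\<lambda>n. (case model of IID \<Rightarrow> 1 / sqrt (dim_vec (g n)) | Orthonormalized \<Rightarrow> 1 / vnorm (g n)) * sqrt (real (N n))) \<longlonglongrightarrow> 1"
proof (cases model)
  case IID
  show ?thesis
    by (rule tendsto_eventually, rule eventually_mono[OF N]) (simp add: IID dim)
next
  case Orthonormalized
  have "(\<lambda>n. 1 / sqrt ((vnorm (g n))\<^sup>2 / real (N n))) \<longlonglongrightarrow> 1 / sqrt 1"
    by (intro tendsto_intros lim) simp
  moreover have "1 / sqrt ((vnorm (g n))\<^sup>2 / real (N n)) = 1 / vnorm (g n) * sqrt (real (N n))" for n
    by (simp add: real_sqrt_divide vnorm_nonneg)
  ultimately show ?thesis by (simp add: Orthonormalized)
qed

lemma vnorm_model_tendsto: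
  fixes g :: "nat \<Rightarrow> 'a::real_or_complex vec" and \<tau> :: "nat \<Rightarrow> real"
  assumes N: "\<forall>\<^sub>F n in sequentially. 0 < N n"
    and lim: "(\<lambda>n. (vnorm (g n))\<^sup>2 / real (N n)) \<longlonglongrightarrow> 1" and \<tau>: "(\<lambda>n. \<tau> n * sqrt (real (N n))) \<longlonglongrightarrow> 1"
  shows "(\<lambda>n. vnorm (of_real (\<tau> n) \<cdot>\<^sub>v g n)) \<longlonglongrightarrow> 1"
proof (rule Lim_transform_eventually)
  have "(\<lambda>n. \<bar>\<tau> n * sqrt (real (N n))\<bar> * sqrt ((vnorm (g n))\<^sup>2 / real (N n))) \<longlonglongrightarrow> \<bar>1\<bar> * sqrt 1"
    by (intro tendsto_intros lim \<tau>)
  thus "(\<lambda>n. \<bar>\<tau> n * sqrt (real (N n))\<bar> * sqrt ((vnorm (g n))\<^sup>2 / real (N n))) \<longlonglongrightarrow> 1" by simp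
  show "\<forall>\<^sub>F n in sequentially. \<bar>\<tau> n * sqrt (real (N n))\<bar> * sqrt ((vnorm (g n))\<^sup>2 / real (N n)) = vnorm (of_real (\<tau> n) \<cdot>\<^sub>v g n)"
    using N by (rule eventually_mono) (simp add: vnorm_smult abs_mult real_sqrt_divide vnorm_nonneg)
qed

text \<open>The formula for the projection needs nonzero u and v, which holds for large n because
  both norms tend to 1.\<close>

lemma proj_norm_tendsto_0:
  fixes u x :: "nat \<Rightarrow> 'a::real_or_complex vec" and v :: "nat \<Rightarrow> 'a vec" and F :: "nat \<Rightarrow> 'a vec set"
  assumes form: "\<And>n. 0 < n \<Longrightarrow> vnorm (u n) \<noteq> 0 \<Longrightarrow> vnorm (v n) \<noteq> 0 \<Longrightarrow>
      proj_norm (x n) (F n) = norm (\<Sum>i<N n. conjugate (u n $ i) * x n $ i) / vnorm (u n)"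
    and u: "(\<lambda>n. vnorm (u n)) \<longlonglongrightarrow> 1" and v: "(\<lambda>n. vnorm (v n)) \<longlonglongrightarrow> 1"
    and lim: "(\<lambda>n. cemb (\<Sum>i<N n. conjugate (u n $ i) * x n $ i)) \<longlonglongrightarrow> 0"
  shows "(\<lambda>n. proj_norm (x n) (F n)) \<longlonglongrightarrow> 0"
proof -
  have "(\<lambda>n. norm (\<Sum>i<N n. conjugate (u n $ i) * x n $ i) / vnorm (u n)) \<longlonglongrightarrow> 0 / 1"
    using tendsto_norm_zero[OF lim] by (intro tendsto_divide u) simp_all
  moreover have "\<forall>\<^sub>F n in sequentially. norm (\<Sum>i<N n. conjugate (u n $ i) * x n $ i) / vnorm (u n) = proj_norm (x n) (F n)"
    using order_tendstoD(1)[OF u, of 0, simplified] order_tendstoD(1)[OF v, of 0, simplified] eventually_gt_at_top[of 0]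
    by eventually_elim (simp add: form)
  ultimately show ?thesis using Lim_transform_eventually by fastforce
qed

lemma unit_noise_cemb:
  fixes \<nu> :: "'a::real_or_complex measure"
  assumes \<nu>: "prob_space \<nu>" "sets \<nu> = sets borel" and mean: "has_bochner_integral \<nu> (\<lambda>x. x) 0"
    and var: "has_bochner_integral \<nu> (\<lambda>x. (norm x)\<^sup>2) (1 :: real)" and ls: "log_sobolev \<nu>"
  shows "unit_noise \<nu> (cemb :: 'a \<Rightarrow> complex)"
proof -
  interpret prob_space \<nu> by (rule \<nu>)
  show ?thesis
  proof
    show "cemb \<in> borel_measurable \<nu>"
      using borel_measurable_cemb measurable_cong_sets[OF \<nu>(2) refl] by blast
    show "integrable \<nu> (\<lambda>x. cmod (cemb x) ^ 8)"
      using log_sobolev_integrable_norm_power[OF \<nu> ls, of 4] var by (simp add: has_bochner_integral_iff)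
    show "expectation cemb = 0"
      using has_bochner_integral_bounded_linear[OF bounded_linear_cemb mean] has_bochner_integral_integral_eq by fastforce
    show "expectation (\<lambda>x. (cmod (cemb x))\<^sup>2) = 1"
      using has_bochner_integral_integral_eq[OF var] by simp
  qed
qed

text \<open>The threshold condition is imposed on \<theta>1, which is the almost sure limit of
  \<open>\<theta> n\<close> in either model since the norms of u and v tend to 1.\<close>

theorem theorem2p10:
  fixes M :: "'w measure"
    and m :: "nat \<Rightarrow> nat"
    and c b \<theta>1 :: real
    and X P Xt :: "nat \<Rightarrow> 'w \<Rightarrow> 'a::real_or_complex mat"
    and Gu Gv u v ut vt :: "nat \<Rightarrow> 'w \<Rightarrow> 'a vec"
    and \<mu> :: "real measure"
    and \<nu> :: "'a measure"
    and model :: perturbation_model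
    and \<theta> :: "nat \<Rightarrow> 'w \<Rightarrow> real"
  assumes M: "prob_space M"
    and m_ge: "\<And>n. n \<le> m n"
    and c: "0 \<le> c" "c \<le> 1" "(\<lambda>n. real n / real (m n)) \<longlonglongrightarrow> c"
    and X_dim: "\<And>n \<omega>. \<omega> \<in> space M \<Longrightarrow> X n \<omega> \<in> carrier_mat n (m n)"
    and \<mu>: "real_distribution \<mu>" "compact (msupport \<mu>)"
    and b: "b = Sup (msupport \<mu>)"
    and X_weak: "AE \<omega> in M. weak_conv_m (\<lambda>n. empirical_sv (X n \<omega>)) \<mu>"
    and X_edge: "AE \<omega> in M. (\<lambda>n. hd (singular_values (X n \<omega>))) \<longlonglongrightarrow> b"
    and \<nu>: "prob_space \<nu>" "sets \<nu> = sets borel"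
    and \<nu>_mean: "has_bochner_integral \<nu> (\<lambda>x. x) 0"
    and \<nu>_variance: "has_bochner_integral \<nu> (\<lambda>x. (norm x)\<^sup>2) (1 :: real)"
    and \<nu>_log_sobolev: "log_sobolev \<nu>"
    and G_dim: "\<And>n \<omega>. \<omega> \<in> space M \<Longrightarrow> Gu n \<omega> \<in> carrier_vec n"
      "\<And>n \<omega>. \<omega> \<in> space M \<Longrightarrow> Gv n \<omega> \<in> carrier_vec (m n)"
    and G_indep: "\<And>n. prob_space.indep_vars M (\<lambda>_. borel)
      (\<lambda>k \<omega>. entries (Gu n \<omega>) (Gv n \<omega>) k) ({..<n} <+> {..<m n})"
    and G_law: "\<And>n k. k \<in> {..<n} <+> {..<m n} \<Longrightarrow>
      distr M borel (\<lambda>\<omega>. entries (Gu n \<omega>) (Gv n \<omega>) k) = \<nu>"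
    and G_X_indep: "\<And>n. prob_space.indep_set M
      (sets (vimage_algebra (space M) (\<lambda>\<omega>. \<lambda>p\<in>{..<n} \<times> {..<m n}. X n \<omega> $$ p)
        (Pi\<^sub>M ({..<n} \<times> {..<m n}) (\<lambda>_. borel))))
      (sets (vimage_algebra (space M)
        (\<lambda>\<omega>. \<lambda>k\<in>{..<n} <+> {..<m n}. entries (Gu n \<omega>) (Gv n \<omega>) k)
        (Pi\<^sub>M ({..<n} <+> {..<m n}) (\<lambda>_. borel))))"
    and u: "\<And>n \<omega>. u n \<omega> = model_vec model (Gu n \<omega>)"
    and v: "\<And>n \<omega>. v n \<omega> = model_vec model (Gv n \<omega>)"
    and P: "\<And>n \<omega>. P n \<omega> = rank_one_mat \<theta>1 (u n \<omega>) (v n \<omega>)"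
    and Xt: "\<And>n \<omega>. Xt n \<omega> = X n \<omega> + P n \<omega>"
    and \<theta>: "\<And>n \<omega>. \<theta> n \<omega> = \<theta>1 * vnorm (u n \<omega>) * vnorm (v n \<omega>)"
    and \<theta>1_pos: "0 < \<theta>1"
    and subcritical: "\<theta>1 \<le> theta_bar c \<mu> b"
    and phi_deriv: "filterlim (deriv (phi \<mu>)) at_bot (at_right b)"
    and ut_vt: "\<And>n \<omega>. 0 < n \<Longrightarrow> \<omega> \<in> space M \<Longrightarrow>
      singular_vectors (Xt n \<omega>) (hd (singular_values (Xt n \<omega>))) (ut n \<omega>) (vt n \<omega>)"
  shows "(AE \<omega> in M. (\<lambda>n. proj_norm (ut n \<omega>)
      (mat_kernel (of_real ((\<theta> n \<omega>)\<^sup>2) \<cdot>\<^sub>m 1\<^sub>m n - P n \<omega> * mat_adjoint (P n \<omega>)))) \<longlonglongrightarrow> 0)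
    \<and> (AE \<omega> in M. (\<lambda>n. proj_norm (vt n \<omega>)
      (mat_kernel (of_real ((\<theta> n \<omega>)\<^sup>2) \<cdot>\<^sub>m 1\<^sub>m (m n) - mat_adjoint (P n \<omega>) * P n \<omega>))) \<longlonglongrightarrow> 0)"
proof -
  interpret M: prob_space M by (rule M)
  interpret N: unit_noise \<nu> "cemb :: 'a \<Rightarrow> complex"
    by (rule unit_noise_cemb[OF \<nu> \<nu>_mean \<nu>_variance \<nu>_log_sobolev])
  let ?I = "\<lambda>n. idx n (m n)"
  define Y where "Y n \<omega> = (\<lambda>p\<in>{..<n} \<times> {..<m n}. X n \<omega> $$ p)" for n \<omega>
  define G where "G n \<omega> = (\<lambda>k\<in>?I n. entries (Gu n \<omega>) (Gv n \<omega>) k)" for n \<omega>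
  define S where "S n = Pi\<^sub>M ({..<n} \<times> {..<m n}) (\<lambda>_. borel :: 'a measure)" for n
  have Y_space: "Y n \<in> space M \<rightarrow> space (S n)" for n
    by (auto simp: Y_def S_def space_PiM)
  have prod_law: "Y n \<in> measurable M (S n)" "G n \<in> measurable M (Pi\<^sub>M (?I n) (\<lambda>_. \<nu>))"
    "distr M (S n \<Otimes>\<^sub>M Pi\<^sub>M (?I n) (\<lambda>_. \<nu>)) (\<lambda>\<omega>. (Y n \<omega>, G n \<omega>)) = distr M (S n) (Y n) \<Otimes>\<^sub>M Pi\<^sub>M (?I n) (\<lambda>_. \<nu>)"
    if "0 < n" for n
  proof -
    have ne: "?I n \<noteq> {}" using that by (auto simp: idx_def)
    have ind: "M.indep_set (sets (vimage_algebra (space M) (Y n) (S n)))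
      (sets (vimage_algebra (space M) (\<lambda>\<omega>. \<lambda>k\<in>?I n. entries (Gu n \<omega>) (Gv n \<omega>) k) (Pi\<^sub>M (?I n) (\<lambda>_. borel))))"
      using G_X_indep[of n] unfolding Y_def[abs_def] S_def idx_def .
    note law = M.independent_product_law[OF ne G_indep[of n, folded idx_def] G_law[of _ n, folded idx_def] \<nu>(2) Y_space ind]
    show "Y n \<in> measurable M (S n)" "G n \<in> measurable M (Pi\<^sub>M (?I n) (\<lambda>_. \<nu>))"
      "distr M (S n \<Otimes>\<^sub>M Pi\<^sub>M (?I n) (\<lambda>_. \<nu>)) (\<lambda>\<omega>. (Y n \<omega>, G n \<omega>)) = distr M (S n) (Y n) \<Otimes>\<^sub>M Pi\<^sub>M (?I n) (\<lambda>_. \<nu>)"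
      unfolding G_def[abs_def] by (rule law; assumption)+
  qed
  have AE_form: "AE \<omega> in M. (\<forall>\<^sub>F n in sequentially. N.hs2 (?I n) (block s' t' (F n (Y n \<omega>))) \<le> B * wt n) \<longrightarrow>
      (\<lambda>n. N.qform (?I n) (block s' t' (F n (Y n \<omega>))) (G n \<omega>) / of_real (wt n)) \<longlonglongrightarrow> 0"
    if F: "\<And>n p q. p \<in> ?I n \<Longrightarrow> q \<in> ?I n \<Longrightarrow> (\<lambda>y. F n y p q) \<in> borel_measurable (S n)"
      and wt: "\<And>n. 0 < n \<Longrightarrow> real n \<le> wt n" for s' t' F wt B
  proof (rule N.AE_qform_tendsto_0[OF M finite_idx prod_law _ wt])
    fix n p q assume "p \<in> ?I n" "q \<in> ?I n"
    thus "(\<lambda>y. block s' t' (F n y) p q) \<in> borel_measurable (S n)"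
      unfolding block_def using F by (cases "isl p = s' \<and> isl q = t'") auto
  qed
  let ?R = "\<lambda>k n y. dilation_resolvent (b + 1 / real (Suc k)) (entry_mat n (m n) y)"
  have Rm: "(\<lambda>y. ?R k n y p q) \<in> borel_measurable (S n)" if "p \<in> ?I n" "q \<in> ?I n" for k n p q
    unfolding S_def by (rule borel_measurable_dilation_resolvent[OF that])
  \<comment> \<open>The identity kernel: concentration of its two diagonal blocks is the law of
    large numbers for the squared norms of the noise vectors.\<close>
  define \<delta> :: "nat + nat \<Rightarrow> nat + nat \<Rightarrow> complex" where "\<delta> p q = (if p = q then 1 else 0)" for p q
  \<comment> \<open>Eventually the largest singular value is below the midpoint of b and z = b +
    1/(k+1), so the gap is at least 1 / (2 (k+1)) and its inverse square at most this.\<close>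
  define B where "B k = 4 * (real (Suc k))\<^sup>2" for k
  have wt: "real n \<le> real n" "real n \<le> real (m n)" "real n \<le> sqrt (real n * real (m n))" for n
  proof -
    show nm: "real n \<le> real (m n)" using m_ge[of n] by simp
    have "(real n)\<^sup>2 \<le> real n * real (m n)" using nm by (simp add: power2_eq_square mult_left_mono)
    thus "real n \<le> sqrt (real n * real (m n))" by (rule real_le_rsqrt)
  qed simp
  \<comment> \<open>Countably many k share one null set.\<close>
  have 1: "AE \<omega> in M. \<forall>k. (\<forall>\<^sub>F n in sequentially. N.hs2 (?I n) (block True True (?R k n (Y n \<omega>))) \<le> B k * real n) \<longrightarrow>
      (\<lambda>n. N.qform (?I n) (block True True (?R k n (Y n \<omega>))) (G n \<omega>) / of_real (real n)) \<longlonglongrightarrow> 0"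
    unfolding AE_all_countable by (intro allI AE_form Rm wt)
  have 2: "AE \<omega> in M. \<forall>k. (\<forall>\<^sub>F n in sequentially. N.hs2 (?I n) (block False False (?R k n (Y n \<omega>))) \<le> B k * real (m n)) \<longrightarrow>
      (\<lambda>n. N.qform (?I n) (block False False (?R k n (Y n \<omega>))) (G n \<omega>) / of_real (real (m n))) \<longlonglongrightarrow> 0"
    unfolding AE_all_countable by (intro allI AE_form Rm wt)
  have 3: "AE \<omega> in M. \<forall>k. (\<forall>\<^sub>F n in sequentially. N.hs2 (?I n) (block False True (?R k n (Y n \<omega>))) \<le> B k * sqrt (real n * real (m n))) \<longrightarrow>
      (\<lambda>n. N.qform (?I n) (block False True (?R k n (Y n \<omega>))) (G n \<omega>) / of_real (sqrt (real n * real (m n)))) \<longlonglongrightarrow> 0"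
    unfolding AE_all_countable by (intro allI AE_form Rm wt)
  have 4: "AE \<omega> in M. (\<forall>\<^sub>F n in sequentially. N.hs2 (?I n) (block True True \<delta>) \<le> 1 * real n) \<longrightarrow>
      (\<lambda>n. N.qform (?I n) (block True True \<delta>) (G n \<omega>) / of_real (real n)) \<longlonglongrightarrow> 0"
    by (rule AE_form[of "\<lambda>_ _. \<delta>"]) (simp_all add: wt m_ge)
  have 5: "AE \<omega> in M. (\<forall>\<^sub>F n in sequentially. N.hs2 (?I n) (block False False \<delta>) \<le> 1 * real (m n)) \<longrightarrow>
      (\<lambda>n. N.qform (?I n) (block False False \<delta>) (G n \<omega>) / of_real (real (m n))) \<longlonglongrightarrow> 0"
    by (rule AE_form[of "\<lambda>_ _. \<delta>"]) (simp_all add: wt m_ge)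
  have \<delta>_hs: "(\<Sum>p\<in>?I n. (cmod (\<delta> p q))\<^sup>2) \<le> 1" if "q \<in> ?I n" for n q
    using that by (simp add: \<delta>_def if_distrib[of cmod] if_distrib[of "\<lambda>x. x\<^sup>2"] cong: if_cong)

  have "AE \<omega> in M.
     (\<lambda>n. proj_norm (ut n \<omega>) (mat_kernel (of_real ((\<theta> n \<omega>)\<^sup>2) \<cdot>\<^sub>m 1\<^sub>m n - P n \<omega> * mat_adjoint (P n \<omega>)))) \<longlonglongrightarrow> 0 \<and>
     (\<lambda>n. proj_norm (vt n \<omega>) (mat_kernel (of_real ((\<theta> n \<omega>)\<^sup>2) \<cdot>\<^sub>m 1\<^sub>m (m n) - mat_adjoint (P n \<omega>) * P n \<omega>))) \<longlonglongrightarrow> 0"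
    using X_weak X_edge 1 2 3 4 5 AE_space
  proof eventually_elim
    case (elim \<omega>)
    \<comment> \<open>The outcome is fixed from here on and the argument is deterministic; the
      chosen singular vectors enter only now.\<close>
    note \<omega> = elim(8)
    define Xc where "Xc n = map_mat cemb (X n \<omega>)" for n
    define Xtc where "Xtc n = map_mat cemb (Xt n \<omega>)" for n
    define \<gamma>u where "\<gamma>u n i = cemb (Gu n \<omega> $ i)" for n i
    define \<gamma>v where "\<gamma>v n j = cemb (Gv n \<omega> $ j)" for n j
    define \<gamma> where "\<gamma> n = case_sum (\<gamma>u n) (\<gamma>v n)" for n
    define \<tau>u where "\<tau>u n = (case model of IID \<Rightarrow> 1 / sqrt (dim_vec (Gu n \<omega>)) | Orthonormalized \<Rightarrow> 1 / vnorm (Gu n \<omega>))" for n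
    define \<tau>v where "\<tau>v n = (case model of IID \<Rightarrow> 1 / sqrt (dim_vec (Gv n \<omega>)) | Orthonormalized \<Rightarrow> 1 / vnorm (Gv n \<omega>))" for n
    have u_eq: "u n \<omega> = of_real (\<tau>u n) \<cdot>\<^sub>v Gu n \<omega>" and v_eq: "v n \<omega> = of_real (\<tau>v n) \<cdot>\<^sub>v Gv n \<omega>" for n
      unfolding u v \<tau>u_def \<tau>v_def by (rule model_vec_eq)+
    have dims: "X n \<omega> \<in> carrier_mat n (m n)" "Gu n \<omega> \<in> carrier_vec n" "Gv n \<omega> \<in> carrier_vec (m n)" for n
      using X_dim G_dim \<omega> by auto
    have dv: "dim_vec (Gu n \<omega>) = n" "dim_vec (Gv n \<omega>) = m n" for n
      using dims(2,3)[of n] by simp_all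
    have uv_dims: "u n \<omega> \<in> carrier_vec n" "v n \<omega> \<in> carrier_vec (m n)" for n
      using dims by (simp_all add: u_eq v_eq)
    have P_dim: "P n \<omega> \<in> carrier_mat n (m n)" for n
      using uv_dims by (auto simp: P rank_one_mat_def)
    have Xt_dim: "Xt n \<omega> \<in> carrier_mat n (m n)" for n using dims(1) P_dim by (simp add: Xt)
    have Xc_eq: "entry_mat n (m n) (Y n \<omega>) = Xc n" for n
      using dims(1)[of n] by (intro eq_matI) (auto simp: entry_mat_def Y_def Xc_def)
    have Xc_dim: "Xc n \<in> carrier_mat n (m n)" "Xtc n \<in> carrier_mat n (m n)" for n
      using dims(1) Xt_dim by (simp_all add: Xc_def Xtc_def)
    have sv: "singular_values (Xc n) = singular_values (X n \<omega>)" "singular_values (Xtc n) = singular_values (Xt n \<omega>)" for n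
      unfolding Xc_def Xtc_def by (rule singular_values_map_cemb[OF dims(1)], rule singular_values_map_cemb[OF Xt_dim])
    have G_\<gamma>: "cemb (G n \<omega> p) = \<gamma> n p" if "p \<in> ?I n" for n p
      using that by (cases p) (simp_all add: G_def entries_def \<gamma>_def \<gamma>u_def \<gamma>v_def)
    have qform: "N.qform (?I n) (block s' t' F) (G n \<omega>) = ip (?I n) (part s' (\<gamma> n)) (mv (?I n) F (part t' (\<gamma> n))) - (\<Sum>p\<in>?I n. block s' t' F p p)"
      for n s' t' F
      unfolding N.qform_def block_form[symmetric] by (simp add: G_\<gamma> cong: sum.cong)
    have m_ev: "\<forall>\<^sub>F n in sequentially. 0 < m n"
      using eventually_gt_at_top[of 0] by (rule eventually_mono) (use m_ge in \<open>meson less_le_trans\<close>)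

    have ev_hs: "\<forall>\<^sub>F n in sequentially. \<forall>q\<in>?I n. (\<Sum>p\<in>?I n. (cmod (?R k n (Y n \<omega>) p q))\<^sup>2) \<le> B k" for k
    proof -
      define z where "z = b + 1 / real (Suc k)"
      have bz: "b < z" by (simp add: z_def)
      hence "b < (b + z) / 2" by simp
      from order_tendstoD(2)[OF elim(2) this]
      show ?thesis using eventually_gt_at_top[of 0]
      proof eventually_elim
        case (elim n)
        have lt: "hd (singular_values (Xc n)) < (b + z) / 2" using elim(1) by (simp add: sv)
        have zb: "(b + z) / 2 < z" using bz by simp
        have "1 / (z - hd (singular_values (Xc n)))\<^sup>2 \<le> 1 / (1 / (2 * real (Suc k)))\<^sup>2"
        proof (intro divide_left_mono power_mono)
          have half: "1 / (2 * real (Suc k)) = (z - b) / 2" by (simp add: z_def)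
          show "1 / (2 * real (Suc k)) \<le> z - hd (singular_values (Xc n))"
            unfolding half using lt by (simp add: field_simps)
          have "0 < z - hd (singular_values (Xc n))" using lt zb by linarith
          thus "0 < (z - hd (singular_values (Xc n)))\<^sup>2 * (1 / (2 * real (Suc k)))\<^sup>2" by simp
        qed simp_all
        also have "\<dots> = B k" by (simp add: B_def power_mult_distrib power_divide del: of_nat_Suc)
        finally show ?case
          using hs_dilation_resolvent[OF Xc_dim(1) elim(2), of z] lt zb
          unfolding Xc_eq z_def[symmetric] by (meson less_trans order_trans)
      qed
    qed
    have hs_form: "N.hs2 = (\<lambda>I F. \<Sum>p\<in>I. \<Sum>q\<in>I. (cmod (F p q))\<^sup>2)"
      by (intro ext) (simp add: N.hs2_def)
    have P_lim: "(\<lambda>n. N.qform (?I n) (block True True (?R k n (Y n \<omega>))) (G n \<omega>) / of_real (real n)) \<longlonglongrightarrow> 0" for k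
    proof (rule elim(3)[rule_format], rule eventually_mono[OF ev_hs[of k]])
      fix n assume "\<forall>q\<in>?I n. (\<Sum>p\<in>?I n. (cmod (?R k n (Y n \<omega>) p q))\<^sup>2) \<le> B k"
      from block_hs(1)[of n "m n", OF this[rule_format]]
      show "N.hs2 (?I n) (block True True (?R k n (Y n \<omega>))) \<le> B k * real n"
        by (simp only: hs_form mult.commute)
    qed
    have Q_lim: "(\<lambda>n. N.qform (?I n) (block False False (?R k n (Y n \<omega>))) (G n \<omega>) / of_real (real (m n))) \<longlonglongrightarrow> 0" for k
    proof (rule elim(4)[rule_format], rule eventually_mono[OF ev_hs[of k]])
      fix n assume "\<forall>q\<in>?I n. (\<Sum>p\<in>?I n. (cmod (?R k n (Y n \<omega>) p q))\<^sup>2) \<le> B k"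
      from block_hs(2)[of n "m n", OF this[rule_format]]
      show "N.hs2 (?I n) (block False False (?R k n (Y n \<omega>))) \<le> B k * real (m n)"
        by (simp only: hs_form mult.commute)
    qed
    \<comment> \<open>The mixed block has n nonzero columns, and n \<le> sqrt(n m) because n \<le>
      m.\<close>
    have E_lim: "(\<lambda>n. N.qform (?I n) (block False True (?R k n (Y n \<omega>))) (G n \<omega>) / of_real (sqrt (real n * real (m n)))) \<longlonglongrightarrow> 0" for k
    proof (rule elim(5)[rule_format], rule eventually_mono[OF ev_hs[of k]])
      fix n assume "\<forall>q\<in>?I n. (\<Sum>p\<in>?I n. (cmod (?R k n (Y n \<omega>) p q))\<^sup>2) \<le> B k"
      from block_hs(1)[of n "m n", OF this[rule_format]]
      have "N.hs2 (?I n) (block False True (?R k n (Y n \<omega>))) \<le> real n * B k"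
        by (simp only: hs_form)
      also have "\<dots> \<le> sqrt (real n * real (m n)) * B k"
        by (intro mult_right_mono wt) (simp add: B_def)
      finally show "N.hs2 (?I n) (block False True (?R k n (Y n \<omega>))) \<le> B k * sqrt (real n * real (m n))"
        by (simp only: mult.commute)
    qed
    have mv_\<delta>: "mv (?I n) \<delta> y p = y p" if "p \<in> ?I n" for n y p
    proof -
      have "mv (?I n) \<delta> y p = (\<Sum>q\<in>?I n. if p = q then y q else 0)"
        unfolding mv_def \<delta>_def by (intro sum.cong) auto
      thus ?thesis using that by simp
    qed
    have ip_\<delta>: "ip (?I n) y (mv (?I n) \<delta> y) = of_real ((nrm (?I n) y)\<^sup>2)" for n y
      unfolding ip_self[symmetric] by (rule ip_cong) (simp_all add: mv_\<delta>)
    \<comment> \<open>The form of the identity block is the squared norm of the noise minus n, so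
      its concentration adds up to the limit 1.\<close>
    have Nu: "(\<lambda>n. (\<Sum>i<n. (cmod (\<gamma>u n i))\<^sup>2) / real n) \<longlonglongrightarrow> 1"
    proof -
      have "(\<lambda>n. N.qform (?I n) (block True True \<delta>) (G n \<omega>) / of_real (real n)) \<longlonglongrightarrow> of_real 0"
        using elim(6) block_hs(1)[of _ _ \<delta> 1 True, OF \<delta>_hs] by (simp add: hs_form)
      from tendsto_add[OF tendsto_Re_of_real[OF this] tendsto_const[of 1]]
      have "(\<lambda>n. Re (N.qform (?I n) (block True True \<delta>) (G n \<omega>) / of_real (real n)) + 1) \<longlonglongrightarrow> 1" by simp
      moreover have "\<forall>\<^sub>F n in sequentially. Re (N.qform (?I n) (block True True \<delta>) (G n \<omega>) / of_real (real n)) + 1 = (\<Sum>i<n. (cmod (\<gamma>u n i))\<^sup>2) / real n"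
        using eventually_gt_at_top[of 0]
      proof eventually_elim
        case (elim n)
        have "N.qform (?I n) (block True True \<delta>) (G n \<omega>) = of_real ((\<Sum>i<n. (cmod (\<gamma>u n i))\<^sup>2) - real n)"
          unfolding qform ip_\<delta> block_trace nrm_sq by (simp add: \<delta>_def sum_idx part_def \<gamma>_def)
        hence "Re (N.qform (?I n) (block True True \<delta>) (G n \<omega>) / of_real (real n)) = ((\<Sum>i<n. (cmod (\<gamma>u n i))\<^sup>2) - real n) / real n"
          by (simp only: of_real_divide[symmetric] Re_complex_of_real)
        thus ?case using elim by (simp add: diff_divide_distrib)
      qed
      ultimately show ?thesis by (rule Lim_transform_eventually)
    qed
    have Nv: "(\<lambda>n. (\<Sum>j<m n. (cmod (\<gamma>v n j))\<^sup>2) / real (m n)) \<longlonglongrightarrow> 1"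
    proof -
      have "(\<lambda>n. N.qform (?I n) (block False False \<delta>) (G n \<omega>) / of_real (real (m n))) \<longlonglongrightarrow> of_real 0"
        using elim(7) block_hs(2)[of _ _ \<delta> 1 False, OF \<delta>_hs] by (simp add: hs_form)
      from tendsto_add[OF tendsto_Re_of_real[OF this] tendsto_const[of 1]]
      have "(\<lambda>n. Re (N.qform (?I n) (block False False \<delta>) (G n \<omega>) / of_real (real (m n))) + 1) \<longlonglongrightarrow> 1" by simp
      moreover have "\<forall>\<^sub>F n in sequentially. Re (N.qform (?I n) (block False False \<delta>) (G n \<omega>) / of_real (real (m n))) + 1 = (\<Sum>j<m n. (cmod (\<gamma>v n j))\<^sup>2) / real (m n)"
        using m_ev
      proof eventually_elim
        case (elim n)
        have "N.qform (?I n) (block False False \<delta>) (G n \<omega>) = of_real ((\<Sum>j<m n. (cmod (\<gamma>v n j))\<^sup>2) - real (m n))"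
          unfolding qform ip_\<delta> block_trace nrm_sq by (simp add: \<delta>_def sum_idx part_def \<gamma>_def)
        hence "Re (N.qform (?I n) (block False False \<delta>) (G n \<omega>) / of_real (real (m n))) = ((\<Sum>j<m n. (cmod (\<gamma>v n j))\<^sup>2) - real (m n)) / real (m n)"
          by (simp only: of_real_divide[symmetric] Re_complex_of_real)
        thus ?case using elim by (simp add: diff_divide_distrib)
      qed
      ultimately show ?thesis by (rule Lim_transform_eventually)
    qed
    have vn: "(\<lambda>n. (vnorm (Gu n \<omega>))\<^sup>2 / real n) \<longlonglongrightarrow> 1" "(\<lambda>n. (vnorm (Gv n \<omega>))\<^sup>2 / real (m n)) \<longlonglongrightarrow> 1"
      using Nu Nv by (simp_all add: vnorm_sq \<gamma>u_def \<gamma>v_def dv)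
    have \<tau>_lim: "(\<lambda>n. \<tau>u n * sqrt (real n)) \<longlonglongrightarrow> 1" "(\<lambda>n. \<tau>v n * sqrt (real (m n))) \<longlonglongrightarrow> 1"
      unfolding \<tau>u_def \<tau>v_def
      by (intro model_scale_tendsto vn m_ev eventually_gt_at_top dv)+
    have uv_lim: "(\<lambda>n. vnorm (u n \<omega>)) \<longlonglongrightarrow> 1" "(\<lambda>n. vnorm (v n \<omega>)) \<longlonglongrightarrow> 1"
      unfolding u_eq v_eq by (rule vnorm_model_tendsto[OF eventually_gt_at_top vn(1) \<tau>_lim(1)],
        rule vnorm_model_tendsto[OF m_ev vn(2) \<tau>_lim(2)])

    have vecs: "ut n \<omega> \<in> carrier_vec n" "vt n \<omega> \<in> carrier_vec (m n)" "vnorm (ut n \<omega>) = 1" "vnorm (vt n \<omega>) = 1"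
      "Xt n \<omega> *\<^sub>v vt n \<omega> = of_real (hd (singular_values (Xt n \<omega>))) \<cdot>\<^sub>v ut n \<omega>"
      "mat_adjoint (Xt n \<omega>) *\<^sub>v ut n \<omega> = of_real (hd (singular_values (Xt n \<omega>))) \<cdot>\<^sub>v vt n \<omega>" if "0 < n" for n
      using ut_vt[OF that \<omega>] Xt_dim[of n] by (auto simp: singular_vectors_def)
    have left: "(\<Sum>j<m n. Xtc n $$ (i, j) * cemb (vt n \<omega> $ j)) = of_real (hd (singular_values (Xtc n))) * cemb (ut n \<omega> $ i)"
      if "i < n" for n i
    proof -
      have n: "0 < n" using that by simp
      have "(\<Sum>j<m n. Xt n \<omega> $$ (i, j) * vt n \<omega> $ j) = (Xt n \<omega> *\<^sub>v vt n \<omega>) $ i"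
        using that Xt_dim[of n] vecs(2)[OF n] by (simp add: scalar_prod_def lessThan_atLeast0)
      also have "\<dots> = of_real (hd (singular_values (Xt n \<omega>))) * ut n \<omega> $ i"
        using that vecs(1)[OF n] by (simp add: vecs(5)[OF n])
      finally have "cemb (\<Sum>j<m n. Xt n \<omega> $$ (i, j) * vt n \<omega> $ j) = cemb (of_real (hd (singular_values (Xt n \<omega>))) * ut n \<omega> $ i)" by simp
      thus ?thesis unfolding sv using that Xt_dim[of n] by (simp add: cemb_sum Xtc_def)
    qed
    have right: "(\<Sum>i<n. cnj (Xtc n $$ (i, j)) * cemb (ut n \<omega> $ i)) = of_real (hd (singular_values (Xtc n))) * cemb (vt n \<omega> $ j)"
      if n: "0 < n" and "j < m n" for n j
    proof -
      have "(\<Sum>i<n. conjugate (Xt n \<omega> $$ (i, j)) * ut n \<omega> $ i) = (mat_adjoint (Xt n \<omega>) *\<^sub>v ut n \<omega>) $ j"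
        using that Xt_dim[of n] vecs(1)[OF n] by (simp add: scalar_prod_def lessThan_atLeast0)
      also have "\<dots> = of_real (hd (singular_values (Xt n \<omega>))) * vt n \<omega> $ j"
        using that vecs(2)[OF n] by (simp add: vecs(6)[OF n])
      finally have "cemb (\<Sum>i<n. conjugate (Xt n \<omega> $$ (i, j)) * ut n \<omega> $ i) = cemb (of_real (hd (singular_values (Xt n \<omega>))) * vt n \<omega> $ j)" by simp
      thus ?thesis unfolding sv using that Xt_dim[of n] by (simp add: cemb_sum Xtc_def)
    qed
    have Xtc_entry: "Xtc n $$ (i, j) = Xc n $$ (i, j) + of_real \<theta>1 * (of_real (\<tau>u n) * \<gamma>u n i) * cnj (of_real (\<tau>v n) * \<gamma>v n j)"
      if "i < n" "j < m n" for n i j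
    proof -
      have "Xt n \<omega> $$ (i, j) = X n \<omega> $$ (i, j) + of_real \<theta>1 * (of_real (\<tau>u n) * Gu n \<omega> $ i) * conjugate (of_real (\<tau>v n) * Gv n \<omega> $ j)"
        using that dims[of n] by (simp add: Xt P u_eq v_eq rank_one_mat_def dv)
      hence "cemb (Xt n \<omega> $$ (i, j)) = cemb (X n \<omega> $$ (i, j) + of_real \<theta>1 * (of_real (\<tau>u n) * Gu n \<omega> $ i) * conjugate (of_real (\<tau>v n) * Gv n \<omega> $ j))" by simp
      thus ?thesis using that dims(1)[of n] Xt_dim[of n] by (simp add: Xtc_def Xc_def \<gamma>u_def \<gamma>v_def)
    qed
    have unit: "(\<Sum>i<n. (cmod (cemb (ut n \<omega> $ i)))\<^sup>2) = 1" "(\<Sum>j<m n. (cmod (cemb (vt n \<omega> $ j)))\<^sup>2) = 1" if "0 < n" for n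
      using vnorm_sq[of "ut n \<omega>"] vnorm_sq[of "vt n \<omega>"] vecs(1-4)[OF that] by simp_all
    have weak: "weak_conv_m (\<lambda>n. empirical_sv (Xc n)) \<mu>"
      using elim(1) by (simp add: empirical_sv_def sv)
    have edge: "(\<lambda>n. hd (singular_values (Xc n))) \<longlonglongrightarrow> b" using elim(2) by (simp add: sv)
    note concl = singular_vectors_delocalized[of Xc m c \<mu> b \<theta>1 Xtc \<tau>u \<gamma>u \<tau>v \<gamma>v "\<lambda>n j. cemb (vt n \<omega> $ j)" "\<lambda>n i. cemb (ut n \<omega> $ i)",
      OF Xc_dim(1) m_ge c \<mu>(1) weak edge \<theta>1_pos subcritical phi_deriv Xc_dim(2) Xtc_entry left right unit \<tau>_lim
        P_lim[unfolded qform block_trace Xc_eq \<gamma>_def] Q_lim[unfolded qform block_trace Xc_eq \<gamma>_def]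
        E_lim[unfolded qform block_trace Xc_eq \<gamma>_def diff_zero] Nu Nv]
    have lim_u: "(\<lambda>n. cemb (\<Sum>i<n. conjugate (u n \<omega> $ i) * ut n \<omega> $ i)) \<longlonglongrightarrow> 0"
      using concl(1) by (simp add: cemb_sum u_eq \<gamma>u_def dv)
    have lim_v: "(\<lambda>n. cemb (\<Sum>j<m n. conjugate (v n \<omega> $ j) * vt n \<omega> $ j)) \<longlonglongrightarrow> 0"
      using concl(2) by (simp add: cemb_sum v_eq \<gamma>v_def dv)
    have form_u: "proj_norm (ut n \<omega>) (mat_kernel (of_real ((\<theta> n \<omega>)\<^sup>2) \<cdot>\<^sub>m 1\<^sub>m n - P n \<omega> * mat_adjoint (P n \<omega>)))
        = norm (\<Sum>i<n. conjugate (u n \<omega> $ i) * ut n \<omega> $ i) / vnorm (u n \<omega>)"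
      if "0 < n" "vnorm (u n \<omega>) \<noteq> 0" "vnorm (v n \<omega>) \<noteq> 0" for n
      unfolding P \<theta>
      by (rule proj_norm_rank_one[OF uv_dims that(2,3) _ vecs(1)[OF that(1)]]) (use \<theta>1_pos in simp)
    have form_v: "proj_norm (vt n \<omega>) (mat_kernel (of_real ((\<theta> n \<omega>)\<^sup>2) \<cdot>\<^sub>m 1\<^sub>m (m n) - mat_adjoint (P n \<omega>) * P n \<omega>))
        = norm (\<Sum>j<m n. conjugate (v n \<omega> $ j) * vt n \<omega> $ j) / vnorm (v n \<omega>)"
      if "0 < n" "vnorm (v n \<omega>) \<noteq> 0" "vnorm (u n \<omega>) \<noteq> 0" for n
    proof -
      have "\<theta> n \<omega> = \<theta>1 * vnorm (v n \<omega>) * vnorm (u n \<omega>)" by (simp add: \<theta>)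
      moreover have "mat_adjoint (P n \<omega>) * P n \<omega> =
          rank_one_mat \<theta>1 (v n \<omega>) (u n \<omega>) * mat_adjoint (rank_one_mat \<theta>1 (v n \<omega>) (u n \<omega>))"
        by (simp add: P adjoint_rank_one_mat)
      ultimately show ?thesis
        by (simp only:) (rule proj_norm_rank_one[OF uv_dims(2,1) that(2,3) _ vecs(2)[OF that(1)]], use \<theta>1_pos in simp)
    qed
    show ?case
      by (rule conjI[OF
        proj_norm_tendsto_0[where u="\<lambda>n. u n \<omega>" and v="\<lambda>n. v n \<omega>" and x="\<lambda>n. ut n \<omega>" and N="\<lambda>n. n", OF form_u uv_lim lim_u]
        proj_norm_tendsto_0[where u="\<lambda>n. v n \<omega>" and v="\<lambda>n. u n \<omega>" and x="\<lambda>n. vt n \<omega>" and N=m, OF form_v uv_lim(2,1) lim_v]])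
  qed
  thus ?thesis by (simp add: AE_conj_iff)
qed

end
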